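(* Let $H$ and $Y$ be Hilbert spaces, $A_0:\mathcal{D}(A_0)\to H$ a strictly positive self-adjoint operator and $C_0\in\mathcal{L}(H,Y)$ such that $C_0^*C_0\in\mathcal{L}(\mathcal{D}(A_0^{3/2}))\cap\mathcal{L}(\mathcal{D}(A_0^{1/2}))$. Let $X=\mathcal{D}(A_0^{1/2})\times H$, $A=\begin{pmatrix}0&I\\ -A_0&0\end{pmatrix}$ with $\mathcal{D}(A)=\mathcal{D}(A_0)\times\mathcal{D}(A_0^{1/2})$, and $C=\begin{bmatrix}0&C_0\end{bmatrix}\in\mathcal{L}(X,Y)$. Assume that the pair $(A,C)$ is exactly observable in time $\tau>0$ and set $\eta:=\|\mathbb{L}_\tau\|_{\mathcal{L}(X)}<1$. Let $(H_h)_{h>0}$ be a family of finite-dimensional subspaces of $\mathcal{D}(A_0^{1/2})$ satisfying the approximation property stated in the context with exponent $\theta>0$. Let $(w_0,w_1)\in\mathcal{D}(A_0^{3/2})\times\mathcal{D}(A_0)$ be the initial value $(w(0),\dot w(0))$ of the system $\ddot w(t)+A_0w(t)=0$ for $t\ge0$, with output $y(t)=C_0\dot w(t)$ for $t\in[0,\tau]$, let $y_h\in L^1([0,\tau],Y)$ be an approximation of $y$, let $N_h$ be a positive integer (truncation parameter), and let $$\begin{bmatrix}w_{0,h}\\ w_{1,h}\end{bmatrix}=\sum_{n=0}^{N_h}\mathbb{L}_{h,\tau}^{n}\begin{bmatrix}w_h^-(0)\\ \dot w_h^-(0)\end{bmatrix}.$$ Then there exist $M>0$ (independent of $\tau$,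 of $(w_0,w_1)$ and of the discretization parameter $h$) and $h^*>0$ such that for all $h\in(0,h^* )$ $$\|w_0-w_{0,h}\|_{1/2}+\|w_1-w_{1,h}\|\le M\left[\left(\frac{\eta^{N_h+1}}{1-\eta}+h^\theta\tau N_h^2\right)\left(\|w_0\|_{3/2}+\|w_1\|_1\right)+N_h\int_0^\tau\|C_0^*(y(s)-y_h(s))\|\,ds\right].$$
   Context: Notation. $\langle\cdot,\cdot\rangle$ and $\|\cdot\|$ are the inner product and norm of $H$; $\|\varphi\|_\alpha=\|A_0^\alpha\varphi\|$ is the norm of $\mathcal{D}(A_0^\alpha)$, and $\langle\varphi,\psi\rangle_{1/2}=\langle A_0^{1/2}\varphi,A_0^{1/2}\psi\rangle$. $X$ has norm $\|(z_1,z_2)\|=(\|z_1\|_{1/2}^2+\|z_2\|^2)^{1/2}$. The dot denotes the time derivative. Exact observability of $(A,C)$ in time $\tau$: there is $k_\tau>0$ such that $\int_0^\tau\|Cz(t)\|^2dt\ge k_\tau^2\|z_0\|^2$ for all $z_0\in\mathcal{D}(A)$, where $\dot z=Az$, $z(0)=z_0$. Semigroups. $\mathbb{T}^+$ and $\mathbb{T}^-$ are the $C_0$-semigroups on $X$ generated by $A-C^*C$ and $-A-C^*C$ respectively, and $\mathbb{L}_\tau=\mathbb{T}^-_\tau\mathbb{T}^+_\tau$. Under exact observability in time $\tau$ it is known that $\|\mathbb{L}_\tau\|_{\mathcal{L}(X)}<1$. Galerkin spaces. $H_h\subset\mathcal{D}(A_0^{1/2})$ is endowed with the norm of $H$. $\pi_h$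 is the orthogonal projection from $\mathcal{D}(A_0^{1/2})$ (with inner product $\langle\cdot,\cdot\rangle_{1/2}$) onto $H_h$. Approximation property: there exist $M>0$, $\theta>0$, $h^*>0$ such that $\|\pi_h\varphi-\varphi\|\le Mh^\theta\|\varphi\|_{1/2}$ for all $\varphi\in\mathcal{D}(A_0^{1/2})$ and all $h\in(0,h^* )$. Discrete semigroups. For $(p_{0,h},p_{1,h})\in H_h\times H_h$ let $p_h:[0,\tau]\to H_h$ solve $$(G)\qquad\langle\ddot p_h(t),\varphi_h\rangle+\langle p_h(t),\varphi_h\rangle_{1/2}+\langle C_0^*C_0\dot p_h(t),\varphi_h\rangle=0\quad\forall\varphi_h\in H_h,\qquad p_h(0)=p_{0,h},\ \dot p_h(0)=p_{1,h}.$$ For $p_0,p_1\in\mathcal{D}(A_0^{1/2})$: $\mathbb{T}^+_{h,t}\begin{bmatrix}p_0\\ p_1\end{bmatrix}=\begin{bmatrix}p_h(t)\\ \dot p_h(t)\end{bmatrix}$, where $p_h$ solves $(G)$ with data $(\pi_hp_0,\pi_hp_1)$; $\mathbb{T}^-_{h,t}\begin{bmatrix}p_0\\ p_1\end{bmatrix}=\begin{bmatrix}p_h(t)\\ -\dot p_h(t)\end{bmatrix}$, where $p_h$ solves $(G)$ with data $(\pi_hp_0,-\pi_hp_1)$. Set $\mathbb{L}_{h,\tau}=\mathbb{T}^-_{h,\tau}\mathbb{T}^+_{h,\tau}$. Discrete observers. $w_h^+,w_h^-:[0,\tau]\to H_h$ satisfy, for all $\varphi_h\in H_h$ and $t\in[0,\tau]$,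 $$\langle\ddot w_h^+(t),\varphi_h\rangle+\langle w_h^+(t),\varphi_h\rangle_{1/2}+\langle C_0^*C_0\dot w_h^+(t),\varphi_h\rangle=\langle C_0^*y_h(t),\varphi_h\rangle,\quad w_h^+(0)=\dot w_h^+(0)=0,$$ $$\langle\ddot w_h^-(t),\varphi_h\rangle+\langle w_h^-(t),\varphi_h\rangle_{1/2}-\langle C_0^*C_0\dot w_h^-(t),\varphi_h\rangle=-\langle C_0^*y_h(t),\varphi_h\rangle,\quad w_h^-(\tau)=w_h^+(\tau),\ \dot w_h^-(\tau)=\dot w_h^+(\tau).$$ *)

theory Defs
  imports "HOL-Analysis.Analysis"
begin

text \<open>
  Hilbert spaces are types of class \<open>{real_inner, complete_space}\<close>. Separability is not
  assumed. A complex Hilbert space is an instance, with the real part of its inner product;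
  self-adjointness, adjoints, orthogonal projections onto complex subspaces and all norms are
  unchanged by this restriction of scalars.

  An unbounded operator is given by its domain, a set, and a function of which only the values
  on that set matter.
\<close>

section \<open>Unbounded operators\<close>

definition self_adjoint_on :: "'h::real_inner set \<Rightarrow> ('h \<Rightarrow> 'h) \<Rightarrow> bool" where
  "self_adjoint_on D A \<longleftrightarrow>
     subspace D \<and> closure D = UNIV \<and>
     (\<forall>x\<in>D. \<forall>y\<in>D. A (x + y) = A x + A y) \<and> (\<forall>c. \<forall>x\<in>D. A (c *\<^sub>R x) = c *\<^sub>R A x) \<and>
     {(y, A y) | y. y \<in> D} = {(y, z). \<forall>x\<in>D. inner (A x) y = inner x z}"

definition strictly_positive_on :: "'h::real_inner set \<Rightarrow> ('h \<Rightarrow> 'h) \<Rightarrow> bool" where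
  "strictly_positive_on D A \<longleftrightarrow> (\<exists>m>0. \<forall>x\<in>D. inner (A x) x \<ge> m * (norm x)\<^sup>2)"

text \<open>\<open>(D', R)\<close> is the square root of \<open>(D, A)\<close>: the unique nonnegative self-adjoint operator
  with \<open>R\<^sup>2 = A\<close>, domains included.\<close>

definition is_sqrt_of :: "'h::real_inner set \<Rightarrow> ('h \<Rightarrow> 'h) \<Rightarrow> 'h set \<Rightarrow> ('h \<Rightarrow> 'h) \<Rightarrow> bool" where
  "is_sqrt_of D' R D A \<longleftrightarrow>
     self_adjoint_on D' R \<and> (\<forall>x\<in>D'. inner (R x) x \<ge> 0) \<and>
     D = {x \<in> D'. R x \<in> D'} \<and> (\<forall>x\<in>D. A x = R (R x))"

text \<open>The domain and norm of \<open>A\<^sup>3\<^sup>/\<^sup>2 = R A\<close>, where \<open>(D', R)\<close> is the square root of \<open>(D, A)\<close>.\<close>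

definition dom_three_halves :: "'h set \<Rightarrow> ('h \<Rightarrow> 'h) \<Rightarrow> 'h set \<Rightarrow> 'h set" where
  "dom_three_halves D A D' = {x \<in> D. A x \<in> D'}"

definition norm_three_halves :: "('h::real_inner \<Rightarrow> 'h) \<Rightarrow> ('h \<Rightarrow> 'h) \<Rightarrow> 'h \<Rightarrow> real" where
  "norm_three_halves A R x = norm (R (A x))"

definition maps_boundedly :: "'x set \<Rightarrow> ('x \<Rightarrow> real) \<Rightarrow> ('x \<Rightarrow> 'x) \<Rightarrow> bool" where
  "maps_boundedly V nrm B \<longleftrightarrow> (\<exists>K. \<forall>x\<in>V. B x \<in> V \<and> nrm (B x) \<le> K * nrm x)"

section \<open>Semigroups on a subspace carrying its own norm\<close>

text \<open>The space \<open>X = \<D>(A\<^sub>0\<^sup>1\<^sup>/\<^sup>2) \<times> H\<close> is not a type; the notions below are relative to a carrier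
  \<open>X\<close> and a norm \<open>nrm\<close> on it.\<close>

definition has_deriv_wrt ::
    "('x::real_vector \<Rightarrow> real) \<Rightarrow> (real \<Rightarrow> 'x) \<Rightarrow> 'x \<Rightarrow> real \<Rightarrow> real set \<Rightarrow> bool" where
  "has_deriv_wrt nrm z d t S \<longleftrightarrow>
     ((\<lambda>s. nrm ((1 / (s - t)) *\<^sub>R (z s - z t) - d)) \<longlongrightarrow> 0) (at t within S)"

definition classical_solution ::
    "('x::real_vector \<Rightarrow> real) \<Rightarrow> 'x set \<Rightarrow> ('x \<Rightarrow> 'x) \<Rightarrow> (real \<Rightarrow> 'x) \<Rightarrow> bool" where
  "classical_solution nrm D A z \<longleftrightarrow>
     (\<forall>t\<ge>0. z t \<in> D \<and> has_deriv_wrt nrm z (A (z t)) t {0..})"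

definition bounded_linear_on ::
    "'x::real_vector set \<Rightarrow> ('x \<Rightarrow> real) \<Rightarrow> ('x \<Rightarrow> 'x) \<Rightarrow> bool" where
  "bounded_linear_on X nrm L \<longleftrightarrow>
     (\<forall>x\<in>X. \<forall>y\<in>X. L (x + y) = L x + L y) \<and> (\<forall>c. \<forall>x\<in>X. L (c *\<^sub>R x) = c *\<^sub>R L x) \<and>
     maps_boundedly X nrm L"

definition C0_semigroup ::
    "'x::real_vector set \<Rightarrow> ('x \<Rightarrow> real) \<Rightarrow> (real \<Rightarrow> 'x \<Rightarrow> 'x) \<Rightarrow> bool" where
  "C0_semigroup X nrm T \<longleftrightarrow>
     (\<forall>t\<ge>0. bounded_linear_on X nrm (T t)) \<and>
     (\<forall>x\<in>X. T 0 x = x) \<and>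
     (\<forall>s\<ge>0. \<forall>t\<ge>0. \<forall>x\<in>X. T (s + t) x = T s (T t x)) \<and>
     (\<forall>x\<in>X. ((\<lambda>t. nrm (T t x - x)) \<longlongrightarrow> 0) (at_right 0))"

text \<open>\<open>T\<close> is the semigroup on \<open>X\<close> generated by the operator \<open>G\<close> with domain \<open>D\<close>.\<close>

definition semigroup_generated_by ::
    "'x::real_vector set \<Rightarrow> ('x \<Rightarrow> real) \<Rightarrow> (real \<Rightarrow> 'x \<Rightarrow> 'x) \<Rightarrow> 'x set \<Rightarrow> ('x \<Rightarrow> 'x) \<Rightarrow> bool" where
  "semigroup_generated_by X nrm T D G \<longleftrightarrow>
     C0_semigroup X nrm T \<and>
     {(x, G x) | x. x \<in> D} =
       {(x, y). x \<in> X \<and> y \<in> X \<and>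
          ((\<lambda>t. nrm ((1 / t) *\<^sub>R (T t x - x) - y)) \<longlongrightarrow> 0) (at_right 0)}"

definition op_norm_on :: "'x set \<Rightarrow> ('x \<Rightarrow> real) \<Rightarrow> ('x \<Rightarrow> 'x) \<Rightarrow> real" where
  "op_norm_on X nrm L = Sup {nrm (L x) | x. x \<in> X \<and> nrm x \<le> 1}"

section \<open>The second order system\<close>

definition energy_norm :: "('h::real_inner \<Rightarrow> 'h) \<Rightarrow> 'h \<times> 'h \<Rightarrow> real" where
  "energy_norm R z = sqrt ((norm (R (fst z)))\<^sup>2 + (norm (snd z))\<^sup>2)"

definition wave_op :: "('h::real_inner \<Rightarrow> 'h) \<Rightarrow> 'h \<times> 'h \<Rightarrow> 'h \<times> 'h" where
  "wave_op A0 z = (snd z, - A0 (fst z))"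

definition obs_op :: "('h::real_inner \<Rightarrow> 'y::real_inner) \<Rightarrow> 'h \<times> 'h \<Rightarrow> 'y" where
  "obs_op C0 z = C0 (snd z)"

text \<open>\<open>C\<^sup>*C\<close>, with the adjoint of \<open>C \<in> L(X,Y)\<close> taken in the inner product of \<open>X\<close>:
  \<open>C\<^sup>* y = (0, C\<^sub>0\<^sup>* y)\<close>.\<close>

definition obs_gram :: "('h::real_inner \<Rightarrow> 'y::real_inner) \<Rightarrow> 'h \<times> 'h \<Rightarrow> 'h \<times> 'h" where
  "obs_gram C0 z = (0, adjoint C0 (obs_op C0 z))"

definition exactly_observable ::
    "'h::real_inner set \<Rightarrow> ('h \<Rightarrow> 'h) \<Rightarrow> 'h set \<Rightarrow> ('h \<Rightarrow> 'h) \<Rightarrow> ('h \<Rightarrow> 'y::real_inner) \<Rightarrow> real \<Rightarrow> bool"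
  where
  "exactly_observable D0 A0 D12 R C0 \<tau> \<longleftrightarrow>
     (\<exists>k>0. \<forall>z. classical_solution (energy_norm R) (D0 \<times> D12) (wave_op A0) z \<longrightarrow>
        integral {0..\<tau>} (\<lambda>t. (norm (obs_op C0 (z t)))\<^sup>2) \<ge> k\<^sup>2 * (energy_norm R (z 0))\<^sup>2)"

section \<open>Galerkin approximation\<close>

text \<open>The orthogonal projection onto \<open>V\<close> for the inner product
  \<open>\<langle>x,y\<rangle>\<^sub>1\<^sub>/\<^sub>2 = \<langle>R x, R y\<rangle>\<close>.\<close>

definition energy_proj :: "('h::real_inner \<Rightarrow> 'h) \<Rightarrow> 'h set \<Rightarrow> 'h \<Rightarrow> 'h" where
  "energy_proj R V x = (THE u. u \<in> V \<and> (\<forall>v\<in>V. inner (R (x - u)) (R v) = 0))"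

text \<open>\<open>p\<close> with derivative \<open>v\<close> solves (G) on \<open>[0,\<tau>]\<close> in the space \<open>V\<close>.\<close>

definition galerkin_solution ::
    "('h::real_inner \<Rightarrow> 'h) \<Rightarrow> ('h \<Rightarrow> 'y::real_inner) \<Rightarrow> 'h set \<Rightarrow> real \<Rightarrow> 'h \<Rightarrow> 'h
      \<Rightarrow> (real \<Rightarrow> 'h) \<Rightarrow> (real \<Rightarrow> 'h) \<Rightarrow> bool" where
  "galerkin_solution R C0 V \<tau> p0 p1 p v \<longleftrightarrow>
     p 0 = p0 \<and> v 0 = p1 \<and>
     (\<exists>a. \<forall>t\<in>{0..\<tau>}. p t \<in> V \<and>
        (p has_vector_derivative v t) (at t within {0..\<tau>}) \<and>
        (v has_vector_derivative a t) (at t within {0..\<tau>}) \<and>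
        (\<forall>\<phi>\<in>V. inner (a t) \<phi> + inner (R (p t)) (R \<phi>) + inner (adjoint C0 (C0 (v t))) \<phi> = 0))"

definition disc_flow ::
    "('h::real_inner \<Rightarrow> 'h) \<Rightarrow> ('h \<Rightarrow> 'y::real_inner) \<Rightarrow> 'h set \<Rightarrow> real \<Rightarrow> real \<Rightarrow> 'h \<Rightarrow> 'h \<Rightarrow> 'h \<times> 'h"
  where
  "disc_flow R C0 V \<tau> t p0 p1 =
     (THE z. \<exists>p v. galerkin_solution R C0 V \<tau> p0 p1 p v \<and> z = (p t, v t))"

definition disc_semigroup_plus ::
    "('h::real_inner \<Rightarrow> 'h) \<Rightarrow> ('h \<Rightarrow> 'y::real_inner) \<Rightarrow> 'h set \<Rightarrow> real \<Rightarrow> real \<Rightarrow> 'h \<times> 'h \<Rightarrow> 'h \<times> 'h"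
  where
  "disc_semigroup_plus R C0 V \<tau> t z =
     disc_flow R C0 V \<tau> t (energy_proj R V (fst z)) (energy_proj R V (snd z))"

definition disc_semigroup_minus ::
    "('h::real_inner \<Rightarrow> 'h) \<Rightarrow> ('h \<Rightarrow> 'y::real_inner) \<Rightarrow> 'h set \<Rightarrow> real \<Rightarrow> real \<Rightarrow> 'h \<times> 'h \<Rightarrow> 'h \<times> 'h"
  where
  "disc_semigroup_minus R C0 V \<tau> t z =
     (let q = disc_flow R C0 V \<tau> t (energy_proj R V (fst z)) (- energy_proj R V (snd z))
      in (fst q, - snd q))"

definition disc_L ::
    "('h::real_inner \<Rightarrow> 'h) \<Rightarrow> ('h \<Rightarrow> 'y::real_inner) \<Rightarrow> 'h set \<Rightarrow> real \<Rightarrow> 'h \<times> 'h \<Rightarrow> 'h \<times> 'h" where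
  "disc_L R C0 V \<tau> z = disc_semigroup_minus R C0 V \<tau> \<tau> (disc_semigroup_plus R C0 V \<tau> \<tau> z)"

section \<open>Observers driven by integrable data\<close>

text \<open>Bochner integrability on \<open>[0,\<tau>]\<close>. The library's \<open>integrable\<close> needs a second countable
  range type; strong measurability is therefore spelled out as measurability together with
  almost separable range (Pettis).\<close>

definition bochner_L1 :: "real \<Rightarrow> (real \<Rightarrow> 'b::real_normed_vector) \<Rightarrow> bool" where
  "bochner_L1 \<tau> f \<longleftrightarrow>
     f \<in> borel_measurable (lebesgue_on {0..\<tau>}) \<and>
     (\<exists>S. countable S \<and> (AE t in lebesgue_on {0..\<tau>}. f t \<in> closure S)) \<and>
     integrable (lebesgue_on {0..\<tau>}) (\<lambda>t. norm (f t))"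

text \<open>\<open>w : [0,\<tau>] \<rightarrow> V\<close> with derivative \<open>v\<close> solves
  \<open>\<langle>w'',\<phi>\<rangle> + \<langle>w,\<phi>\<rangle>\<^sub>1\<^sub>/\<^sub>2 + \<langle>B w',\<phi>\<rangle> = \<langle>f,\<phi>\<rangle>\<close> for all \<open>\<phi> \<in> V\<close>. As \<open>f\<close> is only integrable in time,
  \<open>v\<close> is absolutely continuous, with almost everywhere derivative \<open>a\<close>, and the equation holds for
  almost every \<open>t\<close>.\<close>

definition weak_wave_solution ::
    "('h::real_inner \<Rightarrow> 'h) \<Rightarrow> ('h \<Rightarrow> 'h) \<Rightarrow> 'h set \<Rightarrow> real \<Rightarrow> (real \<Rightarrow> 'h)
      \<Rightarrow> (real \<Rightarrow> 'h) \<Rightarrow> (real \<Rightarrow> 'h) \<Rightarrow> bool" where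
  "weak_wave_solution R B V \<tau> f w v \<longleftrightarrow>
     (\<forall>t\<in>{0..\<tau>}. w t \<in> V \<and> (w has_vector_derivative v t) (at t within {0..\<tau>})) \<and>
     (\<exists>a. bochner_L1 \<tau> a \<and> (\<forall>t\<in>{0..\<tau>}. (a has_integral (v t - v 0)) {0..t}) \<and>
        (AE t in lebesgue_on {0..\<tau>}. \<forall>\<phi>\<in>V.
           inner (a t) \<phi> + inner (R (w t)) (R \<phi>) + inner (B (v t)) \<phi> = inner (f t) \<phi>))"

definition forward_observer ::
    "('h::real_inner \<Rightarrow> 'h) \<Rightarrow> ('h \<Rightarrow> 'y::real_inner) \<Rightarrow> 'h set \<Rightarrow> real \<Rightarrow> (real \<Rightarrow> 'y)
      \<Rightarrow> (real \<Rightarrow> 'h) \<Rightarrow> (real \<Rightarrow> 'h) \<Rightarrow> bool" where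
  "forward_observer R C0 V \<tau> yh w v \<longleftrightarrow>
     weak_wave_solution R (\<lambda>x. adjoint C0 (C0 x)) V \<tau> (\<lambda>t. adjoint C0 (yh t)) w v \<and>
     w 0 = 0 \<and> v 0 = 0"

definition backward_observer ::
    "('h::real_inner \<Rightarrow> 'h) \<Rightarrow> ('h \<Rightarrow> 'y::real_inner) \<Rightarrow> 'h set \<Rightarrow> real \<Rightarrow> (real \<Rightarrow> 'y)
      \<Rightarrow> 'h \<Rightarrow> 'h \<Rightarrow> (real \<Rightarrow> 'h) \<Rightarrow> (real \<Rightarrow> 'h) \<Rightarrow> bool" where
  "backward_observer R C0 V \<tau> yh q0 q1 w v \<longleftrightarrow>
     weak_wave_solution R (\<lambda>x. - adjoint C0 (C0 x)) V \<tau> (\<lambda>t. - adjoint C0 (yh t)) w v \<and>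
     w \<tau> = q0 \<and> v \<tau> = q1"

end

theory Submission
  imports Defs
begin

text \<open>
  The isometry \<open>(p, v) \<mapsto> (R p, v)\<close> carries the energy space onto \<open>H \<times> H\<close>, where the undamped
  generator becomes the skew-adjoint operator \<open>(u, v) \<mapsto> (R v, - R u)\<close>.

  The undamped solution itself, corrected by the damped semigroups, solves both observer equations
  with exact data, so that the output of the two discrete observers is
  \<open>(I - L\<^sub>h) \<pi>\<^sub>h z\<^sub>0 + d\<close> with a consistency error \<open>d\<close>. The truncated Neumann series therefore
  telescopes: it equals \<open>\<pi>\<^sub>h z\<^sub>0 - L\<^sub>h\<^sup>N\<^sup>+\<^sup>1 \<pi>\<^sub>h z\<^sub>0\<close> up to \<open>N + 1\<close> copies of \<open>d\<close>, because \<open>L\<^sub>h\<close> is a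
  contraction for the energy norm. All consistency errors come from one energy estimate for the
  Galerkin equation, whose residuals are projection errors of \<open>p''\<close> and \<open>p'\<close> and hence cost two orders of
  regularity. It remains to compare \<open>L\<^sub>h\<^sup>N\<^sup>+\<^sup>1 \<pi>\<^sub>h z\<^sub>0\<close> with \<open>L\<^sup>N\<^sup>+\<^sup>1 z\<^sub>0\<close>, for which the powers of \<open>L\<close>
  have to be bounded in the domain of the square of the generator. This holds uniformly in the
  power because \<open>L\<close> commutes with the generator up to lower order and has norm \<open>\<eta> < 1\<close>.

  The resulting constant in front of \<open>h\<^sup>\<theta> N\<close> depends on \<open>\<tau>\<close>. It is absorbed by \<open>h\<^sup>\<theta> \<tau> N\<^sup>2\<close> when \<open>N\<close> is
  large, and by \<open>\<eta>\<^sup>N\<^sup>+\<^sup>1 / (1 - \<eta>)\<close>, for \<open>h\<close> below a bound depending on \<open>\<tau>\<close>, for the finitely many other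
  \<open>N\<close>.
\<close>

section \<open>Hilbert space preliminaries\<close>

text \<open>The constant \<open>M\<close> must not depend on \<open>\<tau>\<close>, while every
  consistency estimate carries constants that do. Comparing the powers of \<open>L_h\<close> and
  \<open>L\<close> in each summand of the Neumann series would add errors proportional to
  \<open>n\<close>, hence a factor \<open>N\<^sup>2\<close> with a \<open>\<tau>\<close>-dependent
  constant, for which the term with \<open>\<tau> N\<^sup>2\<close> leaves no room. In the
  telescoped form only one power is compared, so that the error is linear in \<open>N\<close> and
  can be absorbed.

  Absorbing small \<open>N\<close> into \<open>\<eta>^(N+1)\<close> requires
  \<open>\<eta> > 0\<close>. If \<open>\<eta> = 0\<close>, the data vanish: the damping is bounded,
  hence energy decays at most exponentially and \<open>L\<close> annihilates no nonzero vector of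
  the domain.

  Observability speaks of classical solutions of the undamped equation, so its semigroup has to be
  built; the discrete flow is a definite description, so its solutions must be shown to exist. One
  scheme for m-dissipative operators serves both. The acceleration of an observer is merely
  integrable in time, so the energy identity rests on a product rule for scalar coordinates.\<close>

lemma closed_subspace_projection:
  fixes M :: "'a::{real_inner, complete_space} set"
  assumes M: "subspace M" "closed M"
  shows "\<exists>m\<in>M. \<forall>y\<in>M. inner (x - m) y = 0"
proof -
  define S where "S = (\<lambda>m. (norm (x - m))\<^sup>2) ` M"
  define d where "d = Inf S"
  have S: "S \<noteq> {}" "bdd_below S"
    using subspace_0[OF M(1)] by (auto simp: S_def intro!: bdd_belowI[of _ 0])
  have dle: "d \<le> (norm (x - m))\<^sup>2" if "m \<in> M" for m
    unfolding d_def using that S by (auto intro!: cInf_lower simp: S_def)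
  have "\<exists>m\<in>M. (norm (x - m))\<^sup>2 < d + 1 / real (Suc n)" for n
  proof -
    have "Inf S < d + 1 / real (Suc n)" by (simp add: d_def)
    from cInf_lessD[OF S(1) this] show ?thesis by (auto simp: S_def)
  qed
  then obtain m where m: "\<And>n. m n \<in> M" "\<And>n. (norm (x - m n))\<^sup>2 < d + 1 / real (Suc n)"
    by metis
  \<comment> \<open>The parallelogram identity, with the midpoint in \<open>M\<close> at squared
    distance at least \<open>d\<close>, makes minimising sequences Cauchy.\<close>
  have par: "(norm (a - b))\<^sup>2 \<le> 2 * (norm (x - a))\<^sup>2 + 2 * (norm (x - b))\<^sup>2 - 4 * d"
    if "a \<in> M" "b \<in> M" for a b
  proof -
    have "(1/2) *\<^sub>R (a + b) \<in> M" using that M(1) by (simp add: subspace_add subspace_scale)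
    then have "d \<le> (norm (x - (1/2) *\<^sub>R (a + b)))\<^sup>2" by (rule dle)
    moreover have "(norm (a - b))\<^sup>2 + 4 * (norm (x - (1/2) *\<^sub>R (a + b)))\<^sup>2
        = 2 * (norm (x - a))\<^sup>2 + 2 * (norm (x - b))\<^sup>2"
      by (simp add: power2_norm_eq_inner inner_diff inner_add inner_commute algebra_simps)
    ultimately show ?thesis by linarith
  qed
  have "Cauchy m"
  proof (rule metric_CauchyI)
    fix e :: real assume e: "e > 0"
    obtain N where N: "4 / e\<^sup>2 < real N" using reals_Archimedean2 by blast
    show "\<exists>N. \<forall>i\<ge>N. \<forall>j\<ge>N. dist (m i) (m j) < e"
    proof (intro exI allI impI)
      fix i j assume ij: "i \<ge> N" "j \<ge> N"
      have inv: "1 / real (Suc k) < e\<^sup>2 / 4" if "k \<ge> N" for k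
      proof -
        have "4 / e\<^sup>2 < real (Suc k)" using N that by linarith
        then show ?thesis using e by (simp add: field_simps)
      qed
      have "(norm (m i - m j))\<^sup>2 < e\<^sup>2"
        using par[OF m(1) m(1), of i j] m(2)[of i] m(2)[of j] inv[OF ij(1)] inv[OF ij(2)]
        by linarith
      then show "dist (m i) (m j) < e"
        using e by (simp add: dist_norm power2_less_imp_less)
    qed
  qed
  then obtain l where l: "m \<longlonglongrightarrow> l" using Cauchy_convergent convergent_def by blast
  have lM: "l \<in> M" using closed_sequentially[OF M(2) _ l] m(1) by blast
  have "(\<lambda>n. d + 1 / real (Suc n)) \<longlonglongrightarrow> d + 0"
    by (intro tendsto_intros LIMSEQ_Suc[OF lim_1_over_n])
  moreover have "(\<lambda>n. (norm (x - m n))\<^sup>2) \<longlonglongrightarrow> (norm (x - l))\<^sup>2"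
    by (intro tendsto_intros l)
  ultimately have ld: "(norm (x - l))\<^sup>2 \<le> d"
    using m(2) by (intro LIMSEQ_le[of _ _ "\<lambda>n. d + 1 / real (Suc n)"]) (auto intro: less_imp_le)
  have "inner (x - l) y = 0" if y: "y \<in> M" for y
  proof -
    define c where "c = inner (x - l) y"
    \<comment> \<open>Nearly the minimiser of the quadratic in \<open>t\<close>; the
      \<open>+ 1\<close> keeps the denominator positive when \<open>y = 0\<close>. The increment is
      then at most \<open>- t * c\<close>, and minimality forces \<open>c = 0\<close>.\<close>
    define t where "t = c / ((norm y)\<^sup>2 + 1)"
    have pos: "(norm y)\<^sup>2 + 1 > 0" by (smt (verit) zero_le_power2)
    have "l + t *\<^sub>R y \<in> M" using lM y M(1) by (simp add: subspace_add subspace_scale)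
    then have "(norm (x - l))\<^sup>2 \<le> (norm (x - (l + t *\<^sub>R y)))\<^sup>2" using ld dle[of "l + t *\<^sub>R y"] by linarith
    also have "\<dots> = (norm ((x - l) - t *\<^sub>R y))\<^sup>2" by (simp add: diff_diff_eq)
    also have "\<dots> = (norm (x - l))\<^sup>2 - 2 * t * c + t\<^sup>2 * (norm y)\<^sup>2"
      unfolding power2_norm_eq_inner inner_diff_left[of "x - l" "t *\<^sub>R y"]
        inner_diff_right[of _ "x - l" "t *\<^sub>R y"] c_def
      by (simp add: inner_commute[of y "x - l"] power2_eq_square)
    also have "\<dots> \<le> (norm (x - l))\<^sup>2 - 2 * t * c + t\<^sup>2 * ((norm y)\<^sup>2 + 1)"
      by (simp add: mult_left_mono algebra_simps)
    also have "t\<^sup>2 * ((norm y)\<^sup>2 + 1) = t * c"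
      using pos by (simp add: t_def power2_eq_square)
    finally have "t * c \<le> 0" by (simp add: mult.commute)
    then have "c\<^sup>2 \<le> 0" using pos by (simp add: t_def power2_eq_square divide_le_0_iff)
    then show ?thesis by (simp add: c_def)
  qed
  then show ?thesis using lM by blast
qed

lemma closed_subspace_eq_UNIV:
  fixes M :: "'a::{real_inner, complete_space} set"
  assumes "subspace M" "closed M" "\<And>y. (\<And>x. x \<in> M \<Longrightarrow> inner x y = 0) \<Longrightarrow> y = 0"
  shows "M = UNIV"
proof -
  have "x \<in> M" for x
  proof -
    obtain m where m: "m \<in> M" "\<forall>y\<in>M. inner (x - m) y = 0"
      using closed_subspace_projection[OF assms(1,2)] by blast
    have "x - m = 0" by (rule assms(3)) (use m in \<open>auto simp: inner_commute\<close>)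
    then show ?thesis using m by simp
  qed
  then show ?thesis by auto
qed

lemma riesz_representation:
  fixes f :: "'a::{real_inner, complete_space} \<Rightarrow> real"
  assumes f: "bounded_linear f"
  shows "\<exists>y. \<forall>x. f x = inner x y"
proof -
  interpret f: bounded_linear f by (rule f)
  define M where "M = {x. f x = 0}"
  show ?thesis
  proof (cases "M = UNIV")
    case True
    then show ?thesis by (intro exI[of _ 0]) (auto simp: M_def)
  next
    case False
    have sM: "subspace M" by (simp add: subspace_def M_def f.add f.scaleR f.zero)
    have "closed M" unfolding M_def
      by (intro closed_Collect_eq continuous_intros f.continuous_on)
    with False closed_subspace_eq_UNIV[OF sM]
    obtain y where y: "y \<noteq> 0" "\<And>x. x \<in> M \<Longrightarrow> inner x y = 0" by metis
    have fy: "f y \<noteq> 0" using y(2)[of y] y(1) by (auto simp: M_def)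
    have "f x = inner x ((f y / inner y y) *\<^sub>R y)" for x
    proof -
      have "x - (f x / f y) *\<^sub>R y \<in> M" using fy by (simp add: M_def f.diff f.scaleR)
      from y(2)[OF this] have "inner x y = f x / f y * inner y y" by (simp add: inner_diff)
      then show ?thesis using fy y(1) by (simp add: field_simps)
    qed
    then show ?thesis by blast
  qed
qed

text \<open>\<open>adjoint\<close> is defined by choice, so its characteristic identity presupposes
  that some adjoint exists. Completeness enters here, through the Riesz representation.\<close>

lemma inner_adjoint:
  fixes C :: "'a::{real_inner, complete_space} \<Rightarrow> 'b::real_inner"
  assumes C: "bounded_linear C"
  shows "inner (C x) y = inner x (adjoint C y)"
proof -
  have "\<exists>z. \<forall>x. inner (C x) y = inner x z" for y
    by (rule riesz_representation) (intro bounded_linear_compose[OF bounded_linear_inner_left C])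
  then have "\<exists>f'. \<forall>x y. inner (C x) y = inner x (f' y)" by metis
  from someI_ex[OF this] show ?thesis unfolding adjoint_def by blast
qed

lemma bounded_linear_adjoint:
  fixes C :: "'a::{real_inner, complete_space} \<Rightarrow> 'b::real_inner"
  assumes C: "bounded_linear C"
  shows "bounded_linear (adjoint C)"
proof -
  interpret C: bounded_linear C by (rule C)
  obtain K where K: "K > 0" "\<And>x. norm (C x) \<le> norm x * K" using C.pos_bounded by blast
  note adj = inner_adjoint[OF C, symmetric]
  show ?thesis
  proof (rule bounded_linear_intro)
    show "adjoint C (x + y) = adjoint C x + adjoint C y" for x y
      by (rule vector_eq_ldot[THEN iffD1]) (simp add: adj inner_add)
    show "adjoint C (r *\<^sub>R x) = r *\<^sub>R adjoint C x" for r x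
      by (rule vector_eq_ldot[THEN iffD1]) (simp add: adj)
    show "norm (adjoint C x) \<le> norm x * K" for x
    proof (cases "adjoint C x = 0")
      case False
      have "norm (adjoint C x) * norm (adjoint C x) = inner (C (adjoint C x)) x"
        by (simp add: inner_adjoint[OF C] power2_norm_eq_inner[symmetric] power2_eq_square)
      also have "\<dots> \<le> norm (C (adjoint C x)) * norm x" by (rule norm_cauchy_schwarz)
      also have "\<dots> \<le> norm (adjoint C x) * K * norm x" using K by (intro mult_right_mono) auto
      finally show ?thesis using False by (simp add: mult_ac)
    qed (use K in auto)
  qed
qed

text \<open>A closed operator that is bounded below has closed range.\<close>

lemma bounded_below_surj:
  fixes T :: "'a::complete_space \<Rightarrow> 'b::{real_inner, complete_space}"
  assumes ran: "subspace (T ` D)"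
    and below: "\<And>x y. x \<in> D \<Longrightarrow> y \<in> D \<Longrightarrow> dist x y \<le> c * dist (T x) (T y)" and c: "c > 0"
    and graph: "\<And>X x y. (\<And>n. X n \<in> D) \<Longrightarrow> X \<longlonglongrightarrow> x \<Longrightarrow> (\<lambda>n. T (X n)) \<longlonglongrightarrow> y \<Longrightarrow> x \<in> D \<and> T x = y"
    and compl: "\<And>y. (\<And>x. x \<in> D \<Longrightarrow> inner (T x) y = 0) \<Longrightarrow> y = 0"
  shows "T ` D = UNIV"
proof (rule closed_subspace_eq_UNIV[OF ran])
  show "closed (T ` D)"
    unfolding closed_sequential_limits
  proof (intro allI impI, elim conjE)
    fix Y y assume mem: "\<forall>n. Y n \<in> T ` D" and Y: "Y \<longlonglongrightarrow> y"
    define X where "X n = (SOME x. x \<in> D \<and> Y n = T x)" for n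
    have X: "X n \<in> D" "Y n = T (X n)" for n
      using someI_ex[of "\<lambda>x. x \<in> D \<and> Y n = T x"] mem unfolding X_def by blast+
    have "Cauchy X"
    proof (rule metric_CauchyI)
      fix e :: real assume "e > 0"
      then have "e / c > 0" using c by simp
      from metric_CauchyD[OF LIMSEQ_imp_Cauchy[OF Y] this]
      obtain N where N: "\<And>i j. i \<ge> N \<Longrightarrow> j \<ge> N \<Longrightarrow> dist (Y i) (Y j) < e / c" by blast
      have "dist (X i) (X j) < e" if "i \<ge> N" "j \<ge> N" for i j
      proof -
        have "dist (X i) (X j) \<le> c * dist (Y i) (Y j)" using below X by simp
        also have "\<dots> < e" using N[OF that] c by (simp add: field_simps)
        finally show ?thesis .
      qed
      then show "\<exists>N. \<forall>i\<ge>N. \<forall>j\<ge>N. dist (X i) (X j) < e" by blast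
    qed
    then obtain x where x: "X \<longlonglongrightarrow> x" using Cauchy_convergent convergent_def by blast
    have "x \<in> D \<and> T x = y" by (rule graph[OF X(1) x]) (use Y in \<open>simp add: X(2)[symmetric]\<close>)
    then show "y \<in> T ` D" by blast
  qed
  show "y = 0" if "\<And>x. x \<in> T ` D \<Longrightarrow> inner x y = 0" for y
    by (rule compl) (use that in blast)
qed

section \<open>Contraction semigroups and their generators\<close>

text \<open>Generators and \<open>has_deriv_wrt\<close> are expressed by difference quotients; this
  form carries them over to ordinary derivatives once the energy norm has become a type
  norm.\<close>

lemma has_vector_derivative_quotient:
  "(f has_vector_derivative d) (at t within S) \<longleftrightarrow>
     ((\<lambda>s. (1 / (s - t)) *\<^sub>R (f s - f t) - d) \<longlongrightarrow> 0) (at t within S)"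
proof -
  have "norm (f s - f t - (s - t) *\<^sub>R d) / norm (s - t)
      = norm ((1 / (s - t)) *\<^sub>R (f s - f t) - d)" if "s \<noteq> t" for s
  proof -
    have "(1 / (s - t)) *\<^sub>R (f s - f t) - d = (1 / (s - t)) *\<^sub>R (f s - f t - (s - t) *\<^sub>R d)"
      using that by (simp add: scaleR_diff_right)
    then show ?thesis by (simp add: divide_inverse mult.commute)
  qed
  then have "((\<lambda>s. norm (f s - f t - (s - t) *\<^sub>R d) / norm (s - t)) \<longlongrightarrow> 0) (at t within S) \<longleftrightarrow>
      ((\<lambda>s. norm ((1 / (s - t)) *\<^sub>R (f s - f t) - d)) \<longlongrightarrow> 0) (at t within S)"
    by (intro filterlim_cong refl) (auto simp: eventually_at_filter)
  then show ?thesis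
    by (simp add: has_vector_derivative_def has_derivative_iff_norm tendsto_norm_zero_iff
        bounded_linear_scaleR_left)
qed

lemma filterlim_abs_diff_at_right:
  "filterlim (\<lambda>s. \<bar>s - t\<bar>) (at_right 0) (at (t::real) within S)"
proof -
  have "((\<lambda>s. \<bar>s - t\<bar>) \<longlongrightarrow> \<bar>t - t\<bar>) (at t within S)" by (intro tendsto_intros)
  then show ?thesis
    by (auto simp: filterlim_at eventually_at_filter)
qed

text \<open>The right quotient at \<open>t\<close> is \<open>T t\<close> applied to the right
  quotient at \<open>0\<close>. The left quotient with step \<open>h\<close> is
  \<open>T (t - h)\<close> applied to the same quotient, off by
  \<open>T (t - h) (T h y - y)\<close>, which vanishes by strong continuity and the uniform bound. A
  general bound \<open>M\<close> on a short interval is allowed because contractivity is itself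
  deduced with this lemma.\<close>

lemma semigroup_has_vector_derivative:
  fixes T :: "real \<Rightarrow> 'a::real_normed_vector \<Rightarrow> 'a"
  assumes lin: "\<And>t. t \<ge> 0 \<Longrightarrow> linear (T t)"
    and bnd: "\<And>t x. 0 \<le> t \<Longrightarrow> t \<le> \<delta> \<Longrightarrow> norm (T t x) \<le> M * norm x"
    and add: "\<And>s t x. s \<ge> 0 \<Longrightarrow> t \<ge> 0 \<Longrightarrow> T (s + t) x = T s (T t x)"
    and y0: "((\<lambda>t. T t y) \<longlongrightarrow> y) (at_right 0)"
    and x0: "((\<lambda>t. (1 / t) *\<^sub>R (T t x - x)) \<longlongrightarrow> y) (at_right 0)"
    and t: "t \<in> {0..\<delta>}"
  shows "((\<lambda>s. T s x) has_vector_derivative T t y) (at t within {0..\<delta>})"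
proof -
  define \<phi> where "\<phi> h = norm ((1 / h) *\<^sub>R (T h x - x) - y) + norm (T h y - y)" for h
  have "(\<phi> \<longlongrightarrow> norm (y - y) + norm (y - y)) (at_right 0)"
    unfolding \<phi>_def by (intro tendsto_intros x0 y0)
  then have "(\<phi> \<longlongrightarrow> 0) (at_right 0)" by simp
  from filterlim_compose[OF this filterlim_abs_diff_at_right]
  have "((\<lambda>s. \<phi> \<bar>s - t\<bar>) \<longlongrightarrow> 0) (at t within {0..\<delta>})" .
  then have "((\<lambda>s. M * \<phi> \<bar>s - t\<bar>) \<longlongrightarrow> 0) (at t within {0..\<delta>})"
    using tendsto_mult_right_zero by blast
  moreover have "norm ((1 / (s - t)) *\<^sub>R (T s x - T t x) - T t y) \<le> M * \<phi> \<bar>s - t\<bar>"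
    if s: "s \<in> {0..\<delta>}" "s \<noteq> t" for s
  proof (cases "s > t")
    case True
    define h where "h = s - t"
    have h: "h > 0" "s = t + h" using True by (simp_all add: h_def)
    interpret L: linear "T t" using lin t by simp
    have "(1 / h) *\<^sub>R (T s x - T t x) - T t y = T t ((1 / h) *\<^sub>R (T h x - x) - y)"
      using h t add[of t h x] by (simp add: L.diff L.scaleR)
    also have "norm \<dots> \<le> M * norm ((1 / h) *\<^sub>R (T h x - x) - y)" using t by (intro bnd) auto
    also have "\<dots> \<le> M * \<phi> h"
    proof -
      have "0 \<le> M * norm (T h y - y)" using bnd[of t "T h y - y"] t
        by (meson atLeastAtMost_iff norm_ge_zero order_trans)
      then show ?thesis by (simp add: \<phi>_def distrib_left)
    qed
    finally show ?thesis using True by (simp add: h_def)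
  next
    case False
    define h where "h = t - s"
    have h: "h > 0" "t = s + h" using False s unfolding h_def by linarith+
    interpret L: linear "T s" using lin s by simp
    have "(1 / (s - t)) *\<^sub>R (T s x - T t x) = (1 / h) *\<^sub>R (T t x - T s x)"
    proof -
      have "(1 / (s - t)) = - (1 / h)" by (simp add: h_def minus_divide_right)
      then show ?thesis by (simp add: algebra_simps)
    qed
    then have "(1 / (s - t)) *\<^sub>R (T s x - T t x) - T t y
        = T s ((1 / h) *\<^sub>R (T h x - x) - y) - T s (T h y - y)"
      using h s add[of s h] by (simp add: L.diff L.scaleR)
    also have "norm \<dots> \<le> norm (T s ((1 / h) *\<^sub>R (T h x - x) - y)) + norm (T s (T h y - y))"
      by (rule norm_triangle_ineq4)
    also have "\<dots> \<le> M * \<phi> h"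
      using s bnd[of s "(1 / h) *\<^sub>R (T h x - x) - y"] bnd[of s "T h y - y"]
      by (simp add: \<phi>_def distrib_left)
    finally show ?thesis using False s by (simp add: h_def)
  qed
  ultimately show ?thesis
    unfolding has_vector_derivative_quotient
    by (elim Lim_null_comparison[rotated]) (auto simp: eventually_at_filter)
qed

text \<open>\<open>gen\<close> only makes \<open>G\<close> a restriction of the generator, so
  invariance of \<open>D\<close> and commutation are part of the locale rather than
  consequences.\<close>

locale contraction_semigroup =
  fixes T :: "real \<Rightarrow> 'a::real_inner \<Rightarrow> 'a" and D :: "'a set" and G :: "'a \<Rightarrow> 'a"
  assumes linear_T: "t \<ge> 0 \<Longrightarrow> linear (T t)"
    and contr: "t \<ge> 0 \<Longrightarrow> norm (T t x) \<le> norm x"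
    and zero [simp]: "T 0 x = x"
    and add: "s \<ge> 0 \<Longrightarrow> t \<ge> 0 \<Longrightarrow> T (s + t) x = T s (T t x)"
    and cont0: "((\<lambda>t. T t x) \<longlongrightarrow> x) (at_right 0)"
    and gen: "x \<in> D \<Longrightarrow> ((\<lambda>t. (1 / t) *\<^sub>R (T t x - x)) \<longlongrightarrow> G x) (at_right 0)"
    and dom: "t \<ge> 0 \<Longrightarrow> x \<in> D \<Longrightarrow> T t x \<in> D"
    and commute: "t \<ge> 0 \<Longrightarrow> x \<in> D \<Longrightarrow> G (T t x) = T t (G x)"
begin

lemma has_derivative_T:
  assumes "x \<in> D" "0 \<le> t" "t \<le> \<tau>"
  shows "((\<lambda>s. T s x) has_vector_derivative T t (G x)) (at t within {0..\<tau>})"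
proof (rule semigroup_has_vector_derivative[where M=1])
  show "norm (T s y) \<le> 1 * norm y" if "0 \<le> s" for s y using contr that by simp
  show "t \<in> {0..\<tau>}" using assms by simp
qed (fact linear_T add cont0 gen[OF assms(1)])+

lemma continuous_T: "continuous_on {0..\<tau>} (\<lambda>t. T t x)"
proof -
  have bl: "norm (T s x - T t x) \<le> norm (T \<bar>s - t\<bar> x - x)" if "s \<ge> 0" "t \<ge> 0" for s t
  proof -
    have *: "norm (T b x - T a x) \<le> norm (T \<bar>b - a\<bar> x - x)" if ab: "0 \<le> a" "a \<le> b" for a b
    proof -
      have "T b x - T a x = T a (T (b - a) x - x)"
        using add[of a "b - a" x] ab linear_T[of a] by (simp add: linear_diff)
      then show ?thesis using contr[of a "T (b - a) x - x"] ab by simp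
    qed
    show ?thesis
      using *[of s t] *[of t s] that by (cases "s \<le> t") (auto simp: norm_minus_commute abs_minus_commute)
  qed
  show ?thesis
    unfolding continuous_on_def
  proof
    fix t assume t: "t \<in> {0..\<tau>}"
    have "((\<lambda>h. norm (T h x - x)) \<longlongrightarrow> norm (x - x)) (at_right 0)"
      by (intro tendsto_intros cont0)
    from filterlim_compose[OF this filterlim_abs_diff_at_right]
    have "((\<lambda>s. norm (T \<bar>s - t\<bar> x - x)) \<longlongrightarrow> 0) (at t within {0..\<tau>})" by simp
    then have "((\<lambda>s. T s x - T t x) \<longlongrightarrow> 0) (at t within {0..\<tau>})"
      by (rule Lim_null_comparison[rotated]) (use t bl in \<open>auto simp: eventually_at_filter\<close>)
    then show "((\<lambda>s. T s x) \<longlongrightarrow> T t x) (at t within {0..\<tau>})" by (simp add: Lim_null[symmetric])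
  qed
qed

end

lemma Cauchy_geometric:
  fixes X :: "nat \<Rightarrow> 'a::real_normed_vector"
  assumes X: "\<And>n. norm (X (Suc n) - X n) \<le> C * (1/2) ^ n"
  shows "Cauchy X"
proof -
  have C: "C \<ge> 0" using X[of 0] by (simp add: order_trans[OF norm_ge_zero])
  \<comment> \<open>The right-hand side is the exact geometric sum, so the induction closes without
    slack.\<close>
  have step: "norm (X (m + k) - X m) \<le> 2 * C * (1/2) ^ m - 2 * C * (1/2) ^ (m + k)" for m k
  proof (induction k)
    case (Suc k)
    have "norm (X (m + Suc k) - X m) \<le> norm (X (Suc (m + k)) - X (m + k)) + norm (X (m + k) - X m)"
      using norm_triangle_ineq[of "X (Suc (m + k)) - X (m + k)" "X (m + k) - X m"] by simp
    also have "\<dots> \<le> C * (1/2) ^ (m + k) + (2 * C * (1/2) ^ m - 2 * C * (1/2) ^ (m + k))"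
      by (intro add_mono X Suc)
    finally show ?case by simp
  qed simp
  have d: "norm (X n - X m) \<le> 2 * C * (1/2) ^ m" if "m \<le> n" for m n
    using step[of m "n - m"] C that
    by (smt (verit) le_add_diff_inverse mult_nonneg_nonneg zero_le_divide_1_iff zero_le_power)
  have "(\<lambda>n. 2 * C * (1/2) ^ n :: real) \<longlonglongrightarrow> 2 * C * 0"
    by (intro tendsto_intros LIMSEQ_power_zero) simp
  then have lim: "(\<lambda>n. 2 * C * (1/2) ^ n :: real) \<longlonglongrightarrow> 0" by simp
  show ?thesis
  proof (rule metric_CauchyI)
    fix e :: real assume "e > 0"
    then obtain N where N: "\<And>n. n \<ge> N \<Longrightarrow> 2 * C * (1/2) ^ n < e"
      using order_tendstoD(2)[OF lim] by (auto simp: eventually_sequentially)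
    have "dist (X m) (X n) < e" if "m \<ge> N" "n \<ge> N" for m n
      using d[of m n] N[of m] d[of n m] N[of n] that
      by (cases "m \<le> n") (auto simp: norm_minus_commute dist_norm)
    then show "\<exists>M. \<forall>m\<ge>M. \<forall>n\<ge>M. dist (X m) (X n) < e" by blast
  qed
qed

text \<open>Step counts of the dyadic scheme are floors: halving the step doubles the count, up to
  one extra step.\<close>

lemma nat_floor_double:
  assumes "(0::real) \<le> x"
  shows "nat \<lfloor>2 * x\<rfloor> = 2 * nat \<lfloor>x\<rfloor> \<or> nat \<lfloor>2 * x\<rfloor> = 2 * nat \<lfloor>x\<rfloor> + 1"
proof -
  have "\<lfloor>2 * x\<rfloor> = 2 * \<lfloor>x\<rfloor> \<or> \<lfloor>2 * x\<rfloor> = 2 * \<lfloor>x\<rfloor> + 1" by (simp only: floor_eq_iff) linarith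
  moreover have "\<lfloor>x\<rfloor> \<ge> 0" using assms by simp
  ultimately show ?thesis by arith
qed

lemma nat_floor_add:
  assumes "(0::real) \<le> x" "0 \<le> y"
  shows "nat \<lfloor>x + y\<rfloor> = nat \<lfloor>x\<rfloor> + nat \<lfloor>y\<rfloor> \<or> nat \<lfloor>x + y\<rfloor> = nat \<lfloor>x\<rfloor> + nat \<lfloor>y\<rfloor> + 1"
proof -
  have "\<lfloor>x + y\<rfloor> = \<lfloor>x\<rfloor> + \<lfloor>y\<rfloor> \<or> \<lfloor>x + y\<rfloor> = \<lfloor>x\<rfloor> + \<lfloor>y\<rfloor> + 1" by (simp only: floor_eq_iff) linarith
  moreover have "\<lfloor>x\<rfloor> \<ge> 0" "\<lfloor>y\<rfloor> \<ge> 0" using assms by auto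
  ultimately show ?thesis by arith
qed

text \<open>The semigroup generated by an m-dissipative operator is the limit of the implicit Euler scheme
  with dyadic steps: on \<open>D(G\<^sup>2)\<close>, halving a step of length \<open>e\<close> changes the scheme by \<open>O(e\<^sup>2)\<close>.\<close>

locale m_dissipative =
  fixes D :: "'a::{real_inner, complete_space} set" and G :: "'a \<Rightarrow> 'a"
  assumes subspace_D: "subspace D" and dense_D: "closure D = UNIV"
    and G_add: "x \<in> D \<Longrightarrow> y \<in> D \<Longrightarrow> G (x + y) = G x + G y"
    and G_scale: "x \<in> D \<Longrightarrow> G (c *\<^sub>R x) = c *\<^sub>R G x"
    and dissipative: "x \<in> D \<Longrightarrow> inner (G x) x \<le> 0"
    and range: "e > 0 \<Longrightarrow> \<exists>x\<in>D. x - e *\<^sub>R G x = y"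
begin

lemma G_diff: "x \<in> D \<Longrightarrow> y \<in> D \<Longrightarrow> G (x - y) = G x - G y"
  using G_add[of x "(-1) *\<^sub>R y"] G_scale[of y "-1"] subspace_D by (simp add: subspace_neg)

lemma norm_resolvent_le: "x \<in> D \<Longrightarrow> e > 0 \<Longrightarrow> norm x \<le> norm (x - e *\<^sub>R G x)"
proof -
  assume x: "x \<in> D" "e > 0"
  have "e * inner (G x) x \<le> 0" using x dissipative by (simp add: mult_nonneg_nonpos)
  then have "norm x * norm x \<le> inner (x - e *\<^sub>R G x) x"
    by (simp add: inner_diff_left power2_norm_eq_inner[symmetric] power2_eq_square)
  also have "\<dots> \<le> norm (x - e *\<^sub>R G x) * norm x" by (rule norm_cauchy_schwarz)
  finally show ?thesis by (cases "x = 0") auto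
qed

text \<open>One implicit Euler step of length \<open>e\<close>, that is, the resolvent;
  \<open>J_unique\<close> shows that the choice is forced.\<close>

definition J :: "real \<Rightarrow> 'a \<Rightarrow> 'a" where
  "J e y = (SOME x. x \<in> D \<and> x - e *\<^sub>R G x = y)"

lemma J: assumes "e > 0" shows "J e y \<in> D" "J e y - e *\<^sub>R G (J e y) = y"
proof -
  have "\<exists>x. x \<in> D \<and> x - e *\<^sub>R G x = y" using range[OF assms] by blast
  from someI_ex[OF this] show "J e y \<in> D" "J e y - e *\<^sub>R G (J e y) = y"
    unfolding J_def by blast+
qed

lemma J_unique: assumes e: "e > 0" and x: "x \<in> D" "x - e *\<^sub>R G x = y" shows "J e y = x"
proof -
  have "norm (J e y - x) \<le> norm ((J e y - x) - e *\<^sub>R G (J e y - x))"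
    using J(1)[OF e] x subspace_D e by (intro norm_resolvent_le) (auto simp: subspace_diff)
  also have "(J e y - x) - e *\<^sub>R G (J e y - x) = (J e y - e *\<^sub>R G (J e y)) - (x - e *\<^sub>R G x)"
    using J(1)[OF e] x by (simp add: G_diff algebra_simps)
  also have "\<dots> = 0" using J(2)[OF e, of y] x by simp
  finally show ?thesis by simp
qed

lemma linear_J: assumes e: "e > 0" shows "linear (J e)"
proof (rule linearI)
  fix x y and c :: real
  show "J e (x + y) = J e x + J e y"
  proof (rule J_unique[OF e])
    show "J e x + J e y - e *\<^sub>R G (J e x + J e y) = x + y"
      by (simp only: G_add[OF J(1)[OF e] J(1)[OF e]] scaleR_add_right add_diff_add J(2)[OF e])
  qed (use J(1)[OF e] subspace_D in \<open>simp add: subspace_add\<close>)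
  show "J e (c *\<^sub>R x) = c *\<^sub>R J e x"
  proof (rule J_unique[OF e])
    have "c *\<^sub>R J e x - e *\<^sub>R G (c *\<^sub>R J e x) = c *\<^sub>R (J e x - e *\<^sub>R G (J e x))"
      using J(1)[OF e] by (simp add: G_scale algebra_simps)
    then show "c *\<^sub>R J e x - e *\<^sub>R G (c *\<^sub>R J e x) = c *\<^sub>R x" using J(2)[OF e, of x] by simp
  qed (use J(1)[OF e] subspace_D in \<open>simp add: subspace_scale\<close>)
qed

lemma norm_J: assumes e: "e > 0" shows "norm (J e x) \<le> norm x"
  using norm_resolvent_le[OF J(1)[OF e] e, of x] J(2)[OF e, of x] by simp

lemma G_J: assumes e: "e > 0" and x: "x \<in> D" shows "G (J e x) = J e (G x)"
proof (rule J_unique[OF e, symmetric])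
  have eq: "e *\<^sub>R G (J e x) = J e x - x" using J(2)[OF e, of x] by (simp add: algebra_simps)
  then have "G (J e x) = (1 / e) *\<^sub>R (J e x - x)"
    using e by (metis divide_inverse_commute inverse_eq_divide less_irrefl mult_1_right
        real_vector_affinity_eq scaleR_one scaleR_scaleR right_inverse mult.commute)
  then show "G (J e x) \<in> D" using J(1)[OF e, of x] x subspace_D
    by (simp add: subspace_diff subspace_scale)
  then show "G (J e x) - e *\<^sub>R G (G (J e x)) = G x"
    using J(1)[OF e, of x] x eq by (simp flip: G_scale) (simp add: G_diff)
qed

lemma J_minus: assumes e: "e > 0" and x: "x \<in> D" shows "J e x - x = e *\<^sub>R J e (G x)"
  using J(2)[OF e, of x] G_J[OF e x] by (simp add: algebra_simps)

lemma linear_J_pow: "e > 0 \<Longrightarrow> linear (J e ^^ k)"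
  by (induction k) (auto intro: linear_compose linear_J linear_id simp: id_def[symmetric])

lemma norm_J_pow: "e > 0 \<Longrightarrow> norm ((J e ^^ k) x) \<le> norm x"
  by (induction k) (auto intro: order_trans[OF norm_J])

lemma J_pow_D: "e > 0 \<Longrightarrow> x \<in> D \<Longrightarrow> (J e ^^ k) x \<in> D"
  by (induction k) (auto intro: J)

lemma G_J_pow: "e > 0 \<Longrightarrow> x \<in> D \<Longrightarrow> G ((J e ^^ k) x) = (J e ^^ k) (G x)"
  by (induction k) (auto simp: G_J J_pow_D)

lemma J_pow_minus: assumes e: "e > 0" and x: "x \<in> D"
  shows "norm ((J e ^^ k) x - x) \<le> real k * e * norm (G x)"
proof (induction k)
  case (Suc k)
  have "(J e ^^ Suc k) x - x = J e ((J e ^^ k) x - x) + (J e x - x)"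
    by (simp add: linear_diff[OF linear_J[OF e]])
  then have "norm ((J e ^^ Suc k) x - x) \<le> norm (J e ((J e ^^ k) x - x)) + norm (J e x - x)"
    using norm_triangle_ineq by metis
  also have "\<dots> \<le> real k * e * norm (G x) + e * norm (G x)"
    using norm_J[OF e, of "(J e ^^ k) x - x"] Suc norm_J[OF e, of "G x"] e
    by (intro add_mono) (auto simp: J_minus[OF e x])
  finally show ?case by (simp add: algebra_simps)
qed simp

text \<open>The increment of \<open>k\<close> steps is \<open>e\<close> times the sum of the
  \<open>J e ^^ j\<close> applied to \<open>G x\<close>, for \<open>j\<close> from 1 to
  \<open>k\<close>. As \<open>G x\<close> need not lie in \<open>D\<close>, each summand is compared
  with \<open>G x\<close> through \<open>y\<close>: twice the distance \<open>r\<close>, plus the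
  drift of \<open>y\<close>, which is controlled by \<open>G y\<close>.\<close>

lemma J_pow_taylor:
  assumes e: "e > 0" and x: "x \<in> D" and y: "y \<in> D" "norm (G x - y) \<le> r"
  shows "norm ((J e ^^ k) x - x - (real k * e) *\<^sub>R G x)
      \<le> (real k * e) * (2 * r + (real k * e) * norm (G y))"
proof (induction k)
  case (Suc k)
  define m where "m = Suc k"
  have "norm ((J e ^^ m) (G x) - G x)
      \<le> norm ((J e ^^ m) (G x - y)) + norm ((J e ^^ m) y - y) + norm (y - G x)"
    using norm_triangle_ineq[of "(J e ^^ m) (G x - y) + ((J e ^^ m) y - y)" "y - G x"]
      norm_triangle_ineq[of "(J e ^^ m) (G x - y)" "(J e ^^ m) y - y"]
    by (simp add: linear_diff[OF linear_J_pow[OF e]])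
  also have "\<dots> \<le> r + real m * e * norm (G y) + r"
    using norm_J_pow[OF e, of m "G x - y"] J_pow_minus[OF e y(1), of m] y(2)
    by (intro add_mono) (auto simp: norm_minus_commute)
  finally have m: "norm ((J e ^^ m) (G x) - G x) \<le> 2 * r + real m * e * norm (G y)" by simp
  have "(J e ^^ m) x = (J e ^^ k) (J e x)" by (simp add: m_def funpow_swap1)
  also have "\<dots> = (J e ^^ k) x + (J e ^^ k) (J e x - x)"
    by (simp add: linear_diff[OF linear_J_pow[OF e]])
  also have "(J e ^^ k) (J e x - x) = e *\<^sub>R (J e ^^ m) (G x)"
    by (simp add: m_def J_minus[OF e x] linear_cmul[OF linear_J_pow[OF e]] funpow_swap1)
  finally have "(J e ^^ m) x - x - (real m * e) *\<^sub>R G x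
      = ((J e ^^ k) x - x - (real k * e) *\<^sub>R G x) + e *\<^sub>R ((J e ^^ m) (G x) - G x)"
    by (simp add: m_def algebra_simps)
  then have "norm ((J e ^^ m) x - x - (real m * e) *\<^sub>R G x)
      \<le> norm ((J e ^^ k) x - x - (real k * e) *\<^sub>R G x) + norm (e *\<^sub>R ((J e ^^ m) (G x) - G x))"
    using norm_triangle_ineq by metis
  also have "\<dots> \<le> (real k * e) * (2 * r + (real k * e) * norm (G y))
      + e * (2 * r + real m * e * norm (G y))"
    using Suc m e by (intro add_mono) (auto intro: mult_left_mono)
  also have "\<dots> \<le> (real k * e) * (2 * r + (real m * e) * norm (G y))
      + e * (2 * r + real m * e * norm (G y))"
    using e by (intro add_right_mono mult_left_mono add_left_mono mult_right_mono) (auto simp: m_def)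
  also have "\<dots> = (real m * e) * (2 * r + (real m * e) * norm (G y))"
    by (simp add: m_def algebra_simps)
  finally show ?case by (simp add: m_def)
qed simp

definition D2 where "D2 = {x\<in>D. G x \<in> D}"

lemma J_D2: assumes "e > 0" "x \<in> D" shows "J e x \<in> D2"
  using assms by (simp add: D2_def J G_J)

lemma J_pow_D2: "e > 0 \<Longrightarrow> x \<in> D2 \<Longrightarrow> (J e ^^ k) x \<in> D2"
  by (simp add: D2_def J_pow_D G_J_pow)

text \<open>\<open>J e\<close> maps \<open>D\<close> into \<open>D2\<close> and moves
  \<open>x\<close> by at most \<open>e * norm (G x)\<close>.\<close>

lemma dense_D2: "closure D2 = UNIV"
proof -
  have "x \<in> closure D2" if x: "x \<in> D" for x
  proof (rule closure_approachable[THEN iffD2], intro allI impI)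
    fix r :: real assume r: "r > 0"
    define e where "e = r / (norm (G x) + 1)"
    have pos: "norm (G x) + 1 > 0" by (simp add: add_nonneg_pos)
    have e: "e > 0" using r pos by (simp add: e_def)
    have "norm (J e x - x) \<le> e * norm (G x)" using J_pow_minus[OF e x, of 1] by simp
    also have "\<dots> < e * (norm (G x) + 1)" using e by simp
    also have "\<dots> = r" using pos by (simp add: e_def)
    finally show "\<exists>y\<in>D2. dist y x < r" using J_D2[OF e x] by (auto simp: dist_norm)
  qed
  then have "closure D \<subseteq> closure D2" by (simp add: closure_minimal subsetI)
  then show ?thesis using dense_D by auto
qed

text \<open>Two half steps and one full step both agree with \<open>z + e *\<^sub>R G z\<close> up
  to \<open>e\<^sup>2 * norm (G (G z))\<close>, whence the factor 2. Contractivity propagates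
  earlier errors without growth, so the local errors add up.\<close>

lemma J_halving:
  assumes e: "e > 0" and x: "x \<in> D2"
  shows "norm ((J (e/2) ^^ (2 * k)) x - (J e ^^ k) x) \<le> 2 * real k * e\<^sup>2 * norm (G (G x))"
proof (induction k)
  case (Suc k)
  have e2: "e / 2 > 0" using e by simp
  define z where "z = (J e ^^ k) x"
  have z: "z \<in> D" "G z \<in> D" using J_pow_D2[OF e x, of k] by (auto simp: z_def D2_def)
  have "G (G z) = (J e ^^ k) (G (G x))" using x e by (simp add: z_def G_J_pow D2_def)
  then have Gz: "norm (G (G z)) \<le> norm (G (G x))" using norm_J_pow[OF e] by simp
  have "(J (e/2) ^^ (2 * Suc k)) x - (J e ^^ Suc k) x
     = (J (e/2) ^^ 2) ((J (e/2) ^^ (2 * k)) x - z) + ((J (e/2) ^^ 2) z - J e z)"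
    by (simp add: z_def linear_diff[OF linear_J[OF e2]] numeral_2_eq_2)
  then have "norm ((J (e/2) ^^ (2 * Suc k)) x - (J e ^^ Suc k) x)
     \<le> norm ((J (e/2) ^^ 2) ((J (e/2) ^^ (2 * k)) x - z)) + norm ((J (e/2) ^^ 2) z - J e z)"
    using norm_triangle_ineq by metis
  also have "norm ((J (e/2) ^^ 2) ((J (e/2) ^^ (2 * k)) x - z)) \<le> 2 * real k * e\<^sup>2 * norm (G (G x))"
    using norm_J_pow[OF e2, of 2 "(J (e/2) ^^ (2 * k)) x - z"] Suc by (simp add: z_def)
  also have "norm ((J (e/2) ^^ 2) z - J e z) \<le> 2 * e\<^sup>2 * norm (G (G z))"
    using norm_triangle_ineq4[of "(J (e/2) ^^ 2) z - z - e *\<^sub>R G z" "J e z - z - e *\<^sub>R G z"]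
      J_pow_taylor[OF e2 z(1) z(2), of 0 2] J_pow_taylor[OF e z(1) z(2), of 0 1]
    by (simp add: power2_eq_square)
  also have "\<dots> \<le> 2 * e\<^sup>2 * norm (G (G x))" using Gz by (intro mult_left_mono) auto
  finally show ?case by (simp add: algebra_simps)
qed simp

text \<open>The step length is the same for all \<open>t\<close>. Hence refinement halves it
  exactly, and \<open>E n s\<close>, \<open>E n t\<close> are powers of one resolvent, so that the
  semigroup law fails by at most one step.\<close>

definition E :: "nat \<Rightarrow> real \<Rightarrow> 'a \<Rightarrow> 'a" where
  "E n t = (J ((1/2) ^ n) ^^ nat \<lfloor>t * 2 ^ n\<rfloor>)"

lemma linear_E: "linear (E n t)" unfolding E_def by (rule linear_J_pow) simp

lemma norm_E: "norm (E n t x) \<le> norm x" unfolding E_def by (rule norm_J_pow) simp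

lemma E_time: "0 \<le> t \<Longrightarrow> real (nat \<lfloor>t * 2 ^ n\<rfloor>) * (1/2) ^ n \<le> t"
proof -
  assume "0 \<le> t"
  then have "real (nat \<lfloor>t * 2 ^ n\<rfloor>) \<le> t * 2 ^ n" by simp
  then have "real (nat \<lfloor>t * 2 ^ n\<rfloor>) * (1/2) ^ n \<le> t * 2 ^ n * (1/2) ^ n"
    by (intro mult_right_mono) auto
  then show ?thesis by (simp add: power_one_over)
qed

text \<open>Two errors add up: the possible extra half step costs at most one step length times
  \<open>norm (G x)\<close>, and the halving errors of about \<open>t * 2 ^ n\<close> steps, each
  quadratic in the step, sum to a multiple of \<open>t\<close> times the step.\<close>

lemma E_step:
  assumes x: "x \<in> D2" and t: "t \<ge> 0"
  shows "norm (E (Suc n) t x - E n t x) \<le> (2 * t * norm (G (G x)) + norm (G x)) * (1/2) ^ n"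
proof -
  define e where "e = (1/2 :: real) ^ n"
  define k where "k = nat \<lfloor>t * 2 ^ n\<rfloor>"
  have e: "e > 0" "e / 2 > 0" "(1/2) ^ Suc n = e / 2" by (auto simp: e_def)
  have xD: "x \<in> D" using x by (simp add: D2_def)
  have ke: "real k * e \<le> t" using E_time[OF t] by (simp add: k_def e_def)
  have k': "nat \<lfloor>t * 2 ^ Suc n\<rfloor> = 2 * k \<or> nat \<lfloor>t * 2 ^ Suc n\<rfloor> = 2 * k + 1"
    using nat_floor_double[of "t * 2 ^ n"] t by (simp add: k_def mult_ac)
  have "norm ((J (e/2) ^^ nat \<lfloor>t * 2 ^ Suc n\<rfloor>) x - (J (e/2) ^^ (2 * k)) x) \<le> e * norm (G x)"
  proof (cases "nat \<lfloor>t * 2 ^ Suc n\<rfloor> = 2 * k")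
    case False
    then have "nat \<lfloor>t * 2 ^ Suc n\<rfloor> = Suc (2 * k)" using k' by simp
    then have "(J (e/2) ^^ nat \<lfloor>t * 2 ^ Suc n\<rfloor>) x - (J (e/2) ^^ (2 * k)) x
        = (J (e/2) ^^ (2 * k)) (J (e/2) x - x)"
      by (simp only: funpow_Suc_right o_apply linear_diff[OF linear_J_pow[OF e(2)]])
    also have "norm \<dots> \<le> norm (J (e/2) x - x)" by (rule norm_J_pow[OF e(2)])
    also have "\<dots> \<le> e / 2 * norm (G x)" using J_pow_minus[OF e(2) xD, of 1] by simp
    also have "\<dots> \<le> e * norm (G x)" using e by (intro mult_right_mono) auto
    finally show ?thesis .
  qed (use e in simp)
  moreover have "norm ((J (e/2) ^^ (2 * k)) x - (J e ^^ k) x) \<le> 2 * t * norm (G (G x)) * e"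
  proof -
    have "norm ((J (e/2) ^^ (2 * k)) x - (J e ^^ k) x) \<le> 2 * (real k * e) * e * norm (G (G x))"
      using J_halving[OF e(1) x, of k] by (simp add: power2_eq_square mult_ac)
    also have "\<dots> \<le> 2 * t * e * norm (G (G x))"
      using ke e by (intro mult_right_mono) auto
    finally show ?thesis by (simp add: mult_ac)
  qed
  moreover have "E (Suc n) t x = (J (e/2) ^^ nat \<lfloor>t * 2 ^ Suc n\<rfloor>) x" "E n t x = (J e ^^ k) x"
    by (simp_all add: E_def k_def e_def)
  ultimately have "norm (E (Suc n) t x - E n t x) \<le> e * norm (G x) + 2 * t * norm (G (G x)) * e"
    using norm_triangle_ineq[of "E (Suc n) t x - (J (e/2) ^^ (2 * k)) x" "(J (e/2) ^^ (2 * k)) x - E n t x"]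
    by simp
  then show ?thesis by (simp add: e_def algebra_simps)
qed

lemma convergent_E: assumes t: "t \<ge> 0" shows "convergent (\<lambda>n. E n t x)"
proof (rule Cauchy_convergent, rule metric_CauchyI)
  fix r :: real assume r: "r > 0"
  then obtain y where y: "y \<in> D2" "dist y x < r / 3"
    using dense_D2 closure_approachable[of x D2] by (metis UNIV_I divide_pos_pos zero_less_numeral)
  have "Cauchy (\<lambda>n. E n t y)" by (rule Cauchy_geometric[OF E_step[OF y(1) t]])
  then obtain N where N: "\<And>m n. m \<ge> N \<Longrightarrow> n \<ge> N \<Longrightarrow> dist (E m t y) (E n t y) < r / 3"
    using metric_CauchyD[of _ "r / 3"] r by (metis divide_pos_pos zero_less_numeral)
  have xy: "dist (E n t x) (E n t y) \<le> dist y x" for n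
    using norm_E[of n t "x - y"] by (simp add: dist_norm linear_diff[OF linear_E] norm_minus_commute)
  have "dist (E m t x) (E n t x) < r" if "m \<ge> N" "n \<ge> N" for m n
    using N[OF that] xy[of m] xy[of n] y(2) dist_triangle[of "E m t x" "E n t x" "E m t y"]
      dist_triangle[of "E m t y" "E n t x" "E n t y"] dist_commute[of "E n t y" "E n t x"]
    by linarith
  then show "\<exists>N. \<forall>m\<ge>N. \<forall>n\<ge>N. dist (E m t x) (E n t x) < r" by blast
qed

definition S :: "real \<Rightarrow> 'a \<Rightarrow> 'a" where "S t x = lim (\<lambda>n. E n t x)"

lemma E_tendsto_S: "t \<ge> 0 \<Longrightarrow> (\<lambda>n. E n t x) \<longlonglongrightarrow> S t x"
  unfolding S_def using convergent_E convergent_LIMSEQ_iff by blast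

lemma norm_S: "t \<ge> 0 \<Longrightarrow> norm (S t x) \<le> norm x"
  using tendsto_norm[OF E_tendsto_S] norm_E by (metis LIMSEQ_le_const2)

lemma linear_S: assumes t: "t \<ge> 0" shows "linear (S t)"
proof (rule linearI)
  fix x y and c :: real
  have "(\<lambda>n. E n t (x + y)) \<longlonglongrightarrow> S t x + S t y"
    using tendsto_add[OF E_tendsto_S[OF t] E_tendsto_S[OF t]] by (simp add: linear_add[OF linear_E])
  then show "S t (x + y) = S t x + S t y" using E_tendsto_S[OF t] LIMSEQ_unique by blast
  have "(\<lambda>n. E n t (c *\<^sub>R x)) \<longlonglongrightarrow> c *\<^sub>R S t x"
    using tendsto_scaleR[OF tendsto_const E_tendsto_S[OF t]] by (simp add: linear_cmul[OF linear_E])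
  then show "S t (c *\<^sub>R x) = c *\<^sub>R S t x" using E_tendsto_S[OF t] LIMSEQ_unique by blast
qed

lemma bounded_linear_S: "t \<ge> 0 \<Longrightarrow> bounded_linear (S t)"
  using linear_S norm_S by (intro bounded_linear_intro[where K=1]) (auto simp: linear_add linear_cmul)

text \<open>On \<open>D\<close> the discrete flows at \<open>s + t\<close> and at \<open>t\<close>
  followed by \<open>s\<close> differ by at most one Euler step, which moves \<open>x\<close> by a
  multiple of the step length. The identity extends to the closure by continuity.\<close>

lemma S_add: assumes st: "s \<ge> 0" "t \<ge> 0" shows "S (s + t) x = S s (S t x)"
proof -
  have *: "S (s + t) x = S s (S t x)" if x: "x \<in> D" for x
  proof -
    have st': "s + t \<ge> 0" using st by simp
    have "(\<lambda>n. E n s (E n t x - S t x)) \<longlonglongrightarrow> 0"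
      by (rule Lim_null_comparison[OF always_eventually
            tendsto_norm_zero[OF LIM_zero[OF E_tendsto_S[OF st(2), of x]]]]) (simp add: norm_E)
    from tendsto_add[OF this E_tendsto_S[OF st(1), of "S t x"]]
    have 1: "(\<lambda>n. E n s (E n t x)) \<longlonglongrightarrow> S s (S t x)" by (simp add: linear_diff[OF linear_E])
    have "norm (E n (s + t) x - E n s (E n t x)) \<le> norm (G x) * (1/2) ^ n" for n
    proof -
      define e where "e = (1/2 :: real) ^ n"
      define k where "k = nat \<lfloor>s * 2 ^ n\<rfloor> + nat \<lfloor>t * 2 ^ n\<rfloor>"
      have e: "e > 0" by (simp add: e_def)
      have k: "nat \<lfloor>(s + t) * 2 ^ n\<rfloor> = k \<or> nat \<lfloor>(s + t) * 2 ^ n\<rfloor> = Suc k"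
        using nat_floor_add[of "s * 2 ^ n" "t * 2 ^ n"] st by (simp add: k_def distrib_right)
      have E2: "E n s (E n t x) = (J e ^^ k) x" by (simp add: E_def e_def k_def funpow_add)
      show ?thesis
      proof (cases "nat \<lfloor>(s + t) * 2 ^ n\<rfloor> = k")
        case True
        then show ?thesis by (simp add: E2) (simp add: E_def e_def)
      next
        case False
        then have "nat \<lfloor>(s + t) * 2 ^ n\<rfloor> = Suc k" using k by simp
        then have "E n (s + t) x - E n s (E n t x) = (J e ^^ k) (J e x - x)"
          unfolding E2 by (simp only: E_def e_def[symmetric] funpow_Suc_right o_apply
              linear_diff[OF linear_J_pow[OF e]])
        also have "norm \<dots> \<le> norm (J e x - x)" by (rule norm_J_pow[OF e])
        also have "\<dots> \<le> e * norm (G x)" using J_pow_minus[OF e x, of 1] by simp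
        finally show ?thesis by (simp add: e_def mult.commute)
      qed
    qed
    moreover have "(\<lambda>n. norm (G x) * (1/2) ^ n) \<longlonglongrightarrow> 0"
      by (intro tendsto_mult_right_zero LIMSEQ_power_zero) simp
    ultimately have "(\<lambda>n. E n (s + t) x - E n s (E n t x)) \<longlonglongrightarrow> 0"
      by (rule Lim_null_comparison[OF always_eventually[OF allI]])
    from tendsto_diff[OF E_tendsto_S[OF st'] this, of x]
    have "(\<lambda>n. E n s (E n t x)) \<longlonglongrightarrow> S (s + t) x" by simp
    then show ?thesis using 1 LIMSEQ_unique by blast
  qed
  have "closed {x. S (s + t) x = S s (S t x)}"
    using st by (intro closed_Collect_eq linear_continuous_on bounded_linear_S
        bounded_linear_compose[of "S s" "S t"]) auto
  then have "closure D \<subseteq> {x. S (s + t) x = S s (S t x)}" using * by (intro closure_minimal) auto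
  then show ?thesis using dense_D by auto
qed

lemma S_taylor:
  assumes x: "x \<in> D" and y: "y \<in> D" "norm (G x - y) \<le> r" and t: "t \<ge> 0"
  shows "norm (S t x - x - t *\<^sub>R G x) \<le> t * (2 * r + t * norm (G y))"
proof -
  \<comment> \<open>The time actually reached by the scheme at level \<open>n\<close>.\<close>
  define \<tau> where "\<tau> n = real (nat \<lfloor>t * 2 ^ n\<rfloor>) * (1/2) ^ n" for n
  have "norm (\<tau> n - t) \<le> (1/2) ^ n" for n
  proof -
    have "\<bar>real (nat \<lfloor>t * 2 ^ n\<rfloor>) - t * 2 ^ n\<bar> \<le> 1" using t by (simp; linarith)
    then have "\<bar>real (nat \<lfloor>t * 2 ^ n\<rfloor>) - t * 2 ^ n\<bar> * (1/2) ^ n \<le> 1 * (1/2) ^ n"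
      by (intro mult_right_mono) auto
    also have "\<bar>real (nat \<lfloor>t * 2 ^ n\<rfloor>) - t * 2 ^ n\<bar> * (1/2) ^ n
        = \<bar>(real (nat \<lfloor>t * 2 ^ n\<rfloor>) - t * 2 ^ n) * (1/2) ^ n\<bar>" by (simp add: abs_mult)
    also have "(real (nat \<lfloor>t * 2 ^ n\<rfloor>) - t * 2 ^ n) * (1/2) ^ n = \<tau> n - t"
      by (simp add: \<tau>_def left_diff_distrib power_one_over diff_divide_distrib)
    finally show ?thesis by (simp only: real_norm_def mult_1)
  qed
  moreover have "(\<lambda>n. (1/2 :: real) ^ n) \<longlonglongrightarrow> 0" by (rule LIMSEQ_power_zero) simp
  ultimately have "(\<lambda>n. \<tau> n - t) \<longlonglongrightarrow> 0"
    by (rule Lim_null_comparison[OF always_eventually[OF allI]])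
  then have \<tau>: "\<tau> \<longlonglongrightarrow> t" by (simp add: LIM_zero_iff)
  have "norm (E n t x - x - \<tau> n *\<^sub>R G x) \<le> \<tau> n * (2 * r + \<tau> n * norm (G y))" for n
    unfolding E_def \<tau>_def by (rule J_pow_taylor[OF _ x y]) simp
  moreover have "(\<lambda>n. norm (E n t x - x - \<tau> n *\<^sub>R G x)) \<longlonglongrightarrow> norm (S t x - x - t *\<^sub>R G x)"
    by (intro tendsto_intros E_tendsto_S t \<tau>)
  moreover have "(\<lambda>n. \<tau> n * (2 * r + \<tau> n * norm (G y))) \<longlonglongrightarrow> t * (2 * r + t * norm (G y))"
    by (intro tendsto_intros \<tau>)
  ultimately show ?thesis by (intro LIMSEQ_le) auto
qed

text \<open>The bounded operator \<open>J 1\<close> inverts \<open>I - G\<close>, so limits can be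
  taken on its side.\<close>

lemma G_closed:
  assumes X: "\<And>n. X n \<in> D" and x: "X \<longlonglongrightarrow> x" and y: "(\<lambda>n. G (X n)) \<longlonglongrightarrow> y"
  shows "x \<in> D \<and> G x = y"
proof -
  have bl: "bounded_linear (J 1)"
    using linear_J[of 1] norm_J[of 1] by (intro bounded_linear_intro[where K=1]) (auto simp: linear_add linear_cmul)
  have "(\<lambda>n. J 1 (X n - 1 *\<^sub>R G (X n))) \<longlonglongrightarrow> J 1 (x - 1 *\<^sub>R y)"
    by (intro bounded_linear.tendsto[OF bl] tendsto_intros x y)
  moreover have "J 1 (X n - 1 *\<^sub>R G (X n)) = X n" for n by (rule J_unique) (use X in auto)
  ultimately have eq: "J 1 (x - 1 *\<^sub>R y) = x" using x LIMSEQ_unique by simp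
  then show ?thesis using J[of 1 "x - 1 *\<^sub>R y"] by simp
qed

lemma contraction_semigroup_S: "contraction_semigroup S D G"
proof
  show "S 0 x = x" for x
    using E_tendsto_S[of 0 x] by (simp add: E_def LIMSEQ_const_iff)
  have gen: "((\<lambda>t. (1 / t) *\<^sub>R (S t x - x)) \<longlongrightarrow> G x) (at_right 0)" if x: "x \<in> D" for x
  proof (rule tendstoI)
    fix r :: real assume r: "r > 0"
    then obtain y where y: "y \<in> D" "dist y (G x) < r / 4"
      using dense_D closure_approachable[of "G x" D] by (metis UNIV_I divide_pos_pos zero_less_numeral)
    have "((\<lambda>t. 2 * (r / 4) + t * norm (G y)) \<longlongrightarrow> 2 * (r / 4) + 0 * norm (G y)) (at_right 0)"
      by (intro tendsto_intros)
    then have "eventually (\<lambda>t. 2 * (r / 4) + t * norm (G y) < r) (at_right 0)"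
      by (rule order_tendstoD) (use r in simp)
    then show "eventually (\<lambda>t. dist ((1 / t) *\<^sub>R (S t x - x)) (G x) < r) (at_right 0)"
      using eventually_at_right_less
    proof eventually_elim
      case (elim t)
      have "(1 / t) *\<^sub>R (S t x - x) - G x = (1 / t) *\<^sub>R (S t x - x - t *\<^sub>R G x)"
        using elim(2) by (simp add: scaleR_diff_right)
      then have "dist ((1 / t) *\<^sub>R (S t x - x)) (G x) = norm (S t x - x - t *\<^sub>R G x) / t"
        using elim(2) by (simp add: dist_norm)
      also have "\<dots> \<le> t * (2 * (r / 4) + t * norm (G y)) / t"
        using elim y by (intro divide_right_mono S_taylor x) (auto simp: dist_norm norm_minus_commute)
      also have "\<dots> < r" using elim by simp
      finally show ?case .
    qed
  qed
  then show "x \<in> D \<Longrightarrow> ((\<lambda>t. (1 / t) *\<^sub>R (S t x - x)) \<longlongrightarrow> G x) (at_right 0)" for x .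
  show "((\<lambda>t. S t x) \<longlongrightarrow> x) (at_right 0)" for x
  proof (rule tendstoI)
    fix r :: real assume r: "r > 0"
    then obtain y where y: "y \<in> D" "dist y x < r / 4"
      using dense_D closure_approachable[of x D] by (metis UNIV_I divide_pos_pos zero_less_numeral)
    have "((\<lambda>t. t *\<^sub>R (1 / t) *\<^sub>R (S t y - y)) \<longlongrightarrow> 0 *\<^sub>R G y) (at_right 0)"
      by (intro tendsto_scaleR gen[OF y(1)] tendsto_ident_at)
    then have "eventually (\<lambda>t. dist (t *\<^sub>R (1 / t) *\<^sub>R (S t y - y)) 0 < r / 4) (at_right 0)"
      by (intro tendstoD[unfolded scaleR_zero_left]) (use r in simp_all)
    then show "eventually (\<lambda>t. dist (S t x) x < r) (at_right 0)"
      using eventually_at_right_less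
    proof eventually_elim
      case (elim t)
      have "norm (S t (x - y)) \<le> norm (x - y)" using elim by (intro norm_S) auto
      then have "dist (S t x) (S t y) \<le> dist y x"
        using elim by (simp add: dist_norm linear_diff[OF linear_S] norm_minus_commute)
      moreover have "dist (S t y) y < r / 4" using elim by (simp add: dist_norm)
      ultimately show ?case using y(2) r dist_triangle[of "S t x" x "S t y"]
          dist_triangle[of "S t y" x y] by linarith
    qed
  qed
  fix t :: real and x assume t: "t \<ge> 0" and x: "x \<in> D"
  \<comment> \<open>\<open>D\<close> is invariant and \<open>G\<close> commutes under every
    resolvent, hence under the scheme; closedness of \<open>G\<close> passes both to the
    limit.\<close>
  have 1: "E n t x \<in> D" for n unfolding E_def by (rule J_pow_D[OF _ x]) simp
  have 2: "(\<lambda>n. G (E n t x)) \<longlonglongrightarrow> S t (G x)"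
    using E_tendsto_S[OF t, of "G x"] by (simp add: E_def G_J_pow x)
  from G_closed[OF 1 E_tendsto_S[OF t] 2] show "S t x \<in> D" "G (S t x) = S t (G x)" by auto
qed (simp_all add: linear_add[OF linear_S] linear_cmul[OF linear_S] norm_S S_add)

end

text \<open>The uniform boundedness principle, by Baire's theorem.\<close>

lemma semigroup_locally_bounded:
  fixes T :: "real \<Rightarrow> 'a::{real_normed_vector, complete_space} \<Rightarrow> 'a"
  assumes bl: "\<And>t. t \<ge> 0 \<Longrightarrow> bounded_linear (T t)" and zero: "\<And>x. T 0 x = x"
    and cont0: "\<And>x. ((\<lambda>t. T t x) \<longlongrightarrow> x) (at_right 0)"
  shows "\<exists>\<delta>>0. \<exists>M. \<forall>t\<in>{0..\<delta>}. \<forall>x. norm (T t x) \<le> M * norm x"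
proof -
  \<comment> \<open>Time window and bound are tied to the same index, so that one countable union
    exhausts the space although both are unknown for a given \<open>x\<close>.\<close>
  define F where "F n = {x. \<forall>t\<in>{0<..1 / real (Suc n)}. norm (T t x) \<le> real n}" for n
  have closed: "closed (F n)" for n
  proof -
    have "F n = (\<Inter>t\<in>{0<..1 / real (Suc n)}. {x. norm (T t x) \<le> real n})" by (auto simp: F_def)
    moreover have "closed {x. norm (T t x) \<le> real n}" if "t > 0" for t
      using that by (intro closed_Collect_le continuous_on_norm linear_continuous_on bl continuous_on_const) auto
    ultimately show ?thesis by auto
  qed
  have "x \<in> (\<Union>n. F n)" for x
  proof -
    have "eventually (\<lambda>t. dist (T t x) x < 1) (at_right 0)" by (rule tendstoD[OF cont0]) simp
    then obtain d where d: "d > 0" "\<And>t. 0 < t \<Longrightarrow> t < d \<Longrightarrow> dist (T t x) x < 1"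
      unfolding eventually_at_right_field by blast
    obtain n where n: "1 / d < real n" "norm x + 1 < real n"
      using reals_Archimedean2[of "max (1 / d) (norm x + 1)"] by auto
    have "1 / d < real (Suc n)" using n by simp
    then have "1 / real (Suc n) < d" using d(1) by (simp add: field_simps)
    then have "norm (T t x) \<le> real n" if "t \<in> {0<..1 / real (Suc n)}" for t
      using d(2)[of t] that n(2) norm_triangle_ineq2[of "T t x" x] by (auto simp: dist_norm)
    then have "x \<in> F n" by (simp add: F_def del: of_nat_Suc)
    then show ?thesis by blast
  qed
  then have UN: "\<Union>(range F) = UNIV" by auto
  have "\<exists>n. interior (F n) \<noteq> {}"
  proof (rule ccontr)
    assume "\<not> ?thesis"
    then have "Met_TC.mtopology interior_of \<Union>(range F) = {}"
      using closed by (intro Met_TC.metric_Baire_category_alt) (auto simp: complete_UNIV)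
    then show False using UN by simp
  qed
  then obtain n a r where r: "r > 0" "ball a r \<subseteq> F n"
    by (metis all_not_in_conv mem_interior)
  \<comment> \<open>A vector \<open>y\<close> of norm \<open>r / 2\<close> is a difference of two
    elements of the ball, so \<open>T t y\<close> is bounded by \<open>2 * n\<close>; rescaling
    gives \<open>4 * n / r\<close>. The maximum with 1 covers \<open>t = 0\<close>.\<close>
  define M where "M = max 1 (4 * real n / r)"
  have "norm (T t x) \<le> M * norm x" if t: "t \<in> {0..1 / real (Suc n)}" for t x
  proof (cases "t = 0 \<or> x = 0")
    case True
    have "1 * norm x \<le> M * norm x" by (intro mult_right_mono) (auto simp: M_def)
    then show ?thesis using True t bl[of t] by (auto simp: zero linear_simps)
  next
    case False
    then have t': "t \<in> {0<..1 / real (Suc n)}" using t by auto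
    interpret T: bounded_linear "T t" using t by (intro bl) auto
    define y where "y = (r / (2 * norm x)) *\<^sub>R x"
    have y: "norm y = r / 2" using False r by (simp add: y_def)
    have "norm (T t (a + y)) \<le> real n" "norm (T t a) \<le> real n"
      using r y t' by (auto simp: F_def subset_eq dist_norm)
    then have "norm (T t y) \<le> 2 * real n"
      using norm_triangle_ineq4[of "T t (a + y)" "T t a"] by (simp add: T.add)
    moreover have "norm (T t y) = r / (2 * norm x) * norm (T t x)"
      using r by (simp add: y_def T.scaleR)
    ultimately have "norm (T t x) \<le> 4 * real n / r * norm x"
      using r False by (simp add: field_simps)
    also have "\<dots> \<le> M * norm x" by (intro mult_right_mono) (auto simp: M_def)
    finally show ?thesis .
  qed
  then show ?thesis by (intro exI[of _ "1 / real (Suc n)"] conjI exI[of _ M]) (simp, blast)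
qed

lemma has_real_derivative_norm_square:
  assumes "(f has_vector_derivative d) (at t within S)"
  shows "((\<lambda>s. (norm (f s))\<^sup>2) has_real_derivative 2 * inner (f t) d) (at t within S)"
proof -
  have "((\<lambda>s. inner (f s) (f s)) has_derivative
      (\<lambda>h. inner (f t) (h *\<^sub>R d) + inner (h *\<^sub>R d) (f t))) (at t within S)"
    using assms unfolding has_vector_derivative_def by (intro has_derivative_inner)
  then show ?thesis
    unfolding has_field_derivative_def power2_norm_eq_inner
    by (rule has_derivative_eq_rhs) (auto simp: inner_commute)
qed

lemma deriv_nonpos_decreasing:
  fixes f :: "real \<Rightarrow> real"
  assumes "\<And>t. t \<in> {a..b} \<Longrightarrow> (f has_real_derivative f' t) (at t within {a..b})"
    and "\<And>t. t \<in> {a..b} \<Longrightarrow> f' t \<le> 0" and "a \<le> b"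
  shows "f b \<le> f a"
proof (rule DERIV_nonpos_imp_decreasing_open[OF \<open>a \<le> b\<close>])
  show "continuous_on {a..b} f" using assms(1) by (rule DERIV_continuous_on)
  show "\<exists>y. DERIV f x :> y \<and> y \<le> 0" if "a < x" "x < b" for x
    using assms(1,2)[of x] that
    by (intro exI[of _ "f' x"]) (auto simp: at_within_Icc_at)
qed

text \<open>Contractivity comes from dissipativity alone. Local boundedness makes orbits from
  \<open>D\<close> differentiable on a short interval, where the squared norm then decreases;
  density extends this to all vectors, and the semigroup law to all times. \<open>gen'\<close> says
  that \<open>G\<close> is the whole generator, which yields invariance of \<open>D\<close>.\<close>

lemma contraction_semigroupI:
  fixes T :: "real \<Rightarrow> 'a::{real_inner, complete_space} \<Rightarrow> 'a"
  assumes bl: "\<And>t. t \<ge> 0 \<Longrightarrow> bounded_linear (T t)" and zero: "\<And>x. T 0 x = x"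
    and add: "\<And>s t x. s \<ge> 0 \<Longrightarrow> t \<ge> 0 \<Longrightarrow> T (s + t) x = T s (T t x)"
    and cont0: "\<And>x. ((\<lambda>t. T t x) \<longlongrightarrow> x) (at_right 0)"
    and gen: "\<And>x. x \<in> D \<Longrightarrow> ((\<lambda>t. (1 / t) *\<^sub>R (T t x - x)) \<longlongrightarrow> G x) (at_right 0)"
    and gen': "\<And>x y. ((\<lambda>t. (1 / t) *\<^sub>R (T t x - x)) \<longlongrightarrow> y) (at_right 0) \<Longrightarrow> x \<in> D \<and> G x = y"
    and diss: "\<And>x. x \<in> D \<Longrightarrow> inner (G x) x \<le> 0" and dense: "closure D = UNIV"
  shows "contraction_semigroup T D G"
proof -
  obtain \<delta> M where \<delta>: "\<delta> > 0" and M: "\<And>t x. 0 \<le> t \<Longrightarrow> t \<le> \<delta> \<Longrightarrow> norm (T t x) \<le> M * norm x"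
    using semigroup_locally_bounded[OF bl zero cont0] by (metis atLeastAtMost_iff)
  have lin: "linear (T t)" if "t \<ge> 0" for t using bl[OF that] by (rule bounded_linear.linear)
  have DG: "T t x \<in> D \<and> G (T t x) = T t (G x)" if t: "t \<ge> 0" and x: "x \<in> D" for t x
  proof (rule gen')
    have "((\<lambda>s. T t ((1 / s) *\<^sub>R (T s x - x))) \<longlongrightarrow> T t (G x)) (at_right 0)"
      by (rule bounded_linear.tendsto[OF bl[OF t] gen[OF x]])
    moreover have "eventually (\<lambda>s. T t ((1 / s) *\<^sub>R (T s x - x)) = (1 / s) *\<^sub>R (T s (T t x) - T t x))
        (at_right 0)"
      using eventually_at_right_less
    proof eventually_elim
      case (elim s)
      have "T t (T s x) = T s (T t x)" using add[of t s x] add[of s t x] elim t by (simp add: add.commute)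
      then show ?case using lin[OF t] by (simp add: linear_diff linear_cmul)
    qed
    ultimately show "((\<lambda>s. (1 / s) *\<^sub>R (T s (T t x) - T t x)) \<longlongrightarrow> T t (G x)) (at_right 0)"
      by (rule Lim_transform_eventually)
  qed
  have small: "norm (T t x) \<le> norm x" if t: "0 \<le> t" "t \<le> \<delta>" for t x
  proof -
    have *: "norm (T t x) \<le> norm x" if x: "x \<in> D" for x
    proof -
      have der: "((\<lambda>s. T s x) has_vector_derivative T s (G x)) (at s within {0..t})" if "s \<in> {0..t}" for s
      proof (rule semigroup_has_vector_derivative[where M=M])
        show "norm (T r y) \<le> M * norm y" if "0 \<le> r" "r \<le> t" for r y using M that t by simp
      qed (fact lin add cont0 gen[OF x] that)+
      have "(norm (T t x))\<^sup>2 \<le> (norm (T 0 x))\<^sup>2"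
      proof (rule deriv_nonpos_decreasing[OF has_real_derivative_norm_square[OF der]])
        show "2 * inner (T s x) (T s (G x)) \<le> 0" if "s \<in> {0..t}" for s
          using diss[of "T s x"] DG[of s x] x that by (simp add: inner_commute)
      qed (use t in auto)
      then show ?thesis by (simp add: zero power2_le_iff_abs_le)
    qed
    have "closed {x. norm (T t x) \<le> norm x}"
      using t by (intro closed_Collect_le continuous_on_norm linear_continuous_on bl continuous_on_id) auto
    then have "closure D \<subseteq> {x. norm (T t x) \<le> norm x}" using * by (intro closure_minimal) auto
    then show ?thesis using dense by auto
  qed
  have contr: "norm (T t x) \<le> norm x" if t: "0 \<le> t" for t x
  proof -
    obtain n where n: "t / \<delta> < real n" using reals_Archimedean2 by blast
    have n0: "n > 0" using n t \<delta> by (intro gr0I) (simp add: divide_less_0_iff)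
    define s where "s = t / real n"
    have "t < \<delta> * real n" using n \<delta> by (simp add: field_simps)
    then have s: "0 \<le> s" "s \<le> \<delta>" using n0 t by (simp_all add: s_def field_simps)
    have "norm (T (real k * s) x) \<le> norm x" for k
    proof (induction k)
      case (Suc k)
      have "T (real (Suc k) * s) x = T s (T (real k * s) x)"
        using add[of s "real k * s" x] s by (simp add: algebra_simps)
      then show ?case using small[OF s, of "T (real k * s) x"] Suc by simp
    qed (simp add: zero)
    from this[of n] show ?thesis using n0 by (simp add: s_def)
  qed
  show ?thesis
    by (rule contraction_semigroup.intro) (use DG in \<open>auto intro!: lin contr zero add cont0 gen\<close>)
qed

section \<open>Self-adjoint operators and the wave generator\<close>

lemma self_adjoint_onD:
  assumes "self_adjoint_on D A"
  shows "subspace D" "closure D = UNIV"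
    "x \<in> D \<Longrightarrow> y \<in> D \<Longrightarrow> A (x + y) = A x + A y" "x \<in> D \<Longrightarrow> A (a *\<^sub>R x) = a *\<^sub>R A x"
proof -
  have "subspace D \<and> closure D = UNIV \<and> (\<forall>x\<in>D. \<forall>y\<in>D. A (x + y) = A x + A y) \<and>
      (\<forall>c. \<forall>x\<in>D. A (c *\<^sub>R x) = c *\<^sub>R A x)"
    using assms unfolding self_adjoint_on_def by (elim conjE, intro conjI) assumption+
  then show "subspace D" "closure D = UNIV"
    "x \<in> D \<Longrightarrow> y \<in> D \<Longrightarrow> A (x + y) = A x + A y" "x \<in> D \<Longrightarrow> A (a *\<^sub>R x) = a *\<^sub>R A x"
    by blast+
qed

text \<open>From left to right this is symmetry; from right to left it says that the domain is that
  of the adjoint. Closedness and the range arguments below use the second direction.\<close>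

lemma self_adjoint_graph:
  assumes "self_adjoint_on D A"
  shows "y \<in> D \<and> A y = z \<longleftrightarrow> (\<forall>x\<in>D. inner (A x) y = inner x z)"
proof -
  have "{(y, A y) | y. y \<in> D} = {(y, z). \<forall>x\<in>D. inner (A x) y = inner x z}"
    using assms unfolding self_adjoint_on_def by (elim conjE)
  then have "(y, z) \<in> {(y, A y) | y. y \<in> D} \<longleftrightarrow> (y, z) \<in> {(y, z). \<forall>x\<in>D. inner (A x) y = inner x z}"
    by (rule eqset_imp_iff)
  then show ?thesis by auto
qed

lemma self_adjoint_symmetric:
  assumes "self_adjoint_on D A" "x \<in> D" "y \<in> D"
  shows "inner (A x) y = inner x (A y)"
  using self_adjoint_graph[OF assms(1), of y "A y"] assms(2,3) by simp

lemma self_adjoint_graphI: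
  assumes "self_adjoint_on D A" "\<And>x. x \<in> D \<Longrightarrow> inner (A x) y = inner x z"
  shows "y \<in> D \<and> A y = z"
  using self_adjoint_graph[OF assms(1), of y z] assms(2) by simp

lemma self_adjoint_closed:
  assumes A: "self_adjoint_on D A" and X: "\<And>n. X n \<in> D" "X \<longlonglongrightarrow> x" "(\<lambda>n. A (X n)) \<longlonglongrightarrow> y"
  shows "x \<in> D \<and> A x = y"
proof (rule self_adjoint_graphI[OF A])
  fix z assume z: "z \<in> D"
  have "(\<lambda>n. inner (A z) (X n)) \<longlonglongrightarrow> inner (A z) x" "(\<lambda>n. inner z (A (X n))) \<longlonglongrightarrow> inner z y"
    by (intro tendsto_intros X)+
  then show "inner (A z) x = inner z y"
    using self_adjoint_symmetric[OF A z X(1)] LIMSEQ_unique by simp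
qed

lemma self_adjoint_diff:
  assumes "self_adjoint_on D A" "x \<in> D" "y \<in> D"
  shows "A (x - y) = A x - A y"
proof -
  have "A (x + (-1) *\<^sub>R y) = A x + (-1) *\<^sub>R A y"
    using self_adjoint_onD[OF assms(1)] assms(2,3) by (metis subspace_scale)
  then show ?thesis by simp
qed

text \<open>\<open>D\<close> is the domain of the square root \<open>R\<close>, whose inverse is \<open>S\<close>.\<close>

locale positive_root =
  fixes D :: "'h::{real_inner, complete_space} set" and R S :: "'h \<Rightarrow> 'h" and c :: real
  assumes self_adjoint: "self_adjoint_on D R"
    and S_mem [simp]: "S y \<in> D" and R_S [simp]: "R (S y) = y"
    and S_R [simp]: "x \<in> D \<Longrightarrow> S (R x) = x"
    and norm_S: "norm (S y) \<le> c * norm y" and c_pos: "c > 0"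
begin

lemma subspace_D: "subspace D" and dense_D: "closure D = UNIV"
  and R_add: "x \<in> D \<Longrightarrow> y \<in> D \<Longrightarrow> R (x + y) = R x + R y"
  and R_scale: "x \<in> D \<Longrightarrow> R (a *\<^sub>R x) = a *\<^sub>R R x"
  by (fact self_adjoint_onD[OF self_adjoint])+

lemmas R_diff = self_adjoint_diff[OF self_adjoint]
  and R_sym = self_adjoint_symmetric[OF self_adjoint]

lemma R_0 [simp]: "R 0 = 0" using R_scale[of 0 0] subspace_0[OF subspace_D] by simp

lemma R_minus: "x \<in> D \<Longrightarrow> R (- x) = - R x" using R_scale[of x "-1"] by simp

lemma D_closed [intro]:
  "0 \<in> D" "x \<in> D \<Longrightarrow> y \<in> D \<Longrightarrow> x + y \<in> D" "x \<in> D \<Longrightarrow> y \<in> D \<Longrightarrow> x - y \<in> D"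
  "x \<in> D \<Longrightarrow> a *\<^sub>R x \<in> D" "x \<in> D \<Longrightarrow> - x \<in> D"
  using subspace_D by (simp_all add: subspace_0 subspace_add subspace_diff subspace_scale subspace_neg)

lemma bounded_linear_S: "bounded_linear S"
proof (rule bounded_linear_intro[where K=c])
  show "S (x + y) = S x + S y" for x y
    using S_R[of "S x + S y"] by (simp add: R_add D_closed)
  show "S (a *\<^sub>R x) = a *\<^sub>R S x" for a x
    using S_R[of "a *\<^sub>R S x"] by (simp add: R_scale D_closed)
qed (use norm_S in \<open>simp add: mult.commute\<close>)

lemma norm_le_R: "x \<in> D \<Longrightarrow> norm x \<le> c * norm (R x)" using norm_S[of "R x"] by simp

definition skew :: "'h \<times> 'h \<Rightarrow> 'h \<times> 'h" where "skew z = (R (snd z), - R (fst z))"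

lemma skew_inner: "z \<in> D \<times> D \<Longrightarrow> inner (skew z) z = 0"
  using R_sym[of "snd z" "fst z"] by (auto simp: skew_def inner_prod_def inner_commute)

lemma skew_add: "z \<in> D \<times> D \<Longrightarrow> w \<in> D \<times> D \<Longrightarrow> skew (z + w) = skew z + skew w"
  by (auto simp: skew_def R_add)

lemma skew_diff: "z \<in> D \<times> D \<Longrightarrow> w \<in> D \<times> D \<Longrightarrow> skew (z - w) = skew z - skew w"
  by (auto simp: skew_def R_diff)

lemma skew_scale: "z \<in> D \<times> D \<Longrightarrow> skew (a *\<^sub>R z) = a *\<^sub>R skew z"
  by (auto simp: skew_def R_scale)

lemma norm_le_skew: "z \<in> D \<times> D \<Longrightarrow> norm z \<le> c * norm (skew z)"
proof -
  assume "z \<in> D \<times> D"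
  then have "norm (fst z) \<le> c * norm (R (fst z))" "norm (snd z) \<le> c * norm (R (snd z))"
    by (auto intro: norm_le_R)
  then have "(norm z)\<^sup>2 \<le> (c * norm (R (fst z)))\<^sup>2 + (c * norm (R (snd z)))\<^sup>2"
    unfolding norm_prod_def by (simp add: add_mono power_mono)
  also have "\<dots> = (c * norm (skew z))\<^sup>2"
    by (simp add: norm_prod_def skew_def power_mult_distrib distrib_left)
  finally show ?thesis using c_pos by (simp add: power2_le_iff_abs_le)
qed

lemma subspace_DD: "subspace (D \<times> D)" by (intro subspace_Times subspace_D)

lemma dense_DD: "closure (D \<times> D) = UNIV" by (simp add: closure_Times dense_D)

text \<open>Skewness makes \<open>I - e skew\<close> bounded below, and closedness of
  \<open>R\<close> closes its graph. If \<open>(a, b)\<close> is orthogonal to the range, testing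
  with each component shows that \<open>a\<close> and \<open>b\<close> lie in \<open>D\<close> with
  \<open>R b = - a / e\<close> and \<open>R a = b / e\<close>; symmetry of \<open>R\<close> then
  makes the squared norms of \<open>a\<close> and \<open>b\<close> opposite, so both vanish.\<close>

lemma m_dissipative_skew: "m_dissipative (D \<times> D) skew"
proof
  fix e :: real and y :: "'h \<times> 'h" assume e: "e > 0"
  define T where "T x = x - e *\<^sub>R skew x" for x
  have ran: "subspace (T ` (D \<times> D))"
  proof -
    have "x \<in> D \<times> D \<Longrightarrow> z \<in> D \<times> D \<Longrightarrow> T x + T z = T (x + z)" for x z
      by (simp add: T_def skew_add algebra_simps)
    moreover have "x \<in> D \<times> D \<Longrightarrow> a *\<^sub>R T x = T (a *\<^sub>R x)" for x a
      by (simp add: T_def skew_scale algebra_simps)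
    moreover have "0 = T 0" by (simp add: T_def skew_def zero_prod_def)
    ultimately show ?thesis
      unfolding subspace_def using subspace_DD by (auto simp: subspace_0 subspace_add subspace_scale)
  qed
  have "T ` (D \<times> D) = UNIV"
  proof (rule bounded_below_surj[OF ran, of 1])
    fix x z assume xz: "x \<in> D \<times> D" "z \<in> D \<times> D"
    then have w: "x - z \<in> D \<times> D" using subspace_DD by (simp add: subspace_diff)
    have "norm (x - z) * norm (x - z) = inner ((x - z) - e *\<^sub>R skew (x - z)) (x - z)"
      using skew_inner[OF w]
      by (simp add: inner_diff_left[of "x - z" "e *\<^sub>R skew (x - z)"] power2_norm_eq_inner[symmetric] power2_eq_square)
    also have "\<dots> \<le> norm ((x - z) - e *\<^sub>R skew (x - z)) * norm (x - z)" by (rule norm_cauchy_schwarz)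
    also have "(x - z) - e *\<^sub>R skew (x - z) = T x - T z"
      using xz by (simp add: T_def skew_diff scaleR_diff_right)
    finally show "dist x z \<le> 1 * dist (T x) (T z)"
      by (cases "x = z") (auto simp: dist_norm)
  next
    fix X x y assume X: "\<And>n. X n \<in> D \<times> D" "X \<longlonglongrightarrow> x" "(\<lambda>n. T (X n)) \<longlonglongrightarrow> y"
    have "(\<lambda>n. (1 / e) *\<^sub>R (X n - T (X n))) \<longlonglongrightarrow> (1 / e) *\<^sub>R (x - y)"
      by (intro tendsto_intros X)
    then have lim: "(\<lambda>n. skew (X n)) \<longlonglongrightarrow> (1 / e) *\<^sub>R (x - y)"
      using e by (simp add: T_def)
    have "snd x \<in> D \<and> R (snd x) = fst ((1 / e) *\<^sub>R (x - y))"
      using tendsto_fst[OF lim] X(1)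
      by (intro self_adjoint_closed[OF self_adjoint _ tendsto_snd[OF X(2)]]) (auto simp: skew_def mem_Times_iff)
    moreover have "fst x \<in> D \<and> R (fst x) = - snd ((1 / e) *\<^sub>R (x - y))"
      using tendsto_minus[OF tendsto_snd[OF lim]] X(1)
      by (intro self_adjoint_closed[OF self_adjoint _ tendsto_fst[OF X(2)]]) (auto simp: skew_def mem_Times_iff)
    ultimately have "x \<in> D \<times> D" "skew x = (1 / e) *\<^sub>R (x - y)"
      by (auto simp: skew_def mem_Times_iff intro: prod_eqI)
    then show "x \<in> D \<times> D \<and> T x = y" using e by (simp add: T_def)
  next
    fix y :: "'h \<times> 'h" assume y: "\<And>x. x \<in> D \<times> D \<Longrightarrow> inner (T x) y = 0"
    obtain a b where ab: "y = (a, b)" by force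
    have "b \<in> D \<and> R b = (- 1 / e) *\<^sub>R a"
    proof (rule self_adjoint_graphI[OF self_adjoint])
      fix u assume "u \<in> D"
      with y[of "(u, 0)"] have "inner u a + e * inner (R u) b = 0"
        by (auto simp: ab T_def skew_def inner_prod_def)
      then show "inner (R u) b = inner u ((- 1 / e) *\<^sub>R a)" using e by (simp add: field_simps)
    qed
    moreover have "a \<in> D \<and> R a = (1 / e) *\<^sub>R b"
    proof (rule self_adjoint_graphI[OF self_adjoint])
      fix v assume "v \<in> D"
      with y[of "(0, v)"] have "inner v b = e * inner (R v) a"
        by (auto simp: ab T_def skew_def inner_prod_def)
      then show "inner (R v) a = inner v ((1 / e) *\<^sub>R b)" using e by (simp add: field_simps)
    qed
    ultimately have "(- 1 / e) * inner a a = (1 / e) * inner b b"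
      using R_sym[of b a] by simp
    then have "inner a a + inner b b = 0" using e by (simp add: field_simps)
    then show "y = 0" by (simp add: ab add_nonneg_eq_0_iff zero_prod_def)
  qed simp
  then have "y \<in> T ` (D \<times> D)" by simp
  then show "\<exists>x\<in>D \<times> D. x - e *\<^sub>R skew x = y" by (rule imageE) (simp add: T_def, blast)
next
  show "inner (skew x) x \<le> 0" if "x \<in> D \<times> D" for x using skew_inner[OF that] by simp
qed (fact subspace_DD dense_DD skew_add skew_scale)+

end

text \<open>\<open>A\<close> is onto because it is bounded below and self-adjoint, hence so is
  \<open>R\<close>. The lower bound for \<open>R\<close> is by duality, without spectral calculus:
  write \<open>x = A u\<close>, so that the squared norm of \<open>x\<close> is the inner product of
  \<open>R x\<close> and \<open>R u\<close>, and bound \<open>R u\<close> by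
  \<open>x\<close>.\<close>

lemma square_root_facts:
  fixes A R :: "'h::{real_inner, complete_space} \<Rightarrow> 'h"
  assumes A: "self_adjoint_on D0 A" and pos: "strictly_positive_on D0 A" and R: "is_sqrt_of D R D0 A"
  shows "\<exists>S c. positive_root D R S c"
proof -
  obtain m where m: "m > 0" "\<And>x. x \<in> D0 \<Longrightarrow> inner (A x) x \<ge> m * (norm x)\<^sup>2"
    using pos by (auto simp: strictly_positive_on_def)
  have sR: "self_adjoint_on D R" and D0: "D0 = {x\<in>D. R x \<in> D}" and AR: "\<And>x. x \<in> D0 \<Longrightarrow> A x = R (R x)"
    using R unfolding is_sqrt_of_def by (elim conjE; blast)+
  have subA: "subspace D0" and addA: "\<And>x y. x \<in> D0 \<Longrightarrow> y \<in> D0 \<Longrightarrow> A (x + y) = A x + A y"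
    and scaleA: "\<And>a x. x \<in> D0 \<Longrightarrow> A (a *\<^sub>R x) = a *\<^sub>R A x"
    by (fact self_adjoint_onD[OF A])+
  have lower: "m * norm x \<le> norm (A x)" if "x \<in> D0" for x
  proof -
    have "m * norm x * norm x \<le> norm (A x) * norm x"
      using m(2)[OF that] norm_cauchy_schwarz[of "A x" x] by (simp add: power2_eq_square)
    then show ?thesis by (cases "x = 0") auto
  qed
  have surj: "A ` D0 = UNIV"
  proof (rule bounded_below_surj[of A D0 "1 / m"])
    show "subspace (A ` D0)"
      unfolding subspace_def
    proof (intro conjI ballI allI)
      show "0 \<in> A ` D0" using scaleA[of 0 0] subspace_0[OF subA] by (auto intro!: image_eqI[of _ _ 0])
      show "x + y \<in> A ` D0" if "x \<in> A ` D0" "y \<in> A ` D0" for x y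
        using that addA subspace_add[OF subA] by (auto simp flip: addA)
      show "a *\<^sub>R x \<in> A ` D0" if "x \<in> A ` D0" for a x
        using that subspace_scale[OF subA] by (auto simp flip: scaleA)
    qed
    show "dist x y \<le> 1 / m * dist (A x) (A y)" if "x \<in> D0" "y \<in> D0" for x y
      using lower[of "x - y"] that m subspace_diff[OF subA]
      by (simp add: self_adjoint_diff[OF A] dist_norm field_simps)
    show "y = 0" if "\<And>x. x \<in> D0 \<Longrightarrow> inner (A x) y = 0" for y
    proof -
      have "y \<in> D0 \<and> A y = 0" by (rule self_adjoint_graphI[OF A]) (use that in simp)
      then show ?thesis using lower[of y] m by (auto simp: mult_le_0_iff)
    qed
    show "x \<in> D0 \<and> A x = y" if "\<And>n. X n \<in> D0" "X \<longlonglongrightarrow> x" "(\<lambda>n. A (X n)) \<longlonglongrightarrow> y" for X x y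
      using self_adjoint_closed[OF A that] .
  qed (use m in simp)
  \<comment> \<open>The squared norm of \<open>R u\<close> is the inner product of
    \<open>x = A u\<close> with \<open>u\<close>, hence at most
    \<open>(norm x)\<^sup>2 / m\<close>.\<close>
  define k where "k = 1 / sqrt m"
  have k: "k > 0" using m by (simp add: k_def)
  have bound: "norm x \<le> k * norm (R x)" if x: "x \<in> D" for x
  proof -
    obtain u where u: "u \<in> D0" "A u = x" using surj by (metis UNIV_I imageE)
    have uD: "u \<in> D" "R u \<in> D" using u D0 by auto
    have "m * (norm u)\<^sup>2 \<le> norm x * norm u" using m(2)[OF u(1)] u(2) norm_cauchy_schwarz[of x u] by simp
    then have nu: "m * norm u \<le> norm x" by (cases "u = 0") (auto simp: power2_eq_square)
    have "(norm (R u))\<^sup>2 = inner x u"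
      using AR[OF u(1)] u(2) self_adjoint_symmetric[OF sR uD(2) uD(1)] by (simp add: power2_norm_eq_inner)
    also have "\<dots> \<le> norm x * norm u" by (rule norm_cauchy_schwarz)
    also have "\<dots> \<le> norm x * (norm x / m)" using nu m by (intro mult_left_mono) (auto simp: field_simps)
    also have "\<dots> = (k * norm x)\<^sup>2" using m by (simp add: k_def power_mult_distrib power_divide power2_eq_square)
    finally have Ru: "norm (R u) \<le> k * norm x" using k by (simp add: power2_le_iff_abs_le)
    have "norm x * norm x = inner (R x) (R u)"
      using AR[OF u(1)] u(2) self_adjoint_symmetric[OF sR x uD(2)] by (metis power2_eq_square power2_norm_eq_inner)
    also have "\<dots> \<le> norm (R x) * norm (R u)" by (rule norm_cauchy_schwarz)
    also have "\<dots> \<le> norm (R x) * (k * norm x)" by (intro mult_left_mono Ru) simp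
    finally show ?thesis by (cases "x = 0") (auto simp: mult_ac k less_imp_le)
  qed
  have ex: "\<exists>x\<in>D. R x = y" for y
  proof -
    obtain u where "u \<in> D0" "A u = y" using surj by (metis UNIV_I imageE)
    then show ?thesis using AR D0 by auto
  qed
  define S where "S y = (SOME x. x \<in> D \<and> R x = y)" for y
  have S: "S y \<in> D" "R (S y) = y" for y
    using someI_ex[of "\<lambda>x. x \<in> D \<and> R x = y"] ex[of y] unfolding S_def by blast+
  have "positive_root D R S k"
  proof
    show "S (R x) = x" if "x \<in> D" for x
    proof -
      have "S (R x) - x \<in> D" using S that self_adjoint_onD(1)[OF sR] by (auto intro: subspace_diff)
      from bound[OF this] show ?thesis using S that by (simp add: self_adjoint_diff[OF sR])
    qed
    show "norm (S y) \<le> k * norm y" for y using bound[OF S(1), of y] S(2) by simp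
  qed (fact sR S k)+
  then show ?thesis by blast
qed

section \<open>The damped wave equation\<close>

context contraction_semigroup begin

lemma has_derivative_T_comp:
  "x \<in> D \<Longrightarrow> t \<in> {0..\<tau>} \<Longrightarrow> ((\<lambda>s. T s x) has_vector_derivative G (T t x)) (at t within {0..\<tau>})"
  using has_derivative_T[of x t \<tau>] commute[of t x] by simp

end

lemma norm_triangle3:
  fixes x y z :: "'a::real_normed_vector"
  shows "norm (x + y + z) \<le> norm x + norm y + norm z" "norm (x + y - z) \<le> norm x + norm y + norm z"
    "norm (x - y + z) \<le> norm x + norm y + norm z" "norm (x - y - z) \<le> norm x + norm y + norm z"
  using norm_triangle_ineq[of "x + y" z] norm_triangle_ineq4[of "x + y" z]
    norm_triangle_ineq[of "x - y" z] norm_triangle_ineq4[of "x - y" z]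
    norm_triangle_ineq[of x y] norm_triangle_ineq4[of x y] by linarith+

lemma norm_fst_snd_le: "norm (fst z) \<le> norm z" "norm (snd z) \<le> norm z"
  using norm_fst_le[of "fst z" "snd z"] norm_snd_le[of "snd z" "fst z"] by simp_all

text \<open>\<open>B\<close> stands for \<open>adjoint C0\<close> after \<open>C0\<close>, with
  \<open>b\<close> a bound for the squared norm of \<open>C0\<close>; \<open>norm_B_square\<close>
  alone yields positivity and boundedness. \<open>P\<close> and \<open>N\<close> are the two given
  damped semigroups in the coordinates \<open>(R p, v)\<close>.\<close>

locale damped_wave = positive_root D R S c + P: contraction_semigroup P "D \<times> D" "\<lambda>z. skew z - (0, B (snd z))"
    + N: contraction_semigroup N "D \<times> D" "\<lambda>z. - skew z - (0, B (snd z))"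
  for D :: "'h::{real_inner, complete_space} set" and R S c and B :: "'h \<Rightarrow> 'h" and P N +
  fixes b K :: real
  assumes linear_B: "bounded_linear B" and B_sym: "inner (B x) y = inner x (B y)"
    and norm_B_square: "(norm (B x))\<^sup>2 \<le> b * inner (B x) x" and b_nonneg: "b \<ge> 0"
    and B_mem: "x \<in> D \<Longrightarrow> B x \<in> D" and norm_R_B: "x \<in> D \<Longrightarrow> norm (R (B x)) \<le> K * norm (R x)"
    and K_nonneg: "K \<ge> 0"
begin

definition damp :: "'h \<times> 'h \<Rightarrow> 'h \<times> 'h" where "damp z = (0, B (snd z))"

lemma B_pos: "inner (B x) x \<ge> 0"
proof (cases "b = 0")
  case True
  then show ?thesis using norm_B_square[of x] by simp
next
  case False
  then have "0 \<le> b * inner (B x) x" using norm_B_square[of x] by (meson order_trans zero_le_power2)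
  then show ?thesis using False b_nonneg by (simp add: zero_le_mult_iff)
qed

lemma norm_B: "norm (B x) \<le> b * norm x"
proof -
  have "norm (B x) * norm (B x) \<le> b * inner (B x) x" using norm_B_square by (simp add: power2_eq_square)
  also have "\<dots> \<le> b * (norm (B x) * norm x)" by (intro mult_left_mono norm_cauchy_schwarz b_nonneg)
  finally have "norm (B x) * norm (B x) \<le> norm (B x) * (b * norm x)" by (simp add: mult_ac)
  then show ?thesis using b_nonneg by (cases "B x = 0") (auto simp: mult_le_cancel_left)
qed

lemma inner_B_le: "inner (B x) x \<le> b * (norm x)\<^sup>2"
  using norm_cauchy_schwarz[of "B x" x] mult_right_mono[OF norm_B[of x], of "norm x"]
  by (simp add: power2_eq_square mult_ac)

lemma inner_damp [simp]: "inner (damp z) w = inner (B (snd z)) (snd w)"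
  by (simp add: damp_def inner_prod_def)

lemma norm_damp: "norm (damp z) \<le> b * norm z"
proof -
  have "norm (damp z) = norm (B (snd z))" by (simp add: damp_def norm_Pair)
  also have "\<dots> \<le> b * norm (snd z)" by (rule norm_B)
  also have "\<dots> \<le> b * norm z"
    by (intro mult_left_mono b_nonneg norm_fst_snd_le)
  finally show ?thesis .
qed

lemma damp_mem: "z \<in> D \<times> D \<Longrightarrow> damp z \<in> D \<times> D" by (auto simp: damp_def B_mem D_closed)

lemma norm_skew_damp: "z \<in> D \<times> D \<Longrightarrow> norm (skew (damp z)) \<le> K * norm (skew z)"
proof -
  assume z: "z \<in> D \<times> D"
  have "norm (skew (damp z)) = norm (R (B (snd z)))" by (simp add: damp_def skew_def norm_Pair)
  also have "\<dots> \<le> K * norm (R (snd z))" using z by (intro norm_R_B) auto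
  also have "\<dots> \<le> K * norm (skew z)"
    by (intro mult_left_mono K_nonneg) (metis skew_def norm_fst_le)
  finally show ?thesis .
qed

definition Gp where "Gp z = skew z - damp z"
definition Gm where "Gm z = - skew z - damp z"

lemma contraction_P: "contraction_semigroup P (D \<times> D) Gp"
  using P.contraction_semigroup_axioms unfolding Gp_def damp_def .

lemma contraction_N: "contraction_semigroup N (D \<times> D) Gm"
  using N.contraction_semigroup_axioms unfolding Gm_def damp_def .

text \<open>\<open>P\<close> commutes with \<open>skew - damp\<close>; solving for
  \<open>skew\<close> leaves a commutator made of bounded terms only. The same holds for
  \<open>N\<close>, with the sign of \<open>skew\<close> reversed.\<close>

lemma skew_P: "z \<in> D \<times> D \<Longrightarrow> t \<ge> 0 \<Longrightarrow> skew (P t z) = P t (skew z) - P t (damp z) + damp (P t z)"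
  using contraction_semigroup.commute[OF contraction_P, of t z] linear_diff[OF P.linear_T, of t]
  by (simp add: Gp_def algebra_simps)

lemma skew_N: "z \<in> D \<times> D \<Longrightarrow> t \<ge> 0 \<Longrightarrow> skew (N t z) = N t (skew z) + N t (damp z) - damp (N t z)"
proof -
  assume z: "z \<in> D \<times> D" "t \<ge> 0"
  have "- skew (N t z) - damp (N t z) = N t (- skew z - damp z)"
    using contraction_semigroup.commute[OF contraction_N, of t z] z by (simp add: Gm_def)
  also have "\<dots> = - N t (skew z) - N t (damp z)"
    using z(2) by (simp add: linear_diff[OF N.linear_T] linear_neg[OF N.linear_T])
  finally have "- (- skew (N t z) - damp (N t z)) - damp (N t z)
      = - (- N t (skew z) - N t (damp z)) - damp (N t z)" by (rule arg_cong)
  then show ?thesis by simp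
qed

definition D2 where "D2 = {z \<in> D \<times> D. skew z \<in> D \<times> D}"

lemmas DD_add = subspace_add[OF subspace_DD] and DD_diff = subspace_diff[OF subspace_DD]
  and DD_scale = subspace_scale[OF subspace_DD] and DD_neg = subspace_neg[OF subspace_DD]

lemma P_D2: "z \<in> D2 \<Longrightarrow> t \<ge> 0 \<Longrightarrow> P t z \<in> D2"
  by (auto simp only: D2_def mem_Collect_eq skew_P intro!: DD_add DD_diff P.dom damp_mem)

lemma N_D2: "z \<in> D2 \<Longrightarrow> t \<ge> 0 \<Longrightarrow> N t z \<in> D2"
  by (auto simp only: D2_def mem_Collect_eq skew_N intro!: DD_add DD_diff N.dom damp_mem)

text \<open>The 1 is the part of \<open>skew_P\<close> that commutes; each of the two damping terms
  is at most \<open>b * norm z\<close>, hence at most \<open>b * c * norm (skew z)\<close>. The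
  bound is uniform in time.\<close>

definition q where "q = 1 + 2 * b * c"

lemma q_pos: "q > 0" using b_nonneg c_pos by (simp add: q_def add_pos_nonneg)

lemma norm_skew_aux:
  assumes z: "z \<in> D \<times> D" and "norm x \<le> norm (skew z)" "norm y \<le> b * norm z" "norm w \<le> b * norm z"
  shows "norm x + norm y + norm w \<le> q * norm (skew z)"
proof -
  have "b * norm z \<le> b * (c * norm (skew z))" by (intro mult_left_mono norm_le_skew z b_nonneg)
  then show ?thesis using assms by (simp add: q_def distrib_right)
qed

lemma norm_skew_P: assumes z: "z \<in> D \<times> D" "t \<ge> 0" shows "norm (skew (P t z)) \<le> q * norm (skew z)"
proof -
  have "norm (skew (P t z)) \<le> norm (P t (skew z)) + norm (P t (damp z)) + norm (damp (P t z))"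
    unfolding skew_P[OF z] by (rule norm_triangle3)
  also have "\<dots> \<le> q * norm (skew z)"
  proof (rule norm_skew_aux[OF z(1)])
    show "norm (P t (damp z)) \<le> b * norm z" using P.contr[OF z(2), of "damp z"] norm_damp[of z] by simp
    show "norm (damp (P t z)) \<le> b * norm z"
      using norm_damp[of "P t z"] mult_left_mono[OF P.contr[OF z(2), of z] b_nonneg] by simp
  qed (use P.contr z in auto)
  finally show ?thesis .
qed

lemma norm_skew_N: assumes z: "z \<in> D \<times> D" "t \<ge> 0" shows "norm (skew (N t z)) \<le> q * norm (skew z)"
proof -
  have "norm (skew (N t z)) \<le> norm (N t (skew z)) + norm (N t (damp z)) + norm (damp (N t z))"
    unfolding skew_N[OF z] by (rule norm_triangle3)
  also have "\<dots> \<le> q * norm (skew z)"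
  proof (rule norm_skew_aux[OF z(1)])
    show "norm (N t (damp z)) \<le> b * norm z" using N.contr[OF z(2), of "damp z"] norm_damp[of z] by simp
    show "norm (damp (N t z)) \<le> b * norm z"
      using norm_damp[of "N t z"] mult_left_mono[OF N.contr[OF z(2), of z] b_nonneg] by simp
  qed (use N.contr z in auto)
  finally show ?thesis .
qed

definition L where "L t z = N t (P t z)"

lemma linear_L: "t \<ge> 0 \<Longrightarrow> linear (L t)"
  using linear_compose[OF P.linear_T N.linear_T] by (simp add: L_def[abs_def] o_def)

lemma norm_L: "t \<ge> 0 \<Longrightarrow> norm (L t z) \<le> norm z"
  unfolding L_def by (meson N.contr P.contr order_trans)

lemma L_dom: "t \<ge> 0 \<Longrightarrow> z \<in> D \<times> D \<Longrightarrow> L t z \<in> D \<times> D" unfolding L_def by (intro N.dom P.dom)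

lemma L_D2: "t \<ge> 0 \<Longrightarrow> z \<in> D2 \<Longrightarrow> L t z \<in> D2" unfolding L_def by (intro N_D2 P_D2)

text \<open>This is \<open>skew L - L skew\<close>. Since \<open>skew\<close> enters the two
  generators with opposite signs while the damping keeps its sign, the two middle damping terms add
  up instead of cancelling. No \<open>skew\<close> occurs, so the commutator is bounded by
  \<open>4 * b\<close> uniformly in time.\<close>

definition commutator where
  "commutator t z = 2 *\<^sub>R N t (damp (P t z)) - L t (damp z) - damp (L t z)"

lemma skew_L: "z \<in> D \<times> D \<Longrightarrow> t \<ge> 0 \<Longrightarrow> skew (L t z) = L t (skew z) + commutator t z"
proof -
  assume z: "z \<in> D \<times> D" "t \<ge> 0"
  have "skew (L t z) = N t (P t (skew z) - P t (damp z) + damp (P t z)) + N t (damp (P t z)) - damp (L t z)"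
    unfolding L_def using skew_N[OF P.dom[OF z(2,1)] z(2)] skew_P[OF z] by simp
  also have "N t (P t (skew z) - P t (damp z) + damp (P t z))
      = L t (skew z) - L t (damp z) + N t (damp (P t z))"
    by (simp add: L_def linear_add[OF N.linear_T[OF z(2)]] linear_diff[OF N.linear_T[OF z(2)]])
  finally show ?thesis by (simp add: commutator_def scaleR_2)
qed

lemma norm_commutator: assumes t: "t \<ge> 0" shows "norm (commutator t z) \<le> 4 * b * norm z"
proof -
  have "norm (commutator t z) \<le> norm (2 *\<^sub>R N t (damp (P t z))) + norm (L t (damp z)) + norm (damp (L t z))"
    unfolding commutator_def by (simp only: norm_triangle3)
  moreover have "norm (N t (damp (P t z))) \<le> b * norm z"
    using N.contr[OF t, of "damp (P t z)"] norm_damp[of "P t z"]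
      mult_left_mono[OF P.contr[OF t, of z] b_nonneg] by simp
  moreover have "norm (L t (damp z)) \<le> b * norm z"
    using norm_L[OF t, of "damp z"] norm_damp[of z] by simp
  moreover have "norm (damp (L t z)) \<le> b * norm z"
    using norm_damp[of "L t z"] mult_left_mono[OF norm_L[OF t, of z] b_nonneg] by simp
  ultimately show ?thesis by simp
qed

lemma commutator_mem: "t \<ge> 0 \<Longrightarrow> z \<in> D \<times> D \<Longrightarrow> commutator t z \<in> D \<times> D"
  unfolding commutator_def by (intro DD_diff DD_scale N.dom damp_mem P.dom L_dom)

text \<open>Needed because a second application of \<open>skew\<close> to \<open>L\<close>
  differentiates the commutator. Here the boundedness of \<open>B\<close> on the domain of
  \<open>R\<close> enters, through \<open>K\<close>.\<close>

lemma norm_skew_commutator: assumes t: "t \<ge> 0" and z: "z \<in> D \<times> D"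
  shows "norm (skew (commutator t z)) \<le> 4 * K * q\<^sup>2 * norm (skew z)"
proof -
  define n where "n = norm (skew z)"
  have L: "norm (skew (L t w)) \<le> q * (q * norm (skew w))" if "w \<in> D \<times> D" for w
    unfolding L_def using norm_skew_N[OF P.dom[OF t that] t]
      mult_left_mono[OF norm_skew_P[OF that t], of q] q_pos by linarith
  have mem: "N t (damp (P t z)) \<in> D \<times> D" "L t (damp z) \<in> D \<times> D" "damp (L t z) \<in> D \<times> D"
    using t z by (auto simp del: mem_Times_iff intro!: N.dom damp_mem P.dom L_dom)
  have "skew (commutator t z) = 2 *\<^sub>R skew (N t (damp (P t z))) - skew (L t (damp z)) - skew (damp (L t z))"
    unfolding commutator_def
    by (simp only: skew_diff[OF DD_diff[OF DD_scale[OF mem(1)] mem(2)] mem(3)]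
        skew_diff[OF DD_scale[OF mem(1)] mem(2)] skew_scale[OF mem(1)])
  then have "norm (skew (commutator t z))
      \<le> norm (2 *\<^sub>R skew (N t (damp (P t z)))) + norm (skew (L t (damp z))) + norm (skew (damp (L t z)))"
    by (simp only: norm_triangle3)
  moreover have "norm (skew (N t (damp (P t z)))) \<le> q * (K * (q * n))"
  proof -
    have "norm (skew (N t (damp (P t z)))) \<le> q * norm (skew (damp (P t z)))"
      using t z by (intro norm_skew_N damp_mem P.dom)
    also have "\<dots> \<le> q * (K * norm (skew (P t z)))"
      using t z q_pos by (intro mult_left_mono norm_skew_damp P.dom) auto
    also have "\<dots> \<le> q * (K * (q * n))"
      unfolding n_def using t z q_pos K_nonneg by (intro mult_left_mono norm_skew_P) auto
    finally show ?thesis .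
  qed
  moreover have "norm (skew (L t (damp z))) \<le> q * (q * (K * n))"
  proof -
    have "q * (q * norm (skew (damp z))) \<le> q * (q * (K * n))"
      unfolding n_def using q_pos by (intro mult_left_mono norm_skew_damp z) auto
    then show ?thesis using L[OF damp_mem[OF z]] by linarith
  qed
  moreover have "norm (skew (damp (L t z))) \<le> K * (q * (q * n))"
    using norm_skew_damp[OF L_dom[OF t z]] mult_left_mono[OF L[OF z] K_nonneg] by (simp add: n_def)
  ultimately show ?thesis by (simp add: n_def power2_eq_square algebra_simps)
qed

text \<open>\<open>L\<close> commutes with \<open>skew\<close> up to a commutator of order zero. Hence \<open>L\<close> is a contraction for a
  suitably weighted graph norm of \<open>skew\<^sup>2\<close>, and its powers are uniformly bounded there.\<close>

lemma L_pow_regularity: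
  assumes t: "t \<ge> 0" and \<eta>: "\<eta> < 1" "\<And>z. norm (L t z) \<le> \<eta> * norm z"
  shows "\<exists>C>0. \<forall>z\<in>D2. \<forall>n. (L t ^^ n) z \<in> D2 \<and> norm (skew (skew ((L t ^^ n) z))) \<le> C * norm (skew (skew z))"
proof -
  define a where "a = 4 * b + 4 * K * q\<^sup>2"
  \<comment> \<open>Applying \<open>L\<close> multiplies each seminorm in \<open>W\<close> by
    \<open>\<eta>\<close> and adds at most \<open>a\<close> times the next lower one. The weights
    solve \<open>a + \<beta> * \<eta> = \<beta>\<close> and
    \<open>\<beta> * a + \<gamma> * \<eta> = \<gamma>\<close>: the gain \<open>1 - \<eta>\<close> in
    a lower term pays for the commutator in the term above.\<close>
  define \<beta> where "\<beta> = a / (1 - \<eta>)"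
  define \<gamma> where "\<gamma> = \<beta> * a / (1 - \<eta>)"
  define W where "W z = norm (skew (skew z)) + \<beta> * norm (skew z) + \<gamma> * norm z" for z
  have a: "a \<ge> 0" "4 * b \<le> a" using b_nonneg K_nonneg by (simp_all add: a_def)
  have nn: "\<beta> \<ge> 0" "\<gamma> \<ge> 0" using a \<eta> by (simp_all add: \<beta>_def \<gamma>_def)
  have eqs: "a = \<beta> * (1 - \<eta>)" "\<beta> * a = \<gamma> * (1 - \<eta>)" using \<eta> by (simp_all add: \<beta>_def \<gamma>_def)
  have step: "W (L t z) \<le> W z" if z: "z \<in> D2" for z
  proof -
    have z1: "z \<in> D \<times> D" "skew z \<in> D \<times> D" using z by (auto simp: D2_def)
    have L1: "norm (skew (L t z)) \<le> \<eta> * norm (skew z) + 4 * b * norm z"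
      unfolding skew_L[OF z1(1) t]
      using norm_triangle_ineq[of "L t (skew z)" "commutator t z"] \<eta>(2)[of "skew z"] norm_commutator[OF t, of z]
      by linarith
    have "skew (skew (L t z)) = L t (skew (skew z)) + commutator t (skew z) + skew (commutator t z)"
      unfolding skew_L[OF z1(1) t]
      using skew_add[OF L_dom[OF t z1(2)] commutator_mem[OF t z1(1)]] skew_L[OF z1(2) t] by simp
    then have "norm (skew (skew (L t z)))
        \<le> norm (L t (skew (skew z))) + norm (commutator t (skew z)) + norm (skew (commutator t z))"
      by (simp only: norm_triangle3)
    also have "\<dots> \<le> \<eta> * norm (skew (skew z)) + 4 * b * norm (skew z) + 4 * K * q\<^sup>2 * norm (skew z)"
      by (intro add_mono \<eta>(2) norm_commutator norm_skew_commutator t z1)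
    finally have L2: "norm (skew (skew (L t z))) \<le> \<eta> * norm (skew (skew z)) + a * norm (skew z)"
      by (simp add: a_def algebra_simps)
    have "W (L t z) \<le> (\<eta> * norm (skew (skew z)) + a * norm (skew z))
        + \<beta> * (\<eta> * norm (skew z) + a * norm z) + \<gamma> * (\<eta> * norm z)"
      unfolding W_def
    proof (intro add_mono L2 mult_left_mono nn \<eta>(2))
      show "norm (skew (L t z)) \<le> \<eta> * norm (skew z) + a * norm z"
        using L1 mult_right_mono[OF a(2), of "norm z"] by simp
    qed
    also have "\<dots> = \<eta> * norm (skew (skew z)) + (a + \<beta> * \<eta>) * norm (skew z) + (\<beta> * a + \<gamma> * \<eta>) * norm z"
      by (simp add: algebra_simps)
    also have "\<dots> = \<eta> * norm (skew (skew z)) + \<beta> * norm (skew z) + \<gamma> * norm z"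
    proof -
      have "a + \<beta> * \<eta> = \<beta>" "\<beta> * a + \<gamma> * \<eta> = \<gamma>" using eqs by (simp_all add: algebra_simps)
      then show ?thesis by simp
    qed
    also have "\<dots> \<le> W z" using \<eta>(1) mult_right_mono[of \<eta> 1 "norm (skew (skew z))"] by (simp add: W_def)
    finally show ?thesis .
  qed
  have pow: "(L t ^^ n) z \<in> D2 \<and> W ((L t ^^ n) z) \<le> W z" if "z \<in> D2" for z n
  proof (induction n)
    case (Suc n)
    then show ?case using step[of "(L t ^^ n) z"] L_D2[OF t] by auto
  qed (use that in simp)
  define C where "C = 1 + \<beta> * c + \<gamma> * (c * c)"
  have W_le: "W z \<le> C * norm (skew (skew z))" if z: "z \<in> D2" for z
  proof -
    have z1: "z \<in> D \<times> D" "skew z \<in> D \<times> D" using z by (auto simp: D2_def)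
    have 1: "norm (skew z) \<le> c * norm (skew (skew z))" by (rule norm_le_skew[OF z1(2)])
    have 2: "norm z \<le> c * (c * norm (skew (skew z)))"
      using norm_le_skew[OF z1(1)] mult_left_mono[OF 1, of c] c_pos by linarith
    show ?thesis unfolding W_def C_def
      using mult_left_mono[OF 1 nn(1)] mult_left_mono[OF 2 nn(2)] by (simp add: algebra_simps)
  qed
  have "norm (skew (skew z)) \<le> W z" for z using nn by (simp add: W_def)
  then have "(L t ^^ n) z \<in> D2 \<and> norm (skew (skew ((L t ^^ n) z))) \<le> C * norm (skew (skew z))"
    if "z \<in> D2" for z n using pow[OF that, of n] W_le[OF that] by (meson order_trans)
  moreover have "C > 0" using nn c_pos by (simp add: C_def add_pos_nonneg)
  ultimately show ?thesis by blast
qed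

text \<open>The damping removes energy at relative rate at most \<open>2 * b\<close>, so
  \<open>exp (2 * b * s)\<close> times the squared norm is nondecreasing.\<close>

lemma norm_lower_bound:
  assumes T: "contraction_semigroup T (D \<times> D) G" and G: "\<And>z. z \<in> D \<times> D \<Longrightarrow> inner (G z) z = - inner (B (snd z)) (snd z)"
    and z: "z \<in> D \<times> D" and t: "t \<ge> 0"
  shows "exp (- (2 * b * t)) * (norm z)\<^sup>2 \<le> (norm (T t z))\<^sup>2"
proof -
  interpret T: contraction_semigroup T "D \<times> D" G by (rule T)
  define f where "f s = - (exp (2 * b * s) * (norm (T s z))\<^sup>2)" for s
  have "f t \<le> f 0"
  proof (rule deriv_nonpos_decreasing[OF _ _ t])
    fix s assume s: "s \<in> {0..t}"
    have d: "((\<lambda>s. T s z) has_vector_derivative G (T s z)) (at s within {0..t})"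
      by (rule T.has_derivative_T_comp[OF z s])
    show "(f has_real_derivative - (exp (2 * b * s) * (2 * b) * (norm (T s z))\<^sup>2
        + exp (2 * b * s) * (2 * inner (T s z) (G (T s z))))) (at s within {0..t})"
      unfolding f_def
      by (rule derivative_eq_intros has_real_derivative_norm_square[OF d] refl)+
        (simp add: algebra_simps)
    have "T s z \<in> D \<times> D" using s z by (intro T.dom) auto
    from G[OF this] have "inner (T s z) (G (T s z)) \<ge> - (b * (norm (T s z))\<^sup>2)"
      using inner_B_le[of "snd (T s z)"] b_nonneg
        mult_left_mono[OF power_mono[OF norm_fst_snd_le(2)[of "T s z"], of 2], of b]
      by (simp add: inner_commute)
    then have "0 \<le> exp (2 * b * s) * (2 * (b * (norm (T s z))\<^sup>2 + inner (T s z) (G (T s z))))" by simp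
    then show "- (exp (2 * b * s) * (2 * b) * (norm (T s z))\<^sup>2
        + exp (2 * b * s) * (2 * inner (T s z) (G (T s z)))) \<le> 0"
      by (simp add: algebra_simps)
  qed
  then have "(norm z)\<^sup>2 \<le> exp (2 * b * t) * (norm (T t z))\<^sup>2" by (simp add: f_def)
  then show ?thesis by (simp add: exp_minus field_simps)
qed

lemma inner_Gp: "z \<in> D \<times> D \<Longrightarrow> inner (Gp z) z = - inner (B (snd z)) (snd z)"
  by (simp add: Gp_def inner_diff_left skew_inner)

lemma inner_Gm: "z \<in> D \<times> D \<Longrightarrow> inner (Gm z) z = - inner (B (snd z)) (snd z)"
  by (simp add: Gm_def inner_diff_left skew_inner)

text \<open>Settles the degenerate case \<open>\<eta> = 0\<close>, in which nothing can be absorbed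
  by powers of \<open>\<eta>\<close>: it occurs only for zero data.\<close>

lemma L_nonzero: assumes "z \<in> D \<times> D" "t \<ge> 0" "z \<noteq> 0" shows "L t z \<noteq> 0"
proof -
  have pos: "T t w \<noteq> 0" if "contraction_semigroup T (D \<times> D) G" "w \<in> D \<times> D" "w \<noteq> 0"
    "\<And>z. z \<in> D \<times> D \<Longrightarrow> inner (G z) z = - inner (B (snd z)) (snd z)" for T G w
    using norm_lower_bound[OF that(1,4,2) assms(2)] that(3) by (auto simp: mult_le_0_iff)
  have "P t z \<noteq> 0" by (rule pos[OF contraction_P assms(1,3) inner_Gp])
  then show ?thesis unfolding L_def
    by (rule pos[OF contraction_N P.dom[OF assms(2,1)] _ inner_Gm])
qed

end

section \<open>The undamped semigroup and the regularity of orbits\<close>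

context positive_root begin

text \<open>The undamped semigroup, constructed by the Euler scheme. Its orbits are the classical
  solutions to which observability applies, and the given solution \<open>w\<close> is one of
  them.\<close>

definition U :: "real \<Rightarrow> 'h \<times> 'h \<Rightarrow> 'h \<times> 'h" where "U = m_dissipative.S (D \<times> D) skew"

lemma contraction_U: "contraction_semigroup U (D \<times> D) skew"
  unfolding U_def by (rule m_dissipative.contraction_semigroup_S[OF m_dissipative_skew])

lemma undamped_unique:
  assumes y: "\<And>t. t \<in> {0..\<tau>} \<Longrightarrow> y t \<in> D \<times> D"
    "\<And>t. t \<in> {0..\<tau>} \<Longrightarrow> (y has_vector_derivative skew (y t)) (at t within {0..\<tau>})"
    and t: "t \<in> {0..\<tau>}"
  shows "y t = U t (y 0)"
proof -
  interpret U: contraction_semigroup U "D \<times> D" skew by (rule contraction_U)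
  have y0: "y 0 \<in> D \<times> D" using y t by auto
  have "(norm (y t - U t (y 0)))\<^sup>2 \<le> (norm (y 0 - U 0 (y 0)))\<^sup>2"
  proof (rule deriv_nonpos_decreasing[where f="\<lambda>s. (norm (y s - U s (y 0)))\<^sup>2"
        and f'="\<lambda>s. 2 * inner (y s - U s (y 0)) (skew (y s) - skew (U s (y 0)))"])
    fix s assume s: "s \<in> {0..t}"
    then have s': "s \<in> {0..\<tau>}" using t by auto
    have "((\<lambda>s. y s - U s (y 0)) has_vector_derivative skew (y s) - skew (U s (y 0))) (at s within {0..\<tau>})"
      by (intro has_vector_derivative_diff y(2) s' U.has_derivative_T_comp y0)
    then have "((\<lambda>s. y s - U s (y 0)) has_vector_derivative skew (y s) - skew (U s (y 0))) (at s within {0..t})"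
      by (rule has_vector_derivative_within_subset) (use t in auto)
    from has_real_derivative_norm_square[OF this]
    show "((\<lambda>s. (norm (y s - U s (y 0)))\<^sup>2) has_real_derivative
        2 * inner (y s - U s (y 0)) (skew (y s) - skew (U s (y 0)))) (at s within {0..t})" .
    have "y s \<in> D \<times> D" "U s (y 0) \<in> D \<times> D" using y(1) s' y0 by (auto intro!: U.dom simp del: mem_Times_iff)
    then have "inner (y s - U s (y 0)) (skew (y s) - skew (U s (y 0))) = 0"
      using skew_inner[of "y s - U s (y 0)"] subspace_diff[OF subspace_DD]
      by (simp add: skew_diff inner_commute)
    then show "2 * inner (y s - U s (y 0)) (skew (y s) - skew (U s (y 0))) \<le> 0" by simp
  qed (use t in auto)
  then show ?thesis by simp
qed

text \<open>Derivatives are taken in the norm of \<open>D(A\<^sub>0\<^sup>1\<^sup>/\<^sup>2)\<close>, not in that of \<open>H\<close>.\<close>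

definition smooth_path :: "real \<Rightarrow> (real \<Rightarrow> 'h) \<Rightarrow> (real \<Rightarrow> 'h) \<Rightarrow> (real \<Rightarrow> 'h) \<Rightarrow> bool" where
  "smooth_path \<tau> p q r \<longleftrightarrow>
     (\<forall>t\<in>{0..\<tau>}. p t \<in> D \<and> q t \<in> D \<and> r t \<in> D \<and>
        ((\<lambda>s. R (p s)) has_vector_derivative R (q t)) (at t within {0..\<tau>}) \<and>
        ((\<lambda>s. R (q s)) has_vector_derivative R (r t)) (at t within {0..\<tau>})) \<and>
     continuous_on {0..\<tau>} (\<lambda>t. R (r t))"

text \<open>The sign \<open>s\<close> is 1 for \<open>P\<close> and \<open>U\<close> and -1 for
  \<open>N\<close>, where the velocity of the path is minus the second component. As
  \<open>z\<close> and \<open>G z\<close> lie in the domain, the orbit can be differentiated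
  twice.\<close>

lemma smooth_path_semigroup:
  assumes T: "contraction_semigroup T (D \<times> D) G"
    and G: "\<And>z. z \<in> D \<times> D \<Longrightarrow> fst (G z) = s *\<^sub>R R (snd z)"
    and z: "z \<in> D \<times> D" "G z \<in> D \<times> D"
  shows "smooth_path \<tau> (\<lambda>t. S (fst (T t z))) (\<lambda>t. s *\<^sub>R snd (T t z)) (\<lambda>t. s *\<^sub>R snd (G (T t z)))"
    and "t \<ge> 0 \<Longrightarrow> R (s *\<^sub>R snd (T t z)) = fst (T t (G z))"
    and "t \<ge> 0 \<Longrightarrow> R (s *\<^sub>R snd (G (T t z))) = fst (T t (G (G z)))"
proof -
  interpret T: contraction_semigroup T "D \<times> D" G by (rule T)
  have mem: "T t z \<in> D \<times> D" "G (T t z) \<in> D \<times> D" if "t \<ge> 0" for t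
    using T.dom[OF that z(1)] T.dom[OF that z(2)] T.commute[OF that z(1)] by simp_all
  have mem': "snd (T t z) \<in> D" "snd (G (T t z)) \<in> D" if "t \<ge> 0" for t
    using mem[OF that] by (auto simp: mem_Times_iff)
  have 1: "R (s *\<^sub>R snd (T t z)) = fst (T t (G z))" if "t \<ge> 0" for t
    using G[OF mem(1)[OF that]] T.commute[OF that z(1)] mem'[OF that] by (simp add: R_scale)
  have 2: "R (s *\<^sub>R snd (G (T t z))) = fst (T t (G (G z)))" if "t \<ge> 0" for t
    using G[OF mem(2)[OF that]] T.commute[OF that z(1)] T.commute[OF that z(2)] mem'[OF that]
    by (simp add: R_scale)
  show "t \<ge> 0 \<Longrightarrow> R (s *\<^sub>R snd (T t z)) = fst (T t (G z))"
    "t \<ge> 0 \<Longrightarrow> R (s *\<^sub>R snd (G (T t z))) = fst (T t (G (G z)))" using 1 2 by auto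
  show "smooth_path \<tau> (\<lambda>t. S (fst (T t z))) (\<lambda>t. s *\<^sub>R snd (T t z)) (\<lambda>t. s *\<^sub>R snd (G (T t z)))"
    unfolding smooth_path_def
  proof (intro conjI ballI)
    fix t assume t: "t \<in> {0..\<tau>}"
    then have t0: "t \<ge> 0" by simp
    show "s *\<^sub>R snd (T t z) \<in> D" "s *\<^sub>R snd (G (T t z)) \<in> D" using mem'[OF t0] by auto
    have "((\<lambda>s. fst (T s z)) has_vector_derivative fst (T t (G z))) (at t within {0..\<tau>})"
      by (intro bounded_linear.has_vector_derivative[OF bounded_linear_fst] T.has_derivative_T z) (use t in auto)
    then show "((\<lambda>s. R (S (fst (T s z)))) has_vector_derivative R (s *\<^sub>R snd (T t z))) (at t within {0..\<tau>})"
      using 1[OF t0] by simp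
    have "((\<lambda>s. fst (T s (G z))) has_vector_derivative fst (T t (G (G z)))) (at t within {0..\<tau>})"
      by (intro bounded_linear.has_vector_derivative[OF bounded_linear_fst] T.has_derivative_T z) (use t in auto)
    then show "((\<lambda>r. R (s *\<^sub>R snd (T r z))) has_vector_derivative R (s *\<^sub>R snd (G (T t z)))) (at t within {0..\<tau>})"
      unfolding 2[OF t0] by (rule has_vector_derivative_transform[OF t, rotated]) (use 1 in auto)
  next
    have "continuous_on {0..\<tau>} (\<lambda>t. fst (T t (G (G z))))" by (intro continuous_on_fst T.continuous_T)
    then show "continuous_on {0..\<tau>} (\<lambda>t. R (s *\<^sub>R snd (G (T t z))))"
      by (rule continuous_on_eq) (use 2 in auto)
  qed simp
qed

end

section \<open>Observability of the damped equation and strict contraction\<close>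

context damped_wave begin

lemma energy_identity:
  assumes z: "z \<in> D \<times> D" and \<tau>: "\<tau> \<ge> 0"
  shows "((\<lambda>s. inner (B (snd (P s z))) (snd (P s z))) has_integral
      ((norm z)\<^sup>2 - (norm (P \<tau> z))\<^sup>2) / 2) {0..\<tau>}"
proof -
  interpret T: contraction_semigroup P "D \<times> D" Gp by (rule contraction_P)
  have "((\<lambda>s. 2 * inner (P s z) (Gp (P s z))) has_integral (norm (P \<tau> z))\<^sup>2 - (norm (P 0 z))\<^sup>2) {0..\<tau>}"
  proof (rule fundamental_theorem_of_calculus[OF \<tau>])
    fix s assume s: "s \<in> {0..\<tau>}"
    show "((\<lambda>s. (norm (P s z))\<^sup>2) has_vector_derivative 2 * inner (P s z) (Gp (P s z))) (at s within {0..\<tau>})"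
      using has_real_derivative_norm_square[OF T.has_derivative_T_comp[OF z s]]
      by (simp add: has_real_derivative_iff_has_vector_derivative)
  qed
  from has_integral_mult_right[OF this, of "-1/2"]
  have "((\<lambda>s. - inner (P s z) (Gp (P s z))) has_integral ((norm z)\<^sup>2 - (norm (P \<tau> z))\<^sup>2) / 2) {0..\<tau>}"
    by (simp add: diff_divide_distrib)
  then show ?thesis
    by (rule has_integral_eq[rotated]) (use z in \<open>auto simp: inner_commute[of _ "Gp _"] inner_Gp P.dom simp del: mem_Times_iff\<close>)
qed

lemma inner_B_triangle: "inner (B (x + y)) (x + y) \<le> 2 * inner (B x) x + 2 * inner (B y) y"
  using B_pos[of "x - y"] B_sym[of x y]
  by (simp add: bounded_linear.linear[OF linear_B] linear_add linear_diff inner_add inner_diff inner_commute[of y "B x"])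

text \<open>The difference of the undamped and the damped solution is driven by \<open>B\<close> applied to the damped
  velocity, so the output of the undamped solution is controlled by that of the damped one.\<close>

lemma damped_observability:
  assumes \<tau>: "\<tau> > 0" and z: "z \<in> D \<times> D"
    and obs: "k\<^sup>2 * (norm z)\<^sup>2 \<le> integral {0..\<tau>} (\<lambda>t. inner (B (snd (U t z))) (snd (U t z)))"
  shows "k\<^sup>2 * (norm z)\<^sup>2 \<le> (1 + 4 * \<tau>\<^sup>2 * b\<^sup>2) * ((norm z)\<^sup>2 - (norm (P \<tau> z))\<^sup>2)"
proof -
  interpret U: contraction_semigroup U "D \<times> D" skew by (rule contraction_U)
  interpret T: contraction_semigroup P "D \<times> D" Gp by (rule contraction_P)
  define e where "e t = inner (B (snd (P t z))) (snd (P t z))" for t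
  define d where "d t = U t z - P t z" for t
  define \<Gamma> where "\<Gamma> = integral {0..\<tau>} e"
  have e0: "e t \<ge> 0" for t by (simp add: e_def B_pos)
  have \<Gamma>: "(e has_integral \<Gamma>) {0..\<tau>}" "\<Gamma> = ((norm z)\<^sup>2 - (norm (P \<tau> z))\<^sup>2) / 2"
    using energy_identity[OF z, of \<tau>] \<tau> unfolding \<Gamma>_def e_def[symmetric] by (auto simp: integral_unique)
  have ei: "e integrable_on {0..\<tau>}" by (rule has_integral_integrable[OF \<Gamma>(1)])
  have contd: "continuous_on {0..\<tau>} d"
    unfolding d_def by (intro continuous_intros U.continuous_T T.continuous_T)
  \<comment> \<open>Integrating the energy of the difference only up to its maximum \<open>m\<close>
    makes the bound quadratic in \<open>m\<close> on both sides.\<close>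
  have "\<exists>t0\<in>{0..\<tau>}. \<forall>t\<in>{0..\<tau>}. norm (d t) \<le> norm (d t0)"
    using \<tau> by (intro continuous_attains_sup continuous_on_norm contd) auto
  then obtain t0 where t0: "t0 \<in> {0..\<tau>}" "\<And>t. t \<in> {0..\<tau>} \<Longrightarrow> norm (d t) \<le> norm (d t0)" by blast
  define m where "m = norm (d t0)"
  have "((\<lambda>s. 2 * inner (d s) (skew (U s z) - Gp (P s z))) has_integral (norm (d t0))\<^sup>2 - (norm (d 0))\<^sup>2) {0..t0}"
  proof (rule fundamental_theorem_of_calculus)
    fix s assume s: "s \<in> {0..t0}"
    have "(d has_vector_derivative skew (U s z) - Gp (P s z)) (at s within {0..t0})"
      unfolding d_def
      by (intro has_vector_derivative_diff U.has_derivative_T_comp T.has_derivative_T_comp z s)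
    from has_real_derivative_norm_square[OF this]
    show "((\<lambda>s. (norm (d s))\<^sup>2) has_vector_derivative 2 * inner (d s) (skew (U s z) - Gp (P s z))) (at s within {0..t0})"
      by (simp add: has_real_derivative_iff_has_vector_derivative)
  qed (use t0 in simp)
  then have int: "((\<lambda>s. 2 * inner (B (snd (P s z))) (snd (d s))) has_integral m\<^sup>2) {0..t0}"
  proof (rule has_integral_eq[rotated, THEN has_integral_eq_rhs])
    fix s assume s: "s \<in> {0..t0}"
    have mem: "U s z \<in> D \<times> D" "P s z \<in> D \<times> D" using s z by (auto intro!: U.dom T.dom simp del: mem_Times_iff)
    have "skew (U s z) - Gp (P s z) = skew (d s) + damp (P s z)"
      using mem by (simp add: d_def Gp_def skew_diff)
    moreover have "inner (d s) (skew (d s)) = 0"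
      using skew_inner[of "d s"] mem DD_diff by (simp add: d_def inner_commute)
    ultimately show "2 * inner (d s) (skew (U s z) - Gp (P s z)) = 2 * inner (B (snd (P s z))) (snd (d s))"
      by (simp add: inner_add_right inner_commute[of "d s" "damp _"])
  qed (simp add: m_def d_def)
  \<comment> \<open>Young's inequality with weight \<open>2 * \<tau>\<close>: after integration over
    an interval of length at most \<open>\<tau>\<close> the last term is at most
    \<open>m\<^sup>2 / 2\<close> and can be moved to the left.\<close>
  have bnd: "2 * inner (B (snd (P s z))) (snd (d s)) \<le> 2 * \<tau> * b * e s + m\<^sup>2 / (2 * \<tau>)" if s: "s \<in> {0..t0}" for s
  proof -
    define x where "x = norm (B (snd (P s z)))"
    have "norm (snd (d s)) \<le> m" using t0(2)[of s] s t0(1) norm_fst_snd_le(2)[of "d s"] by (simp add: m_def)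
    then have "inner (B (snd (P s z))) (snd (d s)) \<le> x * m"
      using norm_cauchy_schwarz[of "B (snd (P s z))" "snd (d s)"]
        mult_left_mono[of "norm (snd (d s))" m x] by (simp add: x_def)
    moreover have "0 \<le> (2 * \<tau> * x - m)\<^sup>2 / (2 * \<tau>)" using \<tau> by simp
    moreover have "(2 * \<tau> * x - m)\<^sup>2 / (2 * \<tau>) = 2 * \<tau> * x\<^sup>2 - 2 * (x * m) + m\<^sup>2 / (2 * \<tau>)"
      using \<tau> by (simp add: power2_eq_square field_simps)
    moreover have "2 * \<tau> * x\<^sup>2 \<le> 2 * \<tau> * (b * e s)"
      using norm_B_square[of "snd (P s z)"] \<tau> by (intro mult_left_mono) (auto simp: x_def e_def)
    ultimately show ?thesis by simp
  qed
  have m: "m\<^sup>2 \<le> 4 * \<tau> * b * \<Gamma>"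
  proof -
    have sub: "e integrable_on {0..t0}" "integral {0..t0} e \<le> \<Gamma>"
    proof -
      show "e integrable_on {0..t0}" by (rule integrable_on_subinterval[OF ei]) (use t0(1) in auto)
      then show "integral {0..t0} e \<le> \<Gamma>"
        unfolding \<Gamma>_def by (rule integral_subset_le[rotated, OF _ ei]) (use t0(1) e0 in auto)
    qed
    have "((\<lambda>s. 2 * \<tau> * b * e s + m\<^sup>2 / (2 * \<tau>)) has_integral
        2 * \<tau> * b * integral {0..t0} e + measure lborel {0..t0} *\<^sub>R (m\<^sup>2 / (2 * \<tau>))) {0..t0}"
      using sub(1) has_integral_const_real[of "m\<^sup>2 / (2 * \<tau>)" 0 t0]
      by (intro has_integral_add has_integral_mult_right) auto
    from has_integral_le[OF int this bnd]
    have "m\<^sup>2 \<le> 2 * \<tau> * b * integral {0..t0} e + t0 * (m\<^sup>2 / (2 * \<tau>))" using t0(1) by simp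
    also have "\<dots> \<le> 2 * \<tau> * b * \<Gamma> + \<tau> * (m\<^sup>2 / (2 * \<tau>))"
      using sub(2) \<tau> b_nonneg t0(1) by (intro add_mono mult_left_mono mult_right_mono) auto
    also have "\<tau> * (m\<^sup>2 / (2 * \<tau>)) = m\<^sup>2 / 2" using \<tau> by simp
    finally show ?thesis by simp
  qed
  have le: "inner (B (snd (U t z))) (snd (U t z)) \<le> 2 * e t + 2 * (b * m\<^sup>2)" if t: "t \<in> {0..\<tau>}" for t
  proof -
    have "snd (U t z) = snd (P t z) + snd (d t)" by (simp add: d_def)
    then have "inner (B (snd (U t z))) (snd (U t z)) \<le> 2 * e t + 2 * inner (B (snd (d t))) (snd (d t))"
      using inner_B_triangle[of "snd (P t z)" "snd (d t)"] by (simp add: e_def)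
    moreover have "inner (B (snd (d t))) (snd (d t)) \<le> b * m\<^sup>2"
    proof -
      have "norm (snd (d t)) \<le> m" using t0(2)[OF t] norm_fst_snd_le(2)[of "d t"] by (simp add: m_def)
      then have "b * (norm (snd (d t)))\<^sup>2 \<le> b * m\<^sup>2" by (intro mult_left_mono power_mono b_nonneg) auto
      then show ?thesis using inner_B_le[of "snd (d t)"] by linarith
    qed
    ultimately show ?thesis by simp
  qed
  have "integral {0..\<tau>} (\<lambda>t. inner (B (snd (U t z))) (snd (U t z))) \<le> integral {0..\<tau>} (\<lambda>t. 2 * e t + 2 * (b * m\<^sup>2))"
  proof (rule integral_le[OF _ _ le])
    show "(\<lambda>t. inner (B (snd (U t z))) (snd (U t z))) integrable_on {0..\<tau>}"
      by (intro integrable_continuous_interval continuous_intros bounded_linear.continuous_on[OF linear_B] U.continuous_T)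
    show "(\<lambda>t. 2 * e t + 2 * (b * m\<^sup>2)) integrable_on {0..\<tau>}"
      by (intro integrable_add integrable_on_mult_right ei integrable_const_ivl)
  qed
  also have "\<dots> = 2 * \<Gamma> + \<tau> * (2 * (b * m\<^sup>2))"
    using has_integral_add[OF has_integral_mult_right[OF \<Gamma>(1), of 2] has_integral_const_real[of "2 * (b * m\<^sup>2)" 0 \<tau>]] \<tau>
    by (simp add: integral_unique)
  also have "\<dots> \<le> 2 * \<Gamma> + \<tau> * (2 * (b * (4 * \<tau> * b * \<Gamma>)))"
    using m \<tau> b_nonneg by (intro add_left_mono mult_left_mono) auto
  also have "\<dots> = (1 + 4 * \<tau>\<^sup>2 * b\<^sup>2) * (2 * \<Gamma>)" by (simp add: power2_eq_square algebra_simps)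
  finally have "k\<^sup>2 * (norm z)\<^sup>2 \<le> (1 + 4 * \<tau>\<^sup>2 * b\<^sup>2) * (2 * \<Gamma>)" using obs by linarith
  moreover have "2 * \<Gamma> = (norm z)\<^sup>2 - (norm (P \<tau> z))\<^sup>2" by (simp add: \<Gamma>(2))
  ultimately show ?thesis by (simp only:)
qed

text \<open>\<open>P\<close> alone loses a fixed fraction of the energy over the observation time,
  by observability of the damped orbit; \<open>N\<close> merely must not increase it. The bound
  holds on the domain and extends by density.\<close>

lemma L_strict_contraction:
  assumes \<tau>: "\<tau> > 0" and k: "k > 0"
    and obs: "\<And>z. z \<in> D \<times> D \<Longrightarrow>
      k\<^sup>2 * (norm z)\<^sup>2 \<le> integral {0..\<tau>} (\<lambda>t. inner (B (snd (U t z))) (snd (U t z)))"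
  shows "\<exists>\<rho>. 0 \<le> \<rho> \<and> \<rho> < 1 \<and> (\<forall>z. norm (L \<tau> z) \<le> \<rho> * norm z)"
proof -
  define a where "a = 1 + 4 * \<tau>\<^sup>2 * b\<^sup>2"
  have a: "a > 0" unfolding a_def by (intro add_pos_nonneg) auto
  \<comment> \<open>The maximum keeps \<open>\<rho>\<close> nonnegative even if
    \<open>k\<^sup>2\<close> exceeds \<open>a\<close>.\<close>
  define \<rho> where "\<rho> = sqrt (max 0 (1 - k\<^sup>2 / a))"
  have "k\<^sup>2 / a > 0" using a k by simp
  then have \<rho>: "0 \<le> \<rho>" "\<rho> < 1" by (auto simp: \<rho>_def)
  have *: "norm (P \<tau> z) \<le> \<rho> * norm z" if z: "z \<in> D \<times> D" for z
  proof -
    have "k\<^sup>2 * (norm z)\<^sup>2 \<le> a * ((norm z)\<^sup>2 - (norm (P \<tau> z))\<^sup>2)"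
      unfolding a_def by (rule damped_observability[OF \<tau> z obs[OF z]])
    then have "(norm (P \<tau> z))\<^sup>2 \<le> (1 - k\<^sup>2 / a) * (norm z)\<^sup>2" using a by (simp add: field_simps)
    also have "\<dots> \<le> max 0 (1 - k\<^sup>2 / a) * (norm z)\<^sup>2" by (intro mult_right_mono) auto
    also have "\<dots> = (\<rho> * norm z)\<^sup>2" by (simp add: \<rho>_def power_mult_distrib)
    finally show ?thesis using \<rho> by (simp add: power2_le_iff_abs_le)
  qed
  have bl: "bounded_linear (P \<tau>)"
    using P.linear_T[of \<tau>] P.contr[of \<tau>] \<tau> by (intro bounded_linear_intro[where K=1]) (auto simp: linear_add linear_cmul)
  have "closed {z. norm (P \<tau> z) \<le> \<rho> * norm z}"
    by (intro closed_Collect_le continuous_intros linear_continuous_on bl)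
  then have "closure (D \<times> D) \<subseteq> {z. norm (P \<tau> z) \<le> \<rho> * norm z}" using * by (intro closure_minimal) auto
  then have "norm (P \<tau> z) \<le> \<rho> * norm z" for z using dense_DD by auto
  then have "norm (L \<tau> z) \<le> \<rho> * norm z" for z
    unfolding L_def using N.contr[of \<tau> "P \<tau> z"] \<tau> by (meson less_imp_le order_trans)
  then show ?thesis using \<rho> by blast
qed

end

section \<open>Finite-dimensional subspaces and absolutely continuous functions\<close>

locale orthonormal =
  fixes E :: "'a::real_inner set"
  assumes finite_E: "finite E" and inner_E: "e \<in> E \<Longrightarrow> f \<in> E \<Longrightarrow> inner e f = (if e = f then 1 else 0)"
begin

definition proj :: "'a \<Rightarrow> 'a" where "proj x = (\<Sum>e\<in>E. inner x e *\<^sub>R e)"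

lemma proj_mem: "proj x \<in> span E"
  unfolding proj_def by (intro span_sum span_scale span_base)

lemma inner_proj: "e \<in> E \<Longrightarrow> inner (proj x) e = inner x e"
  by (simp add: proj_def inner_sum_left inner_E finite_E if_distrib cong: if_cong)

lemma orthogonal_proj: "y \<in> span E \<Longrightarrow> inner (x - proj x) y = 0"
proof (induction rule: span_induct_alt)
  case (step c e y)
  then show ?case using inner_proj[of e x] by (simp add: inner_add_right inner_diff_left)
qed simp

lemma proj_id: "x \<in> span E \<Longrightarrow> proj x = x"
  using orthogonal_proj[of "x - proj x" x] proj_mem[of x] by (simp add: span_diff)

lemma linear_proj: "linear proj"
  by (rule linearI) (simp_all add: proj_def inner_add_left scaleR_add_left sum.distrib scaleR_sum_right)

lemma norm_proj_le: "norm (proj x) \<le> norm x"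
proof -
  have "norm (proj x) * norm (proj x) = inner x (proj x)"
    using orthogonal_proj[OF proj_mem, of x x]
    by (simp add: inner_diff_left power2_norm_eq_inner[symmetric] power2_eq_square)
  also have "\<dots> \<le> norm x * norm (proj x)" by (rule norm_cauchy_schwarz)
  finally show ?thesis by (cases "proj x = 0") auto
qed

lemma bounded_linear_proj: "bounded_linear proj"
  by (rule bounded_linear_intro[where K=1])
    (simp_all add: linear_add[OF linear_proj] linear_cmul[OF linear_proj] norm_proj_le)

lemma inner_proj_sum: "x \<in> span E \<Longrightarrow> inner x y = (\<Sum>e\<in>E. inner x e * inner y e)"
  by (subst proj_id[symmetric], assumption) (simp add: proj_def inner_sum_left inner_commute[of y])

text \<open>A curve that starts in a finite-dimensional subspace and whose velocity lies there stays there: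
  pair it with its own component orthogonal to the subspace.\<close>

lemma invariant_span:
  assumes f: "\<And>t. t \<in> {0..\<tau>} \<Longrightarrow> (f has_vector_derivative f' t) (at t within {0..\<tau>})"
    and f': "\<And>t. t \<in> {0..\<tau>} \<Longrightarrow> f' t \<in> span E" and f0: "f 0 \<in> span E" and t: "t \<in> {0..\<tau>}"
  shows "f t \<in> span E"
proof -
  define y where "y = f t - proj (f t)"
  have y: "inner z y = 0" if "z \<in> span E" for z
    using orthogonal_proj[OF that, of "f t"] by (simp add: y_def inner_commute)
  have "((\<lambda>s. inner (f s) y) has_vector_derivative 0) (at s within {0..\<tau>})" if "s \<in> {0..\<tau>}" for s
    using bounded_linear.has_vector_derivative[OF bounded_linear_inner_left f[OF that], of y] y[OF f'[OF that]] by simp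
  then obtain k where "\<And>s. s \<in> {0..\<tau>} \<Longrightarrow> inner (f s) y = k"
    using has_vector_derivative_zero_constant[OF convex_closed_interval] by blast
  from this[of t] this[of 0] t have "inner (f t) y = inner (f 0) y" by simp
  then have "inner (f t) y = 0" using y[OF f0] by simp
  then have "inner y y = 0" using y[OF proj_mem, of "f t"] by (simp add: y_def inner_diff_left)
  then show ?thesis using proj_mem[of "f t"] by (simp add: y_def)
qed

text \<open>Pairing the curve with the component of \<open>d\<close> orthogonal to the span gives
  the zero function, whose derivative is unique. This needs \<open>\<tau> > 0\<close>: within a
  single point every vector is a derivative.\<close>

lemma derivative_in_span:
  assumes f: "(f has_vector_derivative d) (at t within {0..\<tau>})"
    and mem: "\<And>t. t \<in> {0..\<tau>} \<Longrightarrow> f t \<in> span E" and t: "t \<in> {0..\<tau>}" and \<tau>: "\<tau> > 0"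
  shows "d \<in> span E"
proof -
  define y where "y = d - proj d"
  have y: "inner z y = 0" if "z \<in> span E" for z
    using orthogonal_proj[OF that, of d] by (simp add: y_def inner_commute)
  have "((\<lambda>s. inner (f s) y) has_vector_derivative inner d y) (at t within {0..\<tau>})"
    by (rule bounded_linear.has_vector_derivative[OF bounded_linear_inner_left f])
  moreover have "((\<lambda>s. inner (f s) y) has_vector_derivative 0) (at t within {0..\<tau>})"
    by (rule has_vector_derivative_transform[OF t, of _ "\<lambda>_. 0"]) (use y mem in auto)
  ultimately have "inner d y = 0"
    using vector_derivative_unique_within_closed_interval[of 0 \<tau> t] t \<tau> by auto
  then have "inner y y = 0" using y[OF proj_mem, of d] by (simp add: y_def inner_diff_left)
  then show ?thesis using proj_mem[of d] by (simp add: y_def)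
qed

end

lemma orthonormal_basis_exists:
  assumes "finite (F :: 'a::real_inner set)"
  shows "\<exists>E. orthonormal E \<and> span E = span F"
  using assms
proof (induction F)
  case empty
  show ?case by (intro exI[of _ "{}"]) (simp add: orthonormal_def)
next
  case (insert x F)
  then obtain E where E: "orthonormal E" "span E = span F" by blast
  interpret orthonormal E by (rule E)
  define y where "y = x - proj x"
  have yE: "inner y e = 0" if "e \<in> span E" for e using orthogonal_proj[OF that, of x] by (simp add: y_def)
  have xs: "span (insert x F) = span (insert x E)"
    using E(2) by (simp add: span_insert)
  show ?case
  proof (cases "y = 0")
    case True
    then have "x \<in> span E" using proj_mem[of x] by (simp add: y_def)
    then have "span (insert x E) = span E" by (rule span_redundant)
    then show ?thesis using E xs by auto
  next
    case False
    define u where "u = (1 / norm y) *\<^sub>R y"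
    have u: "inner u u = 1" "\<And>e. e \<in> E \<Longrightarrow> inner u e = 0 \<and> inner e u = 0"
      using False yE span_base[of _ E]
      by (auto simp: u_def inner_commute power2_norm_eq_inner[symmetric] power2_eq_square)
    have "u \<notin> E" using u by fastforce
    have "orthonormal (insert u E)"
      by unfold_locales (use finite_E inner_E u \<open>u \<notin> E\<close> in auto)
    moreover have "span (insert u E) = span (insert x E)"
    proof (intro span_eq[THEN iffD2] conjI insert_subsetI)
      have pm: "proj x \<in> span (insert z E)" for z
        using proj_mem[of x] span_mono[of E "insert z E"] by blast
      have "y \<in> span (insert x E)" unfolding y_def by (intro span_diff pm) (simp add: span_base)
      then show "u \<in> span (insert x E)" by (simp add: u_def span_scale)
      have "x = norm y *\<^sub>R u + proj x" using False by (simp add: u_def y_def)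
      moreover have "norm y *\<^sub>R u + proj x \<in> span (insert u E)"
        by (intro span_add span_scale pm) (simp add: span_base)
      ultimately show "x \<in> span (insert u E)" by simp
    qed (auto intro: span_base)
    ultimately show ?thesis using xs by blast
  qed
qed

text \<open>The product rule for an absolutely continuous function, without almost everywhere
  differentiability: on an interval where \<open>g\<close> oscillates by at most \<open>\<epsilon>\<close>, the difference between
  the integral of \<open>g \<alpha>\<close> and half the increment of \<open>g\<^sup>2\<close> is at most \<open>\<epsilon>\<close> times the integral of \<open>\<bar>\<alpha>\<bar>\<close>.\<close>

lemma integral_indefinite_square:
  fixes \<alpha> g :: "real \<Rightarrow> real"
  assumes \<alpha>: "\<alpha> absolutely_integrable_on {0..\<tau>}"
    and g: "\<And>t. t \<in> {0..\<tau>} \<Longrightarrow> (\<alpha> has_integral (g t - g 0)) {0..t}" and \<tau>: "\<tau> \<ge> 0"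
  shows "(\<lambda>s. g s * \<alpha> s) absolutely_integrable_on {0..\<tau>}"
    "((\<lambda>s. 2 * (g s * \<alpha> s)) has_integral ((g \<tau>)\<^sup>2 - (g 0)\<^sup>2)) {0..\<tau>}"
proof -
  have int\<alpha>: "\<alpha> integrable_on {0..\<tau>}" "(\<lambda>s. \<bar>\<alpha> s\<bar>) integrable_on {0..\<tau>}"
    using \<alpha> by (auto simp: absolutely_integrable_on_def)
  have "continuous_on {0..\<tau>} (\<lambda>t. integral {0..t} \<alpha> + g 0)"
    by (intro continuous_intros indefinite_integral_continuous_1 int\<alpha>)
  then have cont: "continuous_on {0..\<tau>} g"
    by (rule continuous_on_eq) (use integral_unique[OF g] in simp)
  show abs: "(\<lambda>s. g s * \<alpha> s) absolutely_integrable_on {0..\<tau>}"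
  proof (rule absolutely_integrable_bounded_measurable_product_real[OF _ _ _ \<alpha>])
    show "g \<in> borel_measurable (lebesgue_on {0..\<tau>})"
      by (rule continuous_imp_measurable_on_sets_lebesgue[OF cont]) simp
    show "bounded (g ` {0..\<tau>})"
      using compact_continuous_image[OF cont] compact_imp_bounded by blast
  qed simp
  then have intg: "(\<lambda>s. g s * \<alpha> s) integrable_on {0..\<tau>}" by (simp add: absolutely_integrable_on_def)
  define I where "I t = integral {0..t} (\<lambda>s. g s * \<alpha> s) - ((g t)\<^sup>2 - (g 0)\<^sup>2) / 2" for t
  have step: "\<bar>I t - I s\<bar> \<le> \<epsilon> * (integral {0..t} (\<lambda>s. \<bar>\<alpha> s\<bar>) - integral {0..s} (\<lambda>s. \<bar>\<alpha> s\<bar>))"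
    if st: "0 \<le> s" "s \<le> t" "t \<le> \<tau>" and osc: "\<And>r r'. r \<in> {s..t} \<Longrightarrow> r' \<in> {s..t} \<Longrightarrow> \<bar>g r - g r'\<bar> \<le> \<epsilon>" for s t \<epsilon>
  proof -
    have sub: "f integrable_on {s..t} \<and> integral {s..t} f = integral {0..t} f - integral {0..s} f"
      if "f integrable_on {0..\<tau>}" for f :: "real \<Rightarrow> real"
    proof -
      have "f integrable_on {0..t}" by (rule integrable_on_subinterval[OF that]) (use st in auto)
      from Henstock_Kurzweil_Integration.integral_combine[OF st(1,2) this] integrable_on_subinterval[OF this, of s t] st
      show ?thesis by auto
    qed
    \<comment> \<open>With the mean of the end values, \<open>m * (g t - g s)\<close> is exactly
      half the increment of the square, and \<open>g\<close> stays within \<open>\<epsilon>\<close>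
      of it.\<close>
    define m where "m = (g s + g t) / 2"
    have "integral {s..t} \<alpha> = g t - g s"
      using sub[OF int\<alpha>(1)] g[of t] g[of s] st by (simp add: integral_unique)
    then have "((\<lambda>r. g r * \<alpha> r - m * \<alpha> r) has_integral
        (integral {s..t} (\<lambda>s. g s * \<alpha> s) - m * (g t - g s))) {s..t}"
      using sub[OF int\<alpha>(1)] sub[OF intg]
      by (intro has_integral_diff has_integral_mult_right) (simp_all add: has_integral_integrable_integral)
    moreover have "m * (g t - g s) = ((g t)\<^sup>2 - (g s)\<^sup>2) / 2"
      by (simp add: m_def power2_eq_square field_simps)
    then have "integral {s..t} (\<lambda>s. g s * \<alpha> s) - m * (g t - g s) = I t - I s"
      using sub[OF intg] by (simp add: I_def diff_divide_distrib)
    ultimately have I: "((\<lambda>r. (g r - m) * \<alpha> r) has_integral (I t - I s)) {s..t}"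
      by (simp add: left_diff_distrib)
    have J: "((\<lambda>r. \<epsilon> * \<bar>\<alpha> r\<bar>) has_integral \<epsilon> * integral {s..t} (\<lambda>s. \<bar>\<alpha> s\<bar>)) {s..t}"
      using sub[OF int\<alpha>(2)] by (intro has_integral_mult_right) (simp add: has_integral_integrable_integral)
    have "norm ((g r - m) * \<alpha> r) \<le> \<epsilon> * \<bar>\<alpha> r\<bar>" if "r \<in> {s..t}" for r
    proof -
      have "\<bar>g r - m\<bar> \<le> \<epsilon>" proof -
        have "\<bar>g r - g s\<bar> \<le> \<epsilon>" "\<bar>g r - g t\<bar> \<le> \<epsilon>" using osc[OF that] st(2) by auto
        moreover have "2 * (g r - m) = (g r - g s) + (g r - g t)" by (simp add: m_def field_simps)
        then have "\<bar>2 * (g r - m)\<bar> \<le> \<bar>g r - g s\<bar> + \<bar>g r - g t\<bar>" by (simp only: abs_triangle_ineq)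
        ultimately show ?thesis by (simp add: abs_mult)
      qed
      then show ?thesis by (simp add: abs_mult mult_right_mono)
    qed
    then have "norm (integral {s..t} (\<lambda>r. (g r - m) * \<alpha> r)) \<le> integral {s..t} (\<lambda>r. \<epsilon> * \<bar>\<alpha> r\<bar>)"
      by (rule integral_norm_bound_integral[OF has_integral_integrable[OF I] has_integral_integrable[OF J]])
    then have "norm (I t - I s) \<le> \<epsilon> * integral {s..t} (\<lambda>s. \<bar>\<alpha> s\<bar>)"
      by (simp only: integral_unique[OF I] integral_unique[OF J])
    then show ?thesis using sub[OF int\<alpha>(2)] by simp
  qed
  define T where "T = integral {0..\<tau>} (\<lambda>s. \<bar>\<alpha> s\<bar>)"
  have T: "T \<ge> 0" unfolding T_def by (rule integral_nonneg[OF int\<alpha>(2)]) simp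
  have small: "\<bar>I \<tau>\<bar> \<le> \<epsilon> * T" if \<epsilon>: "\<epsilon> > 0" for \<epsilon>
  proof -
    have "\<forall>e>0. \<exists>d>0. \<forall>r\<in>{0..\<tau>}. \<forall>r'\<in>{0..\<tau>}. dist r' r < d \<longrightarrow> dist (g r') (g r) < e"
      using compact_uniformly_continuous[OF cont compact_Icc] unfolding uniformly_continuous_on_def .
    then obtain \<delta> where \<delta>: "\<delta> > 0" "\<forall>r\<in>{0..\<tau>}. \<forall>r'\<in>{0..\<tau>}. dist r' r < \<delta> \<longrightarrow> dist (g r') (g r) < \<epsilon>"
      using \<epsilon> by blast
    obtain n where n: "\<tau> / \<delta> < real n" using reals_Archimedean2 by blast
    have n0: "n > 0" using n \<tau> \<delta>(1) by (intro gr0I) (simp add: divide_less_0_iff)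
    define x where "x k = \<tau> * real k / real n" for k
    have xd: "x (Suc k) - x k < \<delta>" for k
    proof -
      have "x (Suc k) - x k = \<tau> / real n" by (simp add: x_def diff_divide_distrib[symmetric] algebra_simps)
      also have "\<dots> < \<delta>" using n n0 \<delta>(1) by (simp add: field_simps)
      finally show ?thesis .
    qed
    have "\<bar>I (x k)\<bar> \<le> \<epsilon> * integral {0..x k} (\<lambda>s. \<bar>\<alpha> s\<bar>)" if "k \<le> n" for k
      using that
    proof (induction k)
      case 0
      have "x 0 = 0" by (simp add: x_def)
      then show ?case by (simp add: I_def)
    next
      case (Suc k)
      have ord: "0 \<le> x k" "x k \<le> x (Suc k)" "x (Suc k) \<le> \<tau>"
      proof -
        show "0 \<le> x k" "x k \<le> x (Suc k)"
          unfolding x_def using \<tau> by (auto intro!: divide_right_mono mult_left_mono)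
        have "\<tau> * real (Suc k) \<le> \<tau> * real n" using \<tau> Suc.prems by (intro mult_left_mono) auto
        then show "x (Suc k) \<le> \<tau>" unfolding x_def using n0 by (simp add: divide_le_eq)
      qed
      have "\<bar>I (x (Suc k)) - I (x k)\<bar>
          \<le> \<epsilon> * (integral {0..x (Suc k)} (\<lambda>s. \<bar>\<alpha> s\<bar>) - integral {0..x k} (\<lambda>s. \<bar>\<alpha> s\<bar>))"
      proof (rule step[OF ord])
        fix r r' assume r: "r \<in> {x k..x (Suc k)}" "r' \<in> {x k..x (Suc k)}"
        then have "dist r r' < \<delta>" using xd[of k] by (auto simp: dist_real_def)
        then show "\<bar>g r - g r'\<bar> \<le> \<epsilon>" using \<delta>(2) r ord by (fastforce simp: dist_real_def)
      qed
      moreover have "\<bar>I (x k)\<bar> \<le> \<epsilon> * integral {0..x k} (\<lambda>s. \<bar>\<alpha> s\<bar>)" using Suc by simp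
      ultimately show ?case by (simp add: right_diff_distrib)
    qed
    from this[of n] show ?thesis using n0 by (simp add: x_def T_def)
  qed
  have "\<bar>I \<tau>\<bar> \<le> 0"
  proof (rule field_le_epsilon)
    fix e :: real assume e: "e > 0"
    have "\<bar>I \<tau>\<bar> \<le> e / (T + 1) * T" using e T by (intro small) auto
    also have "\<dots> \<le> e" using e T by (simp add: field_simps)
    finally show "\<bar>I \<tau>\<bar> \<le> 0 + e" by simp
  qed
  then have "integral {0..\<tau>} (\<lambda>s. g s * \<alpha> s) = ((g \<tau>)\<^sup>2 - (g 0)\<^sup>2) / 2" by (simp add: I_def)
  then have "((\<lambda>s. g s * \<alpha> s) has_integral ((g \<tau>)\<^sup>2 - (g 0)\<^sup>2) / 2) {0..\<tau>}"
    using intg by (simp add: has_integral_integrable_integral)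
  from has_integral_mult_right[OF this, of 2]
  show "((\<lambda>s. 2 * (g s * \<alpha> s)) has_integral ((g \<tau>)\<^sup>2 - (g 0)\<^sup>2)) {0..\<tau>}"
    by (simp add: diff_divide_distrib)
qed

section \<open>Null sets and measurability for Bochner integrable data\<close>

lemma AE_lebesgue_on_negligible:
  assumes "AE t in lebesgue_on S. Q t" "S \<in> sets lebesgue"
  shows "\<exists>Z. negligible Z \<and> (\<forall>t\<in>S - Z. Q t)"
proof -
  have "AE t in lebesgue. t \<in> S \<longrightarrow> Q t" using assms by (simp add: AE_restrict_space_iff)
  then obtain Z where Z: "{t \<in> space lebesgue. \<not> (t \<in> S \<longrightarrow> Q t)} \<subseteq> Z"
    "emeasure lebesgue Z = 0" "Z \<in> sets lebesgue" by (rule AE_E)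
  have "negligible Z" using null_setsI[OF Z(2,3)] by (simp only: negligible_iff_null_sets)
  then show ?thesis using Z(1) by (intro exI[of _ Z]) auto
qed

lemma absolutely_integrable_iff_lebesgue_on:
  fixes f :: "real \<Rightarrow> real"
  shows "f absolutely_integrable_on {a..b} \<longleftrightarrow> integrable (lebesgue_on {a..b}) f"
  by (simp add: set_integrable_def integrable_restrict_space)

text \<open>In a type that is not second countable, sums of measurable functions need not be measurable;
  almost separable range restores this.\<close>

lemma measurable_norm_diff:
  fixes f g :: "real \<Rightarrow> 'b::real_normed_vector"
  assumes f: "f \<in> borel_measurable (lebesgue_on {0..\<tau>})" and g: "continuous_on {0..\<tau>} g"
    and S: "countable S" "AE t in lebesgue_on {0..\<tau>}. f t \<in> closure S"
  shows "(\<lambda>t. norm (g t - f t)) \<in> borel_measurable (lebesgue_on {0..\<tau>})"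
proof -
  let ?M = "lebesgue_on {0..\<tau>}"
  obtain Z where Z: "negligible Z" "\<And>t. t \<in> {0..\<tau>} - Z \<Longrightarrow> f t \<in> closure S"
    using AE_lebesgue_on_negligible[OF S(2)] by auto
  have sp: "space ?M = {0..\<tau>}" by simp
  have fm: "(\<lambda>t. norm (f t - s)) \<in> borel_measurable ?M" for s
    by (rule measurable_compose[OF f]) (intro borel_measurable_continuous_onI continuous_intros)
  have gm: "(\<lambda>t. norm (g t - s)) \<in> borel_measurable ?M" for s
    by (intro continuous_imp_measurable_on_sets_lebesgue continuous_intros g) simp
  have "{t \<in> space ?M. norm (g t - f t) < a} \<in> sets ?M" for a
  proof -
    define A where "A = {t \<in> space ?M. f t \<in> closure S}"
    \<comment> \<open>Detects the inequality through a point \<open>s\<close> near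
      \<open>f t\<close>: the triangle inequality gives one direction, density of \<open>S\<close>
      near almost every value the other, so that countably many \<open>s\<close> and rational
      \<open>r\<close> suffice.\<close>
    define W where "W s r = {t \<in> space ?M. norm (g t - s) < a - r} \<inter> {t \<in> space ?M. norm (f t - s) < r}" for s r
    have A: "A \<in> sets ?M" unfolding A_def
      using measurable_sets[OF f, of "closure S"] by (simp add: vimage_def Int_def conj_commute)
    have W: "W s r \<in> sets ?M" for s r
      unfolding W_def by (intro sets.Int borel_measurable_less fm gm borel_measurable_const)
    have UN: "(\<Union>s\<in>S. \<Union>r\<in>\<rat>. W s r) \<in> sets ?M"
      by (intro sets.countable_UN'' S(1) W countable_rat)
    \<comment> \<open>What the countable union may miss is negligible, hence Lebesgue measurable by
      completeness of the measure.\<close>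
    have "{t \<in> space ?M. norm (g t - f t) < a} - A \<subseteq> Z" using Z(2) by (auto simp: A_def)
    then have "negligible ({t \<in> space ?M. norm (g t - f t) < a} - A)" by (rule negligible_subset[OF Z(1)])
    then have N: "{t \<in> space ?M. norm (g t - f t) < a} - A \<in> sets ?M"
      by (subst sets_restrict_space_iff) (auto intro: negligible_imp_sets)
    have "\<exists>s\<in>S. \<exists>r\<in>\<rat>. t \<in> W s r" if t: "t \<in> A" "norm (g t - f t) < a" for t
    proof -
      obtain r where r: "r \<in> \<rat>" "0 < r" "r < (a - norm (g t - f t)) / 2"
        using Rats_dense_in_real[of 0 "(a - norm (g t - f t)) / 2"] t(2) by auto
      obtain s where s: "s \<in> S" "dist s (f t) < r"
        using t(1) r(2) by (auto simp: A_def closure_approachable)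
      have "norm (g t - s) \<le> norm (g t - f t) + norm (f t - s)"
        using norm_triangle_ineq[of "g t - f t" "f t - s"] by simp
      also have "\<dots> < a - r" using s(2) r(3) by (simp add: dist_norm norm_minus_commute)
      finally have "t \<in> W s r" using s(2) t(1) by (simp add: W_def A_def dist_norm norm_minus_commute)
      then show ?thesis using s r by blast
    qed
    moreover have "norm (g t - f t) < a" if "t \<in> W s r" for t s r
      using that norm_triangle_ineq4[of "g t - s" "f t - s"] by (simp add: W_def)
    moreover have "W s r \<subseteq> space ?M" for s r by (auto simp: W_def)
    ultimately have "{t \<in> space ?M. norm (g t - f t) < a}
        = A \<inter> (\<Union>s\<in>S. \<Union>r\<in>\<rat>. W s r) \<union> ({t \<in> space ?M. norm (g t - f t) < a} - A)"
      by (auto simp: A_def) 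
    then show ?thesis using sets.Un[OF sets.Int[OF A UN] N] by simp
  qed
  then show ?thesis by (subst borel_measurable_iff_less) blast
qed

section \<open>The Galerkin equation\<close>

locale galerkin = positive_root D R S c
  for D :: "'h::{real_inner, complete_space} set" and R S :: "'h \<Rightarrow> 'h" and c :: real +
  fixes B :: "'h \<Rightarrow> 'h" and V :: "'h set" and b :: real
  assumes linear_B: "bounded_linear B"
    and B_pos: "inner (B x) x \<ge> 0" and norm_B: "norm (B x) \<le> b * norm x" and b_nonneg: "b \<ge> 0"
    and finite_V: "\<exists>F. finite F \<and> span F = V" and V_D: "V \<subseteq> D"
begin

lemma subspace_V: "subspace V" using finite_V subspace_span by blast

lemma V_closed [intro]:
  "0 \<in> V" "x \<in> V \<Longrightarrow> y \<in> V \<Longrightarrow> x + y \<in> V" "x \<in> V \<Longrightarrow> y \<in> V \<Longrightarrow> x - y \<in> V"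
  "x \<in> V \<Longrightarrow> a *\<^sub>R x \<in> V" "x \<in> V \<Longrightarrow> - x \<in> V"
  using subspace_V by (simp_all add: subspace_0 subspace_add subspace_diff subspace_scale subspace_neg)

lemma V_memD [simp]: "x \<in> V \<Longrightarrow> x \<in> D" using V_D by blast

lemma R_sum:
  assumes "finite A" "\<And>x. x \<in> A \<Longrightarrow> f x \<in> D"
  shows "sum f A \<in> D \<and> R (sum f A) = (\<Sum>x\<in>A. R (f x))"
  using assms by (induction A rule: finite_induct) (auto simp: R_add D_closed)

definition EV where "EV = (SOME E. orthonormal E \<and> span E = V)"
definition ER where "ER = (SOME E. orthonormal E \<and> span E = R ` V)"

lemma EV: "orthonormal EV" "span EV = V"
proof -
  obtain F where "finite F" "span F = V" using finite_V by blast
  then have "\<exists>E. orthonormal E \<and> span E = V" using orthonormal_basis_exists by metis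
  from someI_ex[OF this] show "orthonormal EV" "span EV = V" unfolding EV_def by auto
qed

sublocale EV: orthonormal EV by (rule EV)

lemma EV_mem [simp]: "e \<in> EV \<Longrightarrow> e \<in> V" using EV(2) span_base by blast

lemma V_expand: "x \<in> V \<Longrightarrow> x = (\<Sum>e\<in>EV. inner x e *\<^sub>R e)"
  using EV.proj_id[of x] by (simp add: EV(2) EV.proj_def)

text \<open>A bounded operator on all of \<open>H\<close> that agrees with the unbounded
  \<open>R\<close> on \<open>V\<close>; it allows derivatives of curves in \<open>V\<close> to pass
  through \<open>R\<close>.\<close>

definition Q where "Q x = (\<Sum>e\<in>EV. inner x e *\<^sub>R R e)"

lemma bounded_linear_Q: "bounded_linear Q"
  unfolding Q_def
  by (intro bounded_linear_sum bounded_linear_compose[OF bounded_linear_scaleR_left] bounded_linear_inner_left)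

lemma Q_eq_R: "x \<in> V \<Longrightarrow> Q x = R x"
proof -
  assume x: "x \<in> V"
  have "R (\<Sum>e\<in>EV. inner x e *\<^sub>R e) = Q x"
    using R_sum[OF EV.finite_E, of "\<lambda>e. inner x e *\<^sub>R e"] unfolding Q_def by (simp add: D_closed R_scale)
  then show ?thesis using V_expand[OF x] by simp
qed

lemma ER: "orthonormal ER" "span ER = R ` V"
proof -
  have sub: "subspace (R ` V)"
    unfolding subspace_def
  proof (intro conjI ballI allI)
    show "0 \<in> R ` V" using V_closed(1) by (intro image_eqI[of _ _ 0]) auto
    show "x + y \<in> R ` V" if "x \<in> R ` V" "y \<in> R ` V" for x y
      using that by (auto simp flip: R_add)
    show "a *\<^sub>R x \<in> R ` V" if "x \<in> R ` V" for a x
      using that by (auto simp flip: R_scale)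
  qed
  have "span (R ` EV) = R ` V"
  proof (rule span_unique[OF _ sub])
    show "R ` EV \<subseteq> R ` V" by auto
    fix T' assume T': "R ` EV \<subseteq> T'" "subspace T'"
    have "Q x \<in> T'" for x
      unfolding Q_def using T' by (intro subspace_sum subspace_scale) auto
    then show "R ` V \<subseteq> T'" using Q_eq_R by (metis image_subsetI)
  qed
  then have "\<exists>E. orthonormal E \<and> span E = R ` V"
    using orthonormal_basis_exists[of "R ` EV"] EV.finite_E by simp
  from someI_ex[OF this] show "orthonormal ER" "span ER = R ` V" unfolding ER_def by auto
qed

sublocale ER: orthonormal ER by (rule ER)

text \<open>\<open>R\<close> turns the energy inner product into that of \<open>H\<close>, so the
  energy projection is conjugate to the orthogonal projection onto the image of \<open>V\<close>. In
  this form it is a bounded operator applied to \<open>R x\<close>, hence acts on derivatives of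
  \<open>R p\<close>.\<close>

definition prj :: "'h \<Rightarrow> 'h" where "prj x = S (ER.proj (R x))"

lemma S_RV: "y \<in> R ` V \<Longrightarrow> S y \<in> V" by auto

lemma prj_mem [simp]: "prj x \<in> V" unfolding prj_def using ER.proj_mem ER(2) S_RV by blast

lemma R_prj: "R (prj x) = ER.proj (R x)" by (simp add: prj_def)

lemma prj_id: "x \<in> V \<Longrightarrow> prj x = x"
  unfolding prj_def using ER.proj_id[of "R x"] ER(2) by simp

lemma prj_orthogonal: "\<phi> \<in> V \<Longrightarrow> inner (R (prj x)) (R \<phi>) = inner (R x) (R \<phi>)"
  using ER.orthogonal_proj[of "R \<phi>" "R x"] ER(2) by (simp add: R_prj inner_diff_left)

lemma prj_diff: "x \<in> D \<Longrightarrow> y \<in> D \<Longrightarrow> prj (x - y) = prj x - prj y"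
  unfolding prj_def
  by (simp add: R_diff linear_diff[OF ER.linear_proj] linear_diff[OF bounded_linear.linear[OF bounded_linear_S]])

lemma energy_proj_eq: "x \<in> D \<Longrightarrow> energy_proj R V x = prj x"
  unfolding energy_proj_def
proof (rule the_equality)
  assume x: "x \<in> D"
  show "prj x \<in> V \<and> (\<forall>v\<in>V. inner (R (x - prj x)) (R v) = 0)"
    using x by (simp add: R_diff inner_diff_left prj_orthogonal)
  fix u assume u: "u \<in> V \<and> (\<forall>v\<in>V. inner (R (x - u)) (R v) = 0)"
  have d: "prj x - u \<in> V" using u by auto
  have "inner (R (x - u)) (R (prj x - u)) = 0" using u d by blast
  then have "inner (R x) (R (prj x - u)) = inner (R u) (R (prj x - u))"
    using x u by (simp add: R_diff inner_diff_left)
  then have "inner (R (prj x - u)) (R (prj x - u)) = 0"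
    using prj_orthogonal[OF d, of x] u by (simp add: R_diff inner_diff_left)
  then have "R (prj x - u) = 0" by simp
  then have "S (R (prj x - u)) = S 0" by simp
  then show "u = prj x" using d linear_0[OF bounded_linear.linear[OF bounded_linear_S]] by simp
qed

text \<open>Aubin-Nitsche duality.\<close>

lemma norm_R_prj_diff:
  assumes approx: "\<And>\<phi>. \<phi> \<in> D \<Longrightarrow> norm (prj \<phi> - \<phi>) \<le> \<epsilon> * norm (R \<phi>)"
    and x: "x \<in> D" "R x \<in> D"
  shows "norm (R (x - prj x)) \<le> \<epsilon> * norm (R (R x))"
proof -
  define y where "y = x - prj x"
  have y: "y \<in> D" using x by (auto simp: y_def)
  have "prj y = 0" using x by (simp add: y_def prj_diff prj_id)
  then have ny: "norm y \<le> \<epsilon> * norm (R y)" using approx[OF y] by simp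
  have "inner (R y) (R (prj x)) = 0"
    using prj_orthogonal[of "prj x" x] x by (simp add: y_def R_diff inner_diff_left)
  moreover have "R y = R x - R (prj x)" using x by (simp add: y_def R_diff)
  ultimately have "inner (R y) (R y) = inner (R y) (R x)"
    by (metis diff_zero inner_diff_right)
  then have "norm (R y) * norm (R y) = inner (R y) (R x)"
    by (simp add: power2_norm_eq_inner[symmetric] power2_eq_square)
  also have "\<dots> = inner y (R (R x))" using R_sym[OF y x(2)] .
  also have "\<dots> \<le> norm y * norm (R (R x))" by (rule norm_cauchy_schwarz)
  also have "\<dots> \<le> \<epsilon> * norm (R y) * norm (R (R x))" by (intro mult_right_mono ny) simp
  finally have "norm (R y) * norm (R y) \<le> norm (R y) * (\<epsilon> * norm (R (R x)))" by (simp add: mult_ac)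
  moreover have "0 \<le> \<epsilon> * norm (R (R x))"
    using approx[OF x(2)] norm_ge_zero order_trans by blast
  ultimately show ?thesis by (cases "R y = 0") (auto simp: y_def[symmetric])
qed

definition energy :: "'h \<Rightarrow> 'h \<Rightarrow> real" where "energy x y = norm (R x, y)"

lemma energy_nonneg [simp]: "energy x y \<ge> 0" by (simp add: energy_def)

lemma energy_square: "(energy x y)\<^sup>2 = (norm (R x))\<^sup>2 + (norm y)\<^sup>2"
  by (simp add: energy_def norm_Pair)

text \<open>The acceleration \<open>a\<close> enters only through its pairings with \<open>V\<close>, so that all integrals are
  scalar.\<close>

definition weak_sol :: "real \<Rightarrow> real \<Rightarrow> (real \<Rightarrow> 'h) \<Rightarrow> (real \<Rightarrow> 'h) \<Rightarrow> (real \<Rightarrow> 'h) \<Rightarrow> bool" where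
  "weak_sol \<tau> \<beta> f w v \<longleftrightarrow>
     (\<forall>t\<in>{0..\<tau>}. w t \<in> V \<and> v t \<in> V \<and> (w has_vector_derivative v t) (at t within {0..\<tau>})) \<and>
     (\<exists>a. (\<forall>\<phi>\<in>V. (\<lambda>t. inner (a t) \<phi>) absolutely_integrable_on {0..\<tau>} \<and>
           (\<forall>t\<in>{0..\<tau>}. ((\<lambda>s. inner (a s) \<phi>) has_integral inner (v t - v 0) \<phi>) {0..t})) \<and>
        (\<exists>Z. negligible Z \<and> (\<forall>t\<in>{0..\<tau>} - Z. \<forall>\<phi>\<in>V.
           inner (a t) \<phi> + inner (R (w t)) (R \<phi>) + \<beta> * inner (B (v t)) \<phi> = inner (f t) \<phi>)))"

lemma weak_sol_linear:
  assumes 1: "weak_sol \<tau> \<beta> f w v" and 2: "weak_sol \<tau> \<beta> f' w' v'"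
  shows "weak_sol \<tau> \<beta> (\<lambda>t. f t + k *\<^sub>R f' t) (\<lambda>t. w t + k *\<^sub>R w' t) (\<lambda>t. v t + k *\<^sub>R v' t)"
proof -
  obtain a Z where a: "\<forall>\<phi>\<in>V. (\<lambda>t. inner (a t) \<phi>) absolutely_integrable_on {0..\<tau>} \<and>
           (\<forall>t\<in>{0..\<tau>}. ((\<lambda>s. inner (a s) \<phi>) has_integral inner (v t - v 0) \<phi>) {0..t})"
    and Z: "negligible Z" "\<forall>t\<in>{0..\<tau>} - Z. \<forall>\<phi>\<in>V.
           inner (a t) \<phi> + inner (R (w t)) (R \<phi>) + \<beta> * inner (B (v t)) \<phi> = inner (f t) \<phi>"
    using 1 unfolding weak_sol_def by blast
  obtain a' Z' where a': "\<forall>\<phi>\<in>V. (\<lambda>t. inner (a' t) \<phi>) absolutely_integrable_on {0..\<tau>} \<and>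
           (\<forall>t\<in>{0..\<tau>}. ((\<lambda>s. inner (a' s) \<phi>) has_integral inner (v' t - v' 0) \<phi>) {0..t})"
    and Z': "negligible Z'" "\<forall>t\<in>{0..\<tau>} - Z'. \<forall>\<phi>\<in>V.
           inner (a' t) \<phi> + inner (R (w' t)) (R \<phi>) + \<beta> * inner (B (v' t)) \<phi> = inner (f' t) \<phi>"
    using 2 unfolding weak_sol_def by blast
  have w: "w t \<in> V" "v t \<in> V" "(w has_vector_derivative v t) (at t within {0..\<tau>})"
    and w': "w' t \<in> V" "v' t \<in> V" "(w' has_vector_derivative v' t) (at t within {0..\<tau>})" if "t \<in> {0..\<tau>}" for t
    using 1 2 that unfolding weak_sol_def by blast+
  show ?thesis
    unfolding weak_sol_def
  proof (intro conjI ballI exI[of _ "\<lambda>t. a t + k *\<^sub>R a' t"] exI[of _ "Z \<union> Z'"])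
    fix t assume t: "t \<in> {0..\<tau>}"
    show "w t + k *\<^sub>R w' t \<in> V" "v t + k *\<^sub>R v' t \<in> V" using w[OF t] w'[OF t] by auto
    show "((\<lambda>t. w t + k *\<^sub>R w' t) has_vector_derivative v t + k *\<^sub>R v' t) (at t within {0..\<tau>})"
      using w[OF t] w'[OF t]
      by (intro has_vector_derivative_add bounded_linear.has_vector_derivative[OF bounded_linear_scaleR_right])
  next
    fix \<phi> assume \<phi>: "\<phi> \<in> V"
    show "(\<lambda>t. inner (a t + k *\<^sub>R a' t) \<phi>) absolutely_integrable_on {0..\<tau>}"
      using a a' \<phi> by (auto simp: inner_add_left intro!: set_integral_add set_integrable_mult_right)
    fix t assume t: "t \<in> {0..\<tau>}"
    show "((\<lambda>s. inner (a s + k *\<^sub>R a' s) \<phi>) has_integral inner (v t + k *\<^sub>R v' t - (v 0 + k *\<^sub>R v' 0)) \<phi>) {0..t}"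
    proof (rule has_integral_eq_rhs)
      show "((\<lambda>s. inner (a s + k *\<^sub>R a' s) \<phi>) has_integral
          (inner (v t - v 0) \<phi> + k * inner (v' t - v' 0) \<phi>)) {0..t}"
        unfolding inner_add_left inner_scaleR_left
        using a a' \<phi> t by (intro has_integral_add has_integral_mult_right) auto
    qed (simp add: inner_add_left inner_diff_left algebra_simps)
  next
    fix t \<phi> assume t: "t \<in> {0..\<tau>} - (Z \<union> Z')" and \<phi>: "\<phi> \<in> V"
    then have t': "t \<in> {0..\<tau>}" by simp
    have "B (v t + k *\<^sub>R v' t) = B (v t) + k *\<^sub>R B (v' t)"
      using bounded_linear.linear[OF linear_B] by (simp add: linear_add linear_cmul)
    moreover have "R (w t + k *\<^sub>R w' t) = R (w t) + k *\<^sub>R R (w' t)"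
      using w[OF t'] w'[OF t'] by (simp add: R_add R_scale D_closed)
    moreover have "inner (a t) \<phi> + inner (R (w t)) (R \<phi>) + \<beta> * inner (B (v t)) \<phi> = inner (f t) \<phi>"
      "inner (a' t) \<phi> + inner (R (w' t)) (R \<phi>) + \<beta> * inner (B (v' t)) \<phi> = inner (f' t) \<phi>"
      using Z(2) Z'(2) t \<phi> by auto
    ultimately show "inner (a t + k *\<^sub>R a' t) \<phi> + inner (R (w t + k *\<^sub>R w' t)) (R \<phi>)
        + \<beta> * inner (B (v t + k *\<^sub>R v' t)) \<phi> = inner (f t + k *\<^sub>R f' t) \<phi>"
      by (simp add: inner_add_left flip: \<open>inner (a t) \<phi> + _ + _ = _\<close> \<open>inner (a' t) \<phi> + _ + _ = _\<close>)
        (simp add: algebra_simps)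
  qed (use Z Z' in auto)
qed

lemma weak_sol_smooth:
  assumes w: "\<And>t. t \<in> {0..\<tau>} \<Longrightarrow> w t \<in> V \<and> v t \<in> V"
    and w': "\<And>t. t \<in> {0..\<tau>} \<Longrightarrow> (w has_vector_derivative v t) (at t within {0..\<tau>})"
    and v': "\<And>t. t \<in> {0..\<tau>} \<Longrightarrow> (v has_vector_derivative a t) (at t within {0..\<tau>})"
    and a: "\<And>\<phi>. \<phi> \<in> V \<Longrightarrow> continuous_on {0..\<tau>} (\<lambda>t. inner (a t) \<phi>)"
    and eq: "\<And>t \<phi>. t \<in> {0..\<tau>} \<Longrightarrow> \<phi> \<in> V \<Longrightarrow>
      inner (a t) \<phi> + inner (R (w t)) (R \<phi>) + \<beta> * inner (B (v t)) \<phi> = inner (f t) \<phi>"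
  shows "weak_sol \<tau> \<beta> f w v"
  unfolding weak_sol_def
proof (intro conjI ballI exI[of _ a] exI[of _ "{}"])
  fix \<phi> assume \<phi>: "\<phi> \<in> V"
  show "(\<lambda>t. inner (a t) \<phi>) absolutely_integrable_on {0..\<tau>}"
    by (rule absolutely_integrable_continuous_real[OF a[OF \<phi>]])
  fix t assume t: "t \<in> {0..\<tau>}"
  have "((\<lambda>s. inner (a s) \<phi>) has_integral inner (v t) \<phi> - inner (v 0) \<phi>) {0..t}"
  proof (rule fundamental_theorem_of_calculus)
    fix s assume s: "s \<in> {0..t}"
    have "(v has_vector_derivative a s) (at s within {0..t})"
      by (rule has_vector_derivative_within_subset[OF v']) (use s t in auto)
    then show "((\<lambda>s. inner (v s) \<phi>) has_vector_derivative inner (a s) \<phi>) (at s within {0..t})"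
      by (rule bounded_linear.has_vector_derivative[OF bounded_linear_inner_left])
  qed (use t in simp)
  then show "((\<lambda>s. inner (a s) \<phi>) has_integral inner (v t - v 0) \<phi>) {0..t}" by (simp add: inner_diff_left)
qed (use w w' eq in auto)

text \<open>Only the pairings of the acceleration with \<open>V\<close> are integrable functions at
  hand. So the kinetic energy is split into squared coordinates in \<open>EV\<close>, each treated
  by the scalar product rule; the elastic part is differentiable through \<open>Q\<close>.\<close>

lemma weak_sol_energy:
  assumes sol: "weak_sol \<tau> \<beta> f w v"
  shows "\<exists>a Z. negligible Z \<and>
    (\<forall>t\<in>{0..\<tau>}. ((\<lambda>s. 2 * inner (a s) (v s) + 2 * inner (R (w s)) (R (v s))) has_integral
        ((energy (w t) (v t))\<^sup>2 - (energy (w 0) (v 0))\<^sup>2)) {0..t}) \<and>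
    (\<forall>t\<in>{0..\<tau>} - Z. inner (a t) (v t) + inner (R (w t)) (R (v t)) + \<beta> * inner (B (v t)) (v t) = inner (f t) (v t))"
proof -
  obtain a Z where a: "\<forall>\<phi>\<in>V. (\<lambda>t. inner (a t) \<phi>) absolutely_integrable_on {0..\<tau>} \<and>
           (\<forall>t\<in>{0..\<tau>}. ((\<lambda>s. inner (a s) \<phi>) has_integral inner (v t - v 0) \<phi>) {0..t})"
    and Z: "negligible Z" "\<forall>t\<in>{0..\<tau>} - Z. \<forall>\<phi>\<in>V.
           inner (a t) \<phi> + inner (R (w t)) (R \<phi>) + \<beta> * inner (B (v t)) \<phi> = inner (f t) \<phi>"
    using sol unfolding weak_sol_def by blast
  have w: "w t \<in> V" "v t \<in> V" "(w has_vector_derivative v t) (at t within {0..\<tau>})" if "t \<in> {0..\<tau>}" for t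
    using sol that unfolding weak_sol_def by blast+
  have "((\<lambda>s. 2 * inner (a s) (v s) + 2 * inner (R (w s)) (R (v s))) has_integral
        ((energy (w t) (v t))\<^sup>2 - (energy (w 0) (v 0))\<^sup>2)) {0..t}" if t: "t \<in> {0..\<tau>}" for t
  proof -
    have sub: "s \<in> {0..\<tau>}" if "s \<in> {0..t}" for s using that t by auto
    have 1: "((\<lambda>s. 2 * (inner (v s) e * inner (a s) e)) has_integral (inner (v t) e)\<^sup>2 - (inner (v 0) e)\<^sup>2) {0..t}"
      if e: "e \<in> EV" for e
    proof (rule integral_indefinite_square(2))
      have "(\<lambda>t. inner (a t) e) absolutely_integrable_on {0..\<tau>}" using a e by simp
      then show "(\<lambda>t. inner (a t) e) absolutely_integrable_on {0..t}"
        by (rule set_integrable_subset) (use t in auto)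
      show "((\<lambda>s. inner (a s) e) has_integral inner (v r) e - inner (v 0) e) {0..r}" if "r \<in> {0..t}" for r
        using a e sub[OF that] by (simp add: inner_diff_left)
    qed (use t in simp)
    have norm_v: "(norm (v s))\<^sup>2 = (\<Sum>e\<in>EV. (inner (v s) e)\<^sup>2)" if "s \<in> {0..\<tau>}" for s
      using EV.inner_proj_sum[of "v s" "v s"] w(2)[OF that] EV(2)
      unfolding power2_norm_eq_inner by (simp add: power2_eq_square)
    have av: "(\<Sum>e\<in>EV. 2 * (inner (v s) e * inner (a s) e)) = 2 * inner (a s) (v s)" if "s \<in> {0..\<tau>}" for s
      using EV.inner_proj_sum[of "v s" "a s"] w(2)[OF that] EV(2)
      by (simp add: sum_distrib_left inner_commute[of "a s" "v s"])
    have "((\<lambda>s. \<Sum>e\<in>EV. 2 * (inner (v s) e * inner (a s) e)) has_integral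
        (\<Sum>e\<in>EV. (inner (v t) e)\<^sup>2 - (inner (v 0) e)\<^sup>2)) {0..t}"
      by (rule has_integral_sum[OF EV.finite_E 1])
    then have "((\<lambda>s. 2 * inner (a s) (v s)) has_integral
        (\<Sum>e\<in>EV. (inner (v t) e)\<^sup>2 - (inner (v 0) e)\<^sup>2)) {0..t}"
      by (rule has_integral_eq[rotated]) (use av sub in auto)
    then have I1: "((\<lambda>s. 2 * inner (a s) (v s)) has_integral ((norm (v t))\<^sup>2 - (norm (v 0))\<^sup>2)) {0..t}"
      using norm_v[OF t] norm_v[of 0] t by (simp add: sum_subtractf)
    have I2: "((\<lambda>s. 2 * inner (R (w s)) (R (v s))) has_integral ((norm (R (w t)))\<^sup>2 - (norm (R (w 0)))\<^sup>2)) {0..t}"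
    proof (rule fundamental_theorem_of_calculus)
      fix s assume s: "s \<in> {0..t}"
      have "((\<lambda>s. Q (w s)) has_vector_derivative Q (v s)) (at s within {0..\<tau>})"
        by (rule bounded_linear.has_vector_derivative[OF bounded_linear_Q w(3)[OF sub[OF s]]])
      then have "((\<lambda>s. Q (w s)) has_vector_derivative R (v s)) (at s within {0..t})"
        using Q_eq_R[OF w(2)[OF sub[OF s]]] t by (auto intro: has_vector_derivative_within_subset)
      then have "((\<lambda>s. R (w s)) has_vector_derivative R (v s)) (at s within {0..t})"
        by (rule has_vector_derivative_transform[OF s, rotated]) (use Q_eq_R w sub in auto)
      from has_real_derivative_norm_square[OF this]
      show "((\<lambda>s. (norm (R (w s)))\<^sup>2) has_vector_derivative 2 * inner (R (w s)) (R (v s))) (at s within {0..t})"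
        by (simp add: has_real_derivative_iff_has_vector_derivative)
    qed (use t in simp)
    show ?thesis using has_integral_add[OF I1 I2] by (simp add: energy_square algebra_simps)
  qed
  then show ?thesis using Z w by (intro exI[of _ a] exI[of _ Z]) auto
qed

text \<open>With \<open>m\<close> the maximum of the energy on \<open>[0,\<tau>]\<close>, the energy identity gives
  \<open>m\<^sup>2 \<le> m e\<^sub>0 + 2 m \<integral>F\<close>. This replaces Gronwall's lemma.\<close>

lemma energy_estimate:
  assumes sol: "weak_sol \<tau> \<beta> f w v" and \<tau>: "\<tau> \<ge> 0"
    and F: "F integrable_on {0..\<tau>}" "\<And>t. t \<in> {0..\<tau>} \<Longrightarrow> norm (f t) \<le> F t"
  shows "\<beta> \<ge> 0 \<Longrightarrow> energy (w \<tau>) (v \<tau>) \<le> energy (w 0) (v 0) + 2 * integral {0..\<tau>} F"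
    and "\<beta> \<le> 0 \<Longrightarrow> energy (w 0) (v 0) \<le> energy (w \<tau>) (v \<tau>) + 2 * integral {0..\<tau>} F"
proof -
  obtain a Z where Z: "negligible Z"
    and I: "\<And>t. t \<in> {0..\<tau>} \<Longrightarrow> ((\<lambda>s. 2 * inner (a s) (v s) + 2 * inner (R (w s)) (R (v s))) has_integral
        ((energy (w t) (v t))\<^sup>2 - (energy (w 0) (v 0))\<^sup>2)) {0..t}"
    and eq: "\<And>t. t \<in> {0..\<tau>} - Z \<Longrightarrow>
      inner (a t) (v t) + inner (R (w t)) (R (v t)) + \<beta> * inner (B (v t)) (v t) = inner (f t) (v t)"
    using weak_sol_energy[OF sol] by blast
  define e where "e t = energy (w t) (v t)" for t
  define h where "h s = 2 * inner (a s) (v s) + 2 * inner (R (w s)) (R (v s))" for s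
  have e0: "e t \<ge> 0" for t by (simp add: e_def)
  have Ih: "(h has_integral ((e t)\<^sup>2 - (e 0)\<^sup>2)) {0..t}" if "t \<in> {0..\<tau>}" for t
    using I[OF that] unfolding h_def e_def .
  have hint: "h integrable_on {0..\<tau>}" using Ih[of \<tau>] \<tau> by (auto intro: has_integral_integrable)
  have "continuous_on {0..\<tau>} (\<lambda>t. sqrt (integral {0..t} h + (e 0)\<^sup>2))"
    by (intro continuous_intros indefinite_integral_continuous_1 hint)
  then have "continuous_on {0..\<tau>} e"
    by (rule continuous_on_eq) (use integral_unique[OF Ih] e0 in auto)
  then have "\<exists>t0\<in>{0..\<tau>}. \<forall>t\<in>{0..\<tau>}. e t \<le> e t0"
    using \<tau> by (intro continuous_attains_sup) auto
  then obtain t0 where t0: "t0 \<in> {0..\<tau>}" "\<And>t. t \<in> {0..\<tau>} \<Longrightarrow> e t \<le> e t0" by blast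
  define m where "m = e t0"
  define \<Phi> where "\<Phi> = integral {0..\<tau>} F"
  have F0: "F t \<ge> 0" if "t \<in> {0..\<tau>}" for t using F(2)[OF that] by (meson norm_ge_zero order_trans)
  have fv: "\<bar>inner (f t) (v t)\<bar> \<le> m * F t" if t: "t \<in> {0..\<tau>}" for t
  proof -
    have "(norm (v t))\<^sup>2 \<le> (e t)\<^sup>2" by (simp add: e_def energy_square)
    then have "norm (v t) \<le> m" using t0(2)[OF t] e0[of t] by (simp add: m_def power2_le_iff_abs_le)
    have "\<bar>inner (f t) (v t)\<bar> \<le> norm (f t) * norm (v t)" by (rule Cauchy_Schwarz_ineq2)
    also have "\<dots> \<le> F t * m" using F(2)[OF t] F0[OF t] \<open>norm (v t) \<le> m\<close> by (intro mult_mono) auto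
    finally show ?thesis by (simp add: mult.commute)
  qed
  have part: "F integrable_on {s..t} \<and> integral {s..t} F \<le> \<Phi>" if st: "0 \<le> s" "t \<le> \<tau>" for s t
  proof -
    have i: "F integrable_on {s..t}" by (rule integrable_on_subinterval[OF F(1)]) (use st in auto)
    then show ?thesis unfolding \<Phi>_def using F0 st by (intro conjI integral_subset_le F(1)) auto
  qed
  have m0: "m \<ge> 0" by (simp add: m_def e0)
  have cancel: "m \<le> x + 2 * \<Phi>" if "m\<^sup>2 \<le> x\<^sup>2 + 2 * (m * \<Phi>)" "x \<le> m" "x \<ge> 0" for x
  proof -
    have "x\<^sup>2 \<le> m * x" using that by (simp add: power2_eq_square mult_right_mono)
    then have "m * m \<le> m * (x + 2 * \<Phi>)" using that(1) by (simp add: power2_eq_square algebra_simps)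
    moreover have "\<Phi> \<ge> 0" unfolding \<Phi>_def using F0 by (intro integral_nonneg F(1)) auto
    ultimately show ?thesis using m0 that by (cases "m = 0") auto
  qed
  show "energy (w \<tau>) (v \<tau>) \<le> energy (w 0) (v 0) + 2 * integral {0..\<tau>} F" if \<beta>: "\<beta> \<ge> 0"
  proof -
    \<comment> \<open>The equation holds off \<open>Z\<close> only. Setting the integrand to 0 there
      keeps the integral and makes the comparison hold at every point.\<close>
    have "(\<lambda>s. if s \<in> Z then 0 else h s) integrable_on {0..t0} \<and> 
        integral {0..t0} (\<lambda>s. if s \<in> Z then 0 else h s) = m\<^sup>2 - (e 0)\<^sup>2"
      using has_integral_spike[OF Z, of "{0..t0}" "\<lambda>s. if s \<in> Z then 0 else h s" h] Ih[OF t0(1)]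
      by (auto simp: m_def has_integral_integrable_integral)
    moreover have "integral {0..t0} (\<lambda>s. if s \<in> Z then 0 else h s) \<le> integral {0..t0} (\<lambda>s. 2 * m * F s)"
    proof (rule integral_le)
      show "(if s \<in> Z then 0 else h s) \<le> 2 * m * F s" if "s \<in> {0..t0}" for s
      proof (cases "s \<in> Z")
        case True
        then show ?thesis using F0[of s] m0 that t0(1) by simp
      next
        case False
        then show ?thesis
          using that t0(1) eq[of s] fv[of s] mult_nonneg_nonneg[OF \<beta> B_pos[of "v s"]]
          by (simp add: h_def mult.assoc abs_le_iff)
      qed
    qed (use calculation part[of 0 t0] t0(1) in \<open>auto intro: integrable_on_mult_right\<close>)
    ultimately have "m\<^sup>2 \<le> (e 0)\<^sup>2 + 2 * (m * integral {0..t0} F)" by (simp add: mult.assoc)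
    also have "\<dots> \<le> (e 0)\<^sup>2 + 2 * (m * \<Phi>)"
      using part[of 0 t0] t0(1) m0 by (intro add_left_mono mult_left_mono) auto
    finally have "m \<le> e 0 + 2 * \<Phi>" using t0(2)[of 0] \<tau> e0 by (intro cancel) (auto simp: m_def)
    then show ?thesis using t0(2)[of \<tau>] \<tau> by (simp add: e_def m_def \<Phi>_def)
  qed
  show "energy (w 0) (v 0) \<le> energy (w \<tau>) (v \<tau>) + 2 * integral {0..\<tau>} F" if \<beta>: "\<beta> \<le> 0"
  proof -
    \<comment> \<open>For \<open>\<beta> \<le> 0\<close> the damping term raises the energy in time,
      so the identity is integrated from the maximum at \<open>t0\<close> up to
      \<open>\<tau>\<close>, where its sign is favourable again.\<close>
    have comb: "integral {t0..\<tau>} h = (e \<tau>)\<^sup>2 - m\<^sup>2" "h integrable_on {t0..\<tau>}"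
    proof -
      show "h integrable_on {t0..\<tau>}" by (rule integrable_on_subinterval[OF hint]) (use t0 in auto)
      show "integral {t0..\<tau>} h = (e \<tau>)\<^sup>2 - m\<^sup>2"
        using Henstock_Kurzweil_Integration.integral_combine[of 0 t0 \<tau> h] t0(1) hint
          integral_unique[OF Ih[OF t0(1)]] integral_unique[OF Ih[of \<tau>]] \<tau> by (simp add: m_def)
    qed
    have "(\<lambda>s. if s \<in> Z then 0 else h s) integrable_on {t0..\<tau>} \<and> 
        integral {t0..\<tau>} (\<lambda>s. if s \<in> Z then 0 else h s) = (e \<tau>)\<^sup>2 - m\<^sup>2"
      using has_integral_spike[OF Z, of "{t0..\<tau>}" "\<lambda>s. if s \<in> Z then 0 else h s" h "(e \<tau>)\<^sup>2 - m\<^sup>2"] comb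
      by (auto simp: has_integral_integrable_integral)
    moreover have "integral {t0..\<tau>} (\<lambda>s. - (2 * m * F s)) \<le> integral {t0..\<tau>} (\<lambda>s. if s \<in> Z then 0 else h s)"
    proof (rule integral_le)
      show "- (2 * m * F s) \<le> (if s \<in> Z then 0 else h s)" if "s \<in> {t0..\<tau>}" for s
      proof (cases "s \<in> Z")
        case True
        then show ?thesis using F0[of s] m0 that t0(1) by simp
      next
        case False
        then show ?thesis
          using that t0(1) eq[of s] fv[of s] mult_nonpos_nonneg[OF \<beta> B_pos[of "v s"]]
          by (simp add: h_def mult.assoc abs_le_iff)
      qed
    qed (use calculation part[of t0 \<tau>] t0(1) in \<open>auto intro: integrable_on_mult_right integrable_neg\<close>)
    ultimately have "m\<^sup>2 \<le> (e \<tau>)\<^sup>2 + 2 * (m * integral {t0..\<tau>} F)" by (simp add: mult.assoc)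
    also have "\<dots> \<le> (e \<tau>)\<^sup>2 + 2 * (m * \<Phi>)"
      using part[of t0 \<tau>] t0(1) m0 by (intro add_left_mono mult_left_mono) auto
    finally have "m \<le> e \<tau> + 2 * \<Phi>" using t0(2)[of \<tau>] \<tau> e0 by (intro cancel) (auto simp: m_def)
    then show ?thesis using t0(2)[of 0] \<tau> by (simp add: e_def m_def \<Phi>_def)
  qed
qed

end

text \<open>Lets the Euler scheme also serve as the exponential of the generator of the Galerkin
  system.\<close>

lemma bounded_m_dissipative:
  fixes M :: "'a::{real_inner, complete_space} \<Rightarrow> 'a"
  assumes M: "bounded_linear M" and diss: "\<And>x. inner (M x) x \<le> 0"
  shows "m_dissipative UNIV M"
proof
  fix e :: real and y :: 'a assume e: "e > 0"
  define T where "T x = x - e *\<^sub>R M x" for x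
  have bl: "bounded_linear T"
    unfolding T_def by (intro bounded_linear_sub bounded_linear_ident bounded_linear_const_scaleR M)
  have below: "norm x * norm x \<le> inner (T x) x" for x
  proof -
    have "e * inner (M x) x \<le> 0" using e diss by (simp add: mult_nonneg_nonpos)
    then show ?thesis by (simp add: T_def inner_diff_left power2_norm_eq_inner[symmetric] power2_eq_square)
  qed
  have "T ` UNIV = UNIV"
  proof (rule bounded_below_surj[of T UNIV 1])
    show "subspace (range T)" using bounded_linear.linear[OF bl] by (simp add: linear_subspace_image)
    show "dist x z \<le> 1 * dist (T x) (T z)" for x z
    proof -
      have "norm (x - z) * norm (x - z) \<le> norm (T (x - z)) * norm (x - z)"
        using below[of "x - z"] norm_cauchy_schwarz[of "T (x - z)" "x - z"] by linarith
      then have "norm (x - z) \<le> norm (T (x - z))" by (cases "x = z") auto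
      then show ?thesis using bounded_linear.linear[OF bl] by (simp add: dist_norm linear_diff)
    qed
    show "x \<in> UNIV \<and> T x = z" if "X \<longlonglongrightarrow> x" "(\<lambda>n. T (X n)) \<longlonglongrightarrow> z" for X x z
      using bounded_linear.tendsto[OF bl that(1)] that(2) LIMSEQ_unique by blast
    show "z = 0" if "\<And>x. x \<in> UNIV \<Longrightarrow> inner (T x) z = 0" for z
      using below[of z] that[of z] by (simp add: mult_le_0_iff)
  qed simp
  then have "y \<in> range T" by simp
  then show "\<exists>x\<in>UNIV. x - e *\<^sub>R M x = y" by (auto simp: T_def)
qed (use M diss in \<open>auto simp: bounded_linear.linear linear_add linear_cmul\<close>)

section \<open>First order form of the Galerkin equation and consistency\<close>

context galerkin begin

text \<open>The equation (G) as a first order system for \<open>(R p, p')\<close>, extended by projections from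
  \<open>R V \<times> V\<close> to a bounded operator on the whole space.\<close>

definition generator :: "'h \<times> 'h \<Rightarrow> 'h \<times> 'h" where
  "generator z = (Q (snd z), - (\<Sum>e\<in>EV. inner (fst z) (R e) *\<^sub>R e) - EV.proj (B (EV.proj (snd z))))"

lemma bounded_linear_generator: "bounded_linear generator"
  unfolding generator_def
  by (intro bounded_linear_Pair bounded_linear_compose[OF bounded_linear_Q] bounded_linear_snd
      bounded_linear_sub bounded_linear_minus bounded_linear_sum
      bounded_linear_compose[OF bounded_linear_scaleR_left]
      bounded_linear_compose[OF bounded_linear_inner_left] bounded_linear_fst
      bounded_linear_compose[OF EV.bounded_linear_proj] bounded_linear_compose[OF linear_B])

lemma inner_EV_proj: "inner (EV.proj x) y = inner x (EV.proj y)"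
  by (simp add: EV.proj_def inner_sum_left inner_sum_right inner_commute mult.commute)

lemma inner_generator: "inner (generator z) z \<le> 0"
proof -
  have "inner (Q (snd z)) (fst z) = inner (\<Sum>e\<in>EV. inner (fst z) (R e) *\<^sub>R e) (snd z)"
    by (simp add: Q_def inner_sum_left inner_sum_right inner_commute mult.commute)
  moreover have "inner (EV.proj (B (EV.proj (snd z)))) (snd z) \<ge> 0"
    using B_pos[of "EV.proj (snd z)"] by (simp add: inner_EV_proj)
  ultimately show ?thesis by (simp add: generator_def inner_prod_def inner_diff_left)
qed

lemma Q_eq: "Q x = R (EV.proj x)"
  using R_sum[OF EV.finite_E, of "\<lambda>e. inner x e *\<^sub>R e"]
  unfolding Q_def EV.proj_def by (simp add: D_closed R_scale)

lemma weak_sol_memD: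
  "weak_sol \<tau> \<beta> f w v \<Longrightarrow> t \<in> {0..\<tau>} \<Longrightarrow> w t \<in> V \<and> v t \<in> V"
  unfolding weak_sol_def by blast

text \<open>The path \<open>prj p\<close> solves the Galerkin equation with a perturbed right-hand
  side. The elastic term leaves no residual, because \<open>prj\<close> is orthogonal for the energy
  product; only inertia and damping do, through \<open>r - prj r\<close> and
  \<open>B (q - prj q)\<close>. The energy estimate for the difference from \<open>w\<close> then
  gives both directions in time. Here \<open>g\<close> drives the exact equation, \<open>f\<close>
  the discrete one, and \<open>F\<close> bounds their difference.\<close>

lemma consistency:
  assumes p: "smooth_path \<tau> p q r" and \<tau>: "\<tau> > 0"
    and pde: "\<And>t \<phi>. t \<in> {0..\<tau>} \<Longrightarrow> \<phi> \<in> V \<Longrightarrow>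
      inner (r t) \<phi> + inner (R (p t)) (R \<phi>) + \<beta> * inner (B (q t)) \<phi> = inner (g t) \<phi>"
    and \<beta>: "\<bar>\<beta>\<bar> \<le> 1" and sol: "weak_sol \<tau> \<beta> f w v"
    and F: "F integrable_on {0..\<tau>}" "\<And>t. t \<in> {0..\<tau>} \<Longrightarrow> norm (f t - g t) \<le> F t"
    and approx: "\<And>\<phi>. \<phi> \<in> D \<Longrightarrow> norm (prj \<phi> - \<phi>) \<le> \<epsilon> * norm (R \<phi>)" and \<epsilon>: "\<epsilon> \<ge> 0"
    and bounds: "\<And>t. t \<in> {0..\<tau>} \<Longrightarrow> norm (R (q t)) \<le> M1" "\<And>t. t \<in> {0..\<tau>} \<Longrightarrow> norm (R (r t)) \<le> M2"
  defines "e \<equiv> \<lambda>t. energy (w t - prj (p t)) (v t - prj (q t))"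
    and "\<Phi> \<equiv> 2 * integral {0..\<tau>} F + 2 * \<tau> * (\<epsilon> * (M2 + b * M1))"
  shows "\<beta> \<ge> 0 \<Longrightarrow> e \<tau> \<le> e 0 + \<Phi>" and "\<beta> \<le> 0 \<Longrightarrow> e 0 \<le> e \<tau> + \<Phi>"
proof -
  have mem: "p t \<in> D" "q t \<in> D" "r t \<in> D"
    and der: "((\<lambda>s. R (p s)) has_vector_derivative R (q t)) (at t within {0..\<tau>})"
      "((\<lambda>s. R (q s)) has_vector_derivative R (r t)) (at t within {0..\<tau>})" if "t \<in> {0..\<tau>}" for t
    using p that unfolding smooth_path_def by blast+
  define f' where "f' t = g t - (r t - prj (r t)) - \<beta> *\<^sub>R B (q t - prj (q t))" for t
  have bl: "bounded_linear (\<lambda>x. S (ER.proj x))"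
    by (rule bounded_linear_compose[OF bounded_linear_S ER.bounded_linear_proj])
  have sol': "weak_sol \<tau> \<beta> f' (\<lambda>t. prj (p t)) (\<lambda>t. prj (q t))"
  proof (rule weak_sol_smooth[where a="\<lambda>t. prj (r t)"])
    fix t assume t: "t \<in> {0..\<tau>}"
    show "((\<lambda>t. prj (p t)) has_vector_derivative prj (q t)) (at t within {0..\<tau>})"
      "((\<lambda>t. prj (q t)) has_vector_derivative prj (r t)) (at t within {0..\<tau>})"
      unfolding prj_def by (rule bounded_linear.has_vector_derivative[OF bl der(1)[OF t]],
        rule bounded_linear.has_vector_derivative[OF bl der(2)[OF t]])
    fix \<phi> assume \<phi>: "\<phi> \<in> V"
    have "B (q t - prj (q t)) = B (q t) - B (prj (q t))"
      using bounded_linear.linear[OF linear_B] by (simp add: linear_diff)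
    then have "inner (B (q t - prj (q t))) \<phi> = inner (B (q t)) \<phi> - inner (B (prj (q t))) \<phi>"
      by (simp add: inner_diff_left)
    then show "inner (prj (r t)) \<phi> + inner (R (prj (p t))) (R \<phi>) + \<beta> * inner (B (prj (q t))) \<phi> = inner (f' t) \<phi>"
      using pde[OF t \<phi>] by (simp add: f'_def prj_orthogonal[OF \<phi>] inner_diff_left right_diff_distrib)
  next
    fix \<phi>
    have "continuous_on {0..\<tau>} (\<lambda>t. R (r t))" using p unfolding smooth_path_def by blast
    then show "continuous_on {0..\<tau>} (\<lambda>t. inner (prj (r t)) \<phi>)"
      unfolding prj_def by (intro continuous_intros bounded_linear.continuous_on[OF bl])
  qed simp
  have M: "M1 \<ge> 0" "M2 \<ge> 0" using bounds[of 0] \<tau> by (auto intro: order_trans[OF norm_ge_zero])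
  have diff: "weak_sol \<tau> \<beta> (\<lambda>t. f t - f' t) (\<lambda>t. w t - prj (p t)) (\<lambda>t. v t - prj (q t))"
    using weak_sol_linear[OF sol sol', of "-1"] by simp
  have bnd: "norm (f t - f' t) \<le> F t + \<epsilon> * (M2 + b * M1)" if t: "t \<in> {0..\<tau>}" for t
  proof -
    have "f t - f' t = (f t - g t) + (r t - prj (r t)) + \<beta> *\<^sub>R B (q t - prj (q t))"
      by (simp add: f'_def)
    then have "norm (f t - f' t) \<le> norm (f t - g t) + norm (r t - prj (r t)) + norm (\<beta> *\<^sub>R B (q t - prj (q t)))"
      by (simp only: norm_triangle3)
    moreover have "norm (r t - prj (r t)) \<le> \<epsilon> * M2"
      using approx[OF mem(3)[OF t]] mult_left_mono[OF bounds(2)[OF t] \<epsilon>] by (simp add: norm_minus_commute)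
    moreover have "norm (\<beta> *\<^sub>R B (q t - prj (q t))) \<le> b * (\<epsilon> * M1)"
    proof -
      have "norm (q t - prj (q t)) \<le> \<epsilon> * M1"
        using approx[OF mem(2)[OF t]] mult_left_mono[OF bounds(1)[OF t] \<epsilon>] by (simp add: norm_minus_commute)
      then have "norm (B (q t - prj (q t))) \<le> b * (\<epsilon> * M1)"
        using norm_B[of "q t - prj (q t)"] mult_left_mono[OF _ b_nonneg] by (meson order_trans)
      moreover have "\<bar>\<beta>\<bar> * norm (B (q t - prj (q t))) \<le> 1 * norm (B (q t - prj (q t)))"
        using \<beta> by (intro mult_right_mono) auto
      ultimately show ?thesis by simp
    qed
    ultimately show ?thesis using F(2)[OF t] by (simp add: algebra_simps)
  qed
  have int: "((\<lambda>t. F t + \<epsilon> * (M2 + b * M1)) has_integral (integral {0..\<tau>} F + \<tau> * (\<epsilon> * (M2 + b * M1)))) {0..\<tau>}"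
    using has_integral_add[OF integrable_integral[OF F(1)] has_integral_const_real[of "\<epsilon> * (M2 + b * M1)" 0 \<tau>]] \<tau>
    by simp
  have eq: "2 * integral {0..\<tau>} (\<lambda>t. F t + \<epsilon> * (M2 + b * M1)) = \<Phi>"
    unfolding integral_unique[OF int] \<Phi>_def by simp
  show "\<beta> \<ge> 0 \<Longrightarrow> e \<tau> \<le> e 0 + \<Phi>" "\<beta> \<le> 0 \<Longrightarrow> e 0 \<le> e \<tau> + \<Phi>"
    using energy_estimate[OF diff less_imp_le[OF \<tau>] has_integral_integrable[OF int] bnd]
    unfolding eq e_def by auto
qed

end

section \<open>The discrete semigroups\<close>

locale galerkin_flow = galerkin D R S c B V b
  for D :: "'h::{real_inner, complete_space} set" and R S :: "'h \<Rightarrow> 'h" and c :: real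
    and B :: "'h \<Rightarrow> 'h" and V :: "'h set" and b :: real +
  fixes C0 :: "'h \<Rightarrow> 'y::real_inner" and \<tau> :: real
  assumes B_eq: "adjoint C0 (C0 x) = B x" and \<tau>_pos: "\<tau> > 0"
begin

abbreviation "gsol \<equiv> galerkin_solution R C0 V \<tau>"

text \<open>\<open>galerkin_solution\<close> asks only for pointwise derivatives. The equation
  itself shows that the pairings of the acceleration are continuous, which gives the integrability
  that \<open>weak_sol\<close> demands.\<close>

lemma gsolE:
  assumes "gsol p0 p1 p v"
  obtains a where "p 0 = p0" "v 0 = p1"
    "\<And>t. t \<in> {0..\<tau>} \<Longrightarrow> p t \<in> V" "\<And>t. t \<in> {0..\<tau>} \<Longrightarrow> v t \<in> V"
    "\<And>t. t \<in> {0..\<tau>} \<Longrightarrow> (p has_vector_derivative v t) (at t within {0..\<tau>})"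
    "\<And>t. t \<in> {0..\<tau>} \<Longrightarrow> (v has_vector_derivative a t) (at t within {0..\<tau>})"
    "\<And>t \<phi>. t \<in> {0..\<tau>} \<Longrightarrow> \<phi> \<in> V \<Longrightarrow> inner (a t) \<phi> + inner (R (p t)) (R \<phi>) + inner (B (v t)) \<phi> = 0"
    "\<And>\<phi>. \<phi> \<in> V \<Longrightarrow> continuous_on {0..\<tau>} (\<lambda>t. inner (a t) \<phi>)"
proof -
  obtain a where a: "p 0 = p0" "v 0 = p1" "\<forall>t\<in>{0..\<tau>}. p t \<in> V \<and>
        (p has_vector_derivative v t) (at t within {0..\<tau>}) \<and>
        (v has_vector_derivative a t) (at t within {0..\<tau>}) \<and>
        (\<forall>\<phi>\<in>V. inner (a t) \<phi> + inner (R (p t)) (R \<phi>) + inner (B (v t)) \<phi> = 0)"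
    using assms unfolding galerkin_solution_def B_eq by blast
  have p: "continuous_on {0..\<tau>} p" and v: "continuous_on {0..\<tau>} v"
    using a(3) by (auto intro!: continuous_on_vector_derivative)
  show ?thesis
  proof (rule that[OF a(1,2), of a])
    show "v t \<in> V" if "t \<in> {0..\<tau>}" for t
      using EV.derivative_in_span[of p "v t" t \<tau>] a(3) that \<tau>_pos by (simp add: EV(2))
    fix \<phi> assume \<phi>: "\<phi> \<in> V"
    have "continuous_on {0..\<tau>} (\<lambda>t. - inner (Q (p t)) (R \<phi>) - inner (B (v t)) \<phi>)"
      by (intro continuous_intros p v bounded_linear.continuous_on[OF bounded_linear_Q]
          bounded_linear.continuous_on[OF linear_B])
    then show "continuous_on {0..\<tau>} (\<lambda>t. inner (a t) \<phi>)"
    proof (rule continuous_on_eq)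
      fix t assume "t \<in> {0..\<tau>}"
      then have "p t \<in> V" "inner (a t) \<phi> + inner (R (p t)) (R \<phi>) + inner (B (v t)) \<phi> = 0"
        using a(3) \<phi> by auto
      then show "- inner (Q (p t)) (R \<phi>) - inner (B (v t)) \<phi> = inner (a t) \<phi>"
        unfolding Q_eq_R[OF \<open>p t \<in> V\<close>] by linarith
    qed
  qed (use a(3) in blast)+
qed

lemma gsol_weak: "gsol p0 p1 p v \<Longrightarrow> weak_sol \<tau> 1 (\<lambda>_. 0) p v"
  by (elim gsolE, rule weak_sol_smooth) auto

lemma has_vector_derivative_reverse:
  assumes "\<And>t. t \<in> {0..\<tau>} \<Longrightarrow> (f has_vector_derivative f' t) (at t within {0..\<tau>})" "t \<in> {0..\<tau>}"
  shows "((\<lambda>t. f (\<tau> - t)) has_vector_derivative - f' (\<tau> - t)) (at t within {0..\<tau>})"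
proof -
  have im: "(\<lambda>t. \<tau> - t) ` {0..\<tau>} = {0..\<tau>}" by (simp add: image_diff_atLeastAtMost)
  have "((\<lambda>t. \<tau> - t) has_vector_derivative (-1)) (at t within {0..\<tau>})"
    by (auto intro!: derivative_eq_intros)
  moreover have "(f has_vector_derivative f' (\<tau> - t)) (at (\<tau> - t) within (\<lambda>t. \<tau> - t) ` {0..\<tau>})"
    unfolding im using assms by auto
  ultimately show ?thesis
    using vector_diff_chain_within[of "\<lambda>t. \<tau> - t" "-1" t "{0..\<tau>}" f "f' (\<tau> - t)"] by (simp add: o_def)
qed

text \<open>Reversing time changes the sign of the damping, so that a discrete damped solution can
  be superposed on the backward observer.\<close>

lemma gsol_reverse_weak:
  assumes "gsol p0 p1 p v"
  shows "weak_sol \<tau> (-1) (\<lambda>_. 0) (\<lambda>t. p (\<tau> - t)) (\<lambda>t. - v (\<tau> - t))"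
proof -
  obtain a where a: "\<And>t. t \<in> {0..\<tau>} \<Longrightarrow> p t \<in> V" "\<And>t. t \<in> {0..\<tau>} \<Longrightarrow> v t \<in> V"
    "\<And>t. t \<in> {0..\<tau>} \<Longrightarrow> (p has_vector_derivative v t) (at t within {0..\<tau>})"
    "\<And>t. t \<in> {0..\<tau>} \<Longrightarrow> (v has_vector_derivative a t) (at t within {0..\<tau>})"
    "\<And>t \<phi>. t \<in> {0..\<tau>} \<Longrightarrow> \<phi> \<in> V \<Longrightarrow> inner (a t) \<phi> + inner (R (p t)) (R \<phi>) + inner (B (v t)) \<phi> = 0"
    "\<And>\<phi>. \<phi> \<in> V \<Longrightarrow> continuous_on {0..\<tau>} (\<lambda>t. inner (a t) \<phi>)"
    using assms by (rule gsolE) blast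
  show ?thesis
  proof (rule weak_sol_smooth[where a="\<lambda>t. a (\<tau> - t)"])
    fix t assume t: "t \<in> {0..\<tau>}"
    then have t': "\<tau> - t \<in> {0..\<tau>}" by auto
    show "p (\<tau> - t) \<in> V \<and> - v (\<tau> - t) \<in> V" using a(1,2)[OF t'] by auto
    show "((\<lambda>t. p (\<tau> - t)) has_vector_derivative - v (\<tau> - t)) (at t within {0..\<tau>})"
      by (rule has_vector_derivative_reverse[OF a(3) t])
    show "((\<lambda>t. - v (\<tau> - t)) has_vector_derivative a (\<tau> - t)) (at t within {0..\<tau>})"
      using has_vector_derivative_minus[OF has_vector_derivative_reverse[OF a(4) t]] by simp
    fix \<phi> assume "\<phi> \<in> V"
    then show "inner (a (\<tau> - t)) \<phi> + inner (R (p (\<tau> - t))) (R \<phi>) + - 1 * inner (B (- v (\<tau> - t))) \<phi> = inner 0 \<phi>"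
      using a(5)[OF t'] bounded_linear.linear[OF linear_B] by (simp add: linear_neg)
  next
    fix \<phi> assume "\<phi> \<in> V"
    have im: "(\<lambda>t. \<tau> - t) ` {0..\<tau>} = {0..\<tau>}" by (simp add: image_diff_atLeastAtMost)
    have "continuous_on {0..\<tau>} (\<lambda>t. \<tau> - t)" by (intro continuous_intros)
    from continuous_on_compose[OF this, of "\<lambda>t. inner (a t) \<phi>"]
    have "continuous_on {0..\<tau>} ((\<lambda>t. inner (a t) \<phi>) \<circ> (\<lambda>t. \<tau> - t))"
      unfolding im using a(6)[OF \<open>\<phi> \<in> V\<close>] by simp
    then show "continuous_on {0..\<tau>} (\<lambda>t. inner (a (\<tau> - t)) \<phi>)" by (simp add: o_def)
  qed
qed

text \<open>The semigroup of \<open>generator\<close> lives on the whole space; by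
  \<open>invariant_span\<close> its components stay in the image of \<open>V\<close> and in
  \<open>V\<close>, where \<open>Q\<close> is \<open>R\<close> and the projections act as
  identities.\<close>

lemma gsol_exists:
  assumes p0: "p0 \<in> V" "p1 \<in> V"
  shows "\<exists>p v. gsol p0 p1 p v"
proof -
  obtain T where "contraction_semigroup T UNIV generator"
    using m_dissipative.contraction_semigroup_S[OF bounded_m_dissipative[OF bounded_linear_generator inner_generator]]
    by blast
  then interpret T: contraction_semigroup T UNIV generator .
  define z where "z t = T t (R p0, p1)" for t
  define v where "v t = snd (z t)" for t
  define p where "p t = S (fst (z t))" for t
  define a where "a t = snd (generator (z t))" for t
  have z0: "z 0 = (R p0, p1)" by (simp add: z_def)
  have z': "(z has_vector_derivative generator (z t)) (at t within {0..\<tau>})" if "t \<in> {0..\<tau>}" for t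
    unfolding z_def by (rule T.has_derivative_T_comp[OF _ that]) simp
  have u': "((\<lambda>t. fst (z t)) has_vector_derivative Q (v t)) (at t within {0..\<tau>})"
    and v': "(v has_vector_derivative a t) (at t within {0..\<tau>})" if "t \<in> {0..\<tau>}" for t
    using bounded_linear.has_vector_derivative[OF bounded_linear_fst z'[OF that]]
      bounded_linear.has_vector_derivative[OF bounded_linear_snd z'[OF that]]
    by (simp_all add: v_def[abs_def] a_def generator_def)
  have projV: "EV.proj x \<in> V" for x using EV.proj_mem EV(2) by simp
  have u: "fst (z t) \<in> R ` V" if "t \<in> {0..\<tau>}" for t
    using ER.invariant_span[of \<tau> "\<lambda>t. fst (z t)" "\<lambda>t. Q (v t)" t] that u' p0 projV
    by (auto simp: ER(2) z0 Q_eq)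
  have v: "v t \<in> V" if "t \<in> {0..\<tau>}" for t
  proof -
    have "a t \<in> V" for t unfolding a_def generator_def
      by (auto intro!: V_closed(3,5) projV subspace_sum[OF subspace_V] V_closed(4))
    then show ?thesis
      using EV.invariant_span[of \<tau> v a t] that v' p0 by (simp add: EV(2) v_def z0)
  qed
  have "gsol p0 p1 p v"
    unfolding galerkin_solution_def B_eq
  proof (intro conjI exI[of _ a] ballI)
    show "p 0 = p0" "v 0 = p1" using p0 by (simp_all add: p_def v_def z0)
    fix t assume t: "t \<in> {0..\<tau>}"
    show "p t \<in> V" unfolding p_def by (rule S_RV[OF u[OF t]])
    have "(p has_vector_derivative S (Q (v t))) (at t within {0..\<tau>})"
      unfolding p_def by (rule bounded_linear.has_vector_derivative[OF bounded_linear_S u'[OF t]])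
    then show "(p has_vector_derivative v t) (at t within {0..\<tau>})"
      using Q_eq_R[OF v[OF t]] v[OF t] by simp
    show "(v has_vector_derivative a t) (at t within {0..\<tau>})" by (rule v'[OF t])
    fix \<phi> assume \<phi>: "\<phi> \<in> V"
    have "inner (\<Sum>e\<in>EV. inner (fst (z t)) (R e) *\<^sub>R e) \<phi> = inner (fst (z t)) (Q \<phi>)"
      by (simp add: Q_def inner_sum_left inner_sum_right inner_commute mult.commute)
    moreover have "inner (EV.proj (B (EV.proj (v t)))) \<phi> = inner (B (v t)) \<phi>"
      using EV.proj_id[of "v t"] EV.proj_id[of \<phi>] v[OF t] \<phi> by (simp add: inner_EV_proj EV(2))
    ultimately show "inner (a t) \<phi> + inner (R (p t)) (R \<phi>) + inner (B (v t)) \<phi> = 0"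
      using Q_eq_R[OF \<phi>] by (simp add: a_def generator_def p_def v_def[symmetric] inner_diff_left)
  qed
  then show ?thesis by blast
qed

lemma gsol_energy: "gsol p0 p1 p v \<Longrightarrow> energy (p \<tau>) (v \<tau>) \<le> energy p0 p1"
  using energy_estimate(1)[OF gsol_weak less_imp_le[OF \<tau>_pos], of p0 p1 p v "\<lambda>_. 0"]
  by (auto simp: galerkin_solution_def)

lemma energy_eq_0: "x \<in> D \<Longrightarrow> energy x y \<le> 0 \<Longrightarrow> x = 0 \<and> y = 0"
proof -
  assume x: "x \<in> D" "energy x y \<le> 0"
  then have "R x = 0 \<and> y = 0" by (simp add: energy_def zero_prod_def[symmetric] prod_eq_iff)
  then show ?thesis using S_R[OF x(1)] linear_0[OF bounded_linear.linear[OF bounded_linear_S]] by simp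
qed

lemma gsol_memD: "gsol p0 p1 p v \<Longrightarrow> t \<in> {0..\<tau>} \<Longrightarrow> p t \<in> V \<and> v t \<in> V"
  using weak_sol_memD[OF gsol_weak] by blast

lemma gsol_unique:
  assumes 1: "gsol p0 p1 p v" and 2: "gsol p0 p1 p' v'"
  shows "p \<tau> = p' \<tau>" "v \<tau> = v' \<tau>"
proof -
  have mem: "p \<tau> - p' \<tau> \<in> D" using gsol_memD[OF 1] gsol_memD[OF 2] \<tau>_pos by (auto intro!: D_closed)
  have "weak_sol \<tau> 1 (\<lambda>_. 0) (\<lambda>t. p t - p' t) (\<lambda>t. v t - v' t)"
    using weak_sol_linear[OF gsol_weak[OF 1] gsol_weak[OF 2], of "-1"] by simp
  from energy_estimate(1)[OF this less_imp_le[OF \<tau>_pos], of "\<lambda>_. 0"]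
  have "energy (p \<tau> - p' \<tau>) (v \<tau> - v' \<tau>) \<le> energy (p 0 - p' 0) (v 0 - v' 0)"
    by (simp add: integrable_0)
  also have "\<dots> = 0" using 1 2 by (simp add: galerkin_solution_def energy_def zero_prod_def[symmetric])
  finally show "p \<tau> = p' \<tau>" "v \<tau> = v' \<tau>" using energy_eq_0[OF mem, of "v \<tau> - v' \<tau>"] by auto
qed

lemma disc_flow_eq:
  assumes sol: "gsol p0 p1 p v"
  shows "disc_flow R C0 V \<tau> \<tau> p0 p1 = (p \<tau>, v \<tau>)"
  unfolding disc_flow_def
proof (rule the_equality)
  show "\<exists>p' v'. gsol p0 p1 p' v' \<and> (p \<tau>, v \<tau>) = (p' \<tau>, v' \<tau>)" using sol by blast
  fix z assume "\<exists>p v. gsol p0 p1 p v \<and> z = (p \<tau>, v \<tau>)"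
  then show "z = (p \<tau>, v \<tau>)" using gsol_unique[OF _ sol] by auto
qed

lemma gsol_add:
  assumes "gsol p0 p1 p v" "gsol q0 q1 q w"
  shows "gsol (p0 + q0) (p1 + q1) (\<lambda>t. p t + q t) (\<lambda>t. v t + w t)"
proof -
  obtain a where a: "p 0 = p0" "v 0 = p1" "\<forall>t\<in>{0..\<tau>}. p t \<in> V \<and>
        (p has_vector_derivative v t) (at t within {0..\<tau>}) \<and> (v has_vector_derivative a t) (at t within {0..\<tau>}) \<and>
        (\<forall>\<phi>\<in>V. inner (a t) \<phi> + inner (R (p t)) (R \<phi>) + inner (B (v t)) \<phi> = 0)"
    using assms(1) unfolding galerkin_solution_def B_eq by blast
  obtain a' where a': "q 0 = q0" "w 0 = q1" "\<forall>t\<in>{0..\<tau>}. q t \<in> V \<and>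
        (q has_vector_derivative w t) (at t within {0..\<tau>}) \<and> (w has_vector_derivative a' t) (at t within {0..\<tau>}) \<and>
        (\<forall>\<phi>\<in>V. inner (a' t) \<phi> + inner (R (q t)) (R \<phi>) + inner (B (w t)) \<phi> = 0)"
    using assms(2) unfolding galerkin_solution_def B_eq by blast
  show ?thesis
    unfolding galerkin_solution_def B_eq
  proof (intro conjI exI[of _ "\<lambda>t. a t + a' t"] ballI)
    fix t \<phi> assume t: "t \<in> {0..\<tau>}" and \<phi>: "\<phi> \<in> V"
    have "inner (a t) \<phi> + inner (R (p t)) (R \<phi>) + inner (B (v t)) \<phi> = 0"
      "inner (a' t) \<phi> + inner (R (q t)) (R \<phi>) + inner (B (w t)) \<phi> = 0" using a(3) a'(3) t \<phi> by auto
    moreover have "p t \<in> D" "q t \<in> D" using a(3) a'(3) t by auto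
    ultimately show "inner (a t + a' t) \<phi> + inner (R (p t + q t)) (R \<phi>) + inner (B (v t + w t)) \<phi> = 0"
      using bounded_linear.linear[OF linear_B] by (simp add: R_add linear_add inner_add_left)
  qed (use a a' in \<open>auto intro!: has_vector_derivative_add\<close>)
qed

abbreviation "plus_h \<equiv> disc_semigroup_plus R C0 V \<tau> \<tau>"
abbreviation "minus_h \<equiv> disc_semigroup_minus R C0 V \<tau> \<tau>"
abbreviation "L_h \<equiv> disc_L R C0 V \<tau>"

lemma plus_h_eq: "z \<in> V \<times> V \<Longrightarrow> gsol (fst z) (snd z) p v \<Longrightarrow> plus_h z = (p \<tau>, v \<tau>)"
  unfolding disc_semigroup_plus_def by (auto simp: energy_proj_eq prj_id disc_flow_eq)

lemma minus_h_eq: "z \<in> V \<times> V \<Longrightarrow> gsol (fst z) (- snd z) p v \<Longrightarrow> minus_h z = (p \<tau>, - v \<tau>)"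
  unfolding disc_semigroup_minus_def by (auto simp: energy_proj_eq prj_id disc_flow_eq)

definition enorm :: "'h \<times> 'h \<Rightarrow> real" where "enorm z = energy (fst z) (snd z)"

lemma energy_minus [simp]: "energy x (- y) = energy x y" by (simp add: energy_def norm_Pair)

lemma enorm_triangle: "z \<in> D \<times> D \<Longrightarrow> w \<in> D \<times> D \<Longrightarrow> enorm (z + w) \<le> enorm z + enorm w"
  using norm_triangle_ineq[of "(R (fst z), snd z)" "(R (fst w), snd w)"]
  by (auto simp: enorm_def energy_def R_add)

lemma plus_h:
  assumes z: "z \<in> V \<times> V" and w: "w \<in> V \<times> V"
  shows "plus_h z \<in> V \<times> V" "enorm (plus_h z) \<le> enorm z" "plus_h (z + w) = plus_h z + plus_h w"
proof -
  obtain p v where 1: "gsol (fst z) (snd z) p v" using gsol_exists[of "fst z" "snd z"] z by auto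
  obtain q u where 2: "gsol (fst w) (snd w) q u" using gsol_exists[of "fst w" "snd w"] w by auto
  have zw: "z + w \<in> V \<times> V" using z w by (auto simp: mem_Times_iff)
  show "plus_h z \<in> V \<times> V" "enorm (plus_h z) \<le> enorm z"
    using gsol_memD[OF 1, of \<tau>] gsol_energy[OF 1] \<tau>_pos plus_h_eq[OF z 1] by (auto simp: enorm_def)
  have "gsol (fst (z + w)) (snd (z + w)) (\<lambda>t. p t + q t) (\<lambda>t. v t + u t)" using gsol_add[OF 1 2] by simp
  from plus_h_eq[OF zw this] show "plus_h (z + w) = plus_h z + plus_h w"
    using plus_h_eq[OF z 1] plus_h_eq[OF w 2] by simp
qed

lemma minus_h:
  assumes z: "z \<in> V \<times> V" and w: "w \<in> V \<times> V"
  shows "minus_h z \<in> V \<times> V" "enorm (minus_h z) \<le> enorm z" "minus_h (z + w) = minus_h z + minus_h w"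
proof -
  obtain p v where 1: "gsol (fst z) (- snd z) p v" using gsol_exists[of "fst z" "- snd z"] z by (auto simp: V_closed(5))
  obtain q u where 2: "gsol (fst w) (- snd w) q u" using gsol_exists[of "fst w" "- snd w"] w by (auto simp: V_closed(5))
  have zw: "z + w \<in> V \<times> V" using z w by (auto simp: mem_Times_iff)
  show "minus_h z \<in> V \<times> V" "enorm (minus_h z) \<le> enorm z"
    using gsol_memD[OF 1, of \<tau>] gsol_energy[OF 1] \<tau>_pos minus_h_eq[OF z 1] by (auto simp: enorm_def)
  have "gsol (fst (z + w)) (- snd (z + w)) (\<lambda>t. p t + q t) (\<lambda>t. v t + u t)" using gsol_add[OF 1 2] by simp
  from minus_h_eq[OF zw this] show "minus_h (z + w) = minus_h z + minus_h w"
    using minus_h_eq[OF z 1] minus_h_eq[OF w 2] by simp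
qed

lemma L_h:
  assumes z: "z \<in> V \<times> V" and w: "w \<in> V \<times> V"
  shows "L_h z \<in> V \<times> V" "enorm (L_h z) \<le> enorm z" "L_h (z + w) = L_h z + L_h w"
  unfolding disc_L_def
  using minus_h[OF plus_h(1)[OF z z] plus_h(1)[OF w w]] plus_h[OF z w] by auto

lemma L_h_pow:
  assumes z: "z \<in> V \<times> V" and w: "w \<in> V \<times> V"
  shows "(L_h ^^ n) z \<in> V \<times> V" "enorm ((L_h ^^ n) z) \<le> enorm z" "(L_h ^^ n) (z + w) = (L_h ^^ n) z + (L_h ^^ n) w"
proof -
  have mem: "(L_h ^^ n) z \<in> V \<times> V" if "z \<in> V \<times> V" for n z
    by (induction n) (use that L_h(1) in \<open>auto simp del: mem_Times_iff\<close>)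
  show "(L_h ^^ n) z \<in> V \<times> V" by (rule mem[OF z])
  show "enorm ((L_h ^^ n) z) \<le> enorm z"
    by (induction n) (use L_h(2)[OF mem[OF z] mem[OF z]] in \<open>auto intro: order_trans\<close>)
  show "(L_h ^^ n) (z + w) = (L_h ^^ n) z + (L_h ^^ n) w"
    by (induction n) (use L_h(3)[OF mem[OF z] mem[OF w]] in auto)
qed

lemma subspace_VV: "subspace (V \<times> V)" by (intro subspace_Times subspace_V)

text \<open>The powers of \<open>L_h\<close> applied to \<open>d\<close> are each no larger than
  \<open>d\<close> itself, so the \<open>N + 1\<close> of them add up linearly. Sums stand on both
  sides of the identity so that the induction uses additivity of \<open>L_h\<close> on
  \<open>V \<times> V\<close> only.\<close>

lemma neumann_sum:
  assumes x: "x \<in> V \<times> V" and d: "d \<in> V \<times> V" and y: "y + L_h x = x + d"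
  shows "\<exists>s\<in>V \<times> V. enorm s \<le> (real N + 1) * enorm d \<and> (\<Sum>n\<le>N. (L_h ^^ n) y) + (L_h ^^ Suc N) x = x + s"
proof -
  have Lx: "L_h x \<in> V \<times> V" by (rule L_h(1)[OF x x])
  have yV: "y \<in> V \<times> V"
  proof -
    have "y = x + d - L_h x" using y by (simp add: algebra_simps)
    then show ?thesis using subspace_VV x d Lx by (simp add: subspace_add subspace_diff del: mem_Times_iff)
  qed
  have VD: "z \<in> D \<times> D" if "z \<in> V \<times> V" for z using that V_D by auto
  show ?thesis
  proof (induction N)
    case 0
    show ?case using y d by (intro bexI[of _ d]) auto
  next
    case (Suc N)
    then obtain s where s: "s \<in> V \<times> V" "enorm s \<le> (real N + 1) * enorm d"
      "(\<Sum>n\<le>N. (L_h ^^ n) y) + (L_h ^^ Suc N) x = x + s" by blast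
    define e where "e = (L_h ^^ Suc N) d"
    have e: "e \<in> V \<times> V" "enorm e \<le> enorm d"
      unfolding e_def by (rule L_h_pow[OF d d])+
    have "(L_h ^^ Suc N) y + (L_h ^^ Suc N) (L_h x) = (L_h ^^ Suc N) x + e"
      unfolding e_def L_h_pow(3)[OF yV Lx, symmetric] L_h_pow(3)[OF x d, symmetric] y ..
    then have "(L_h ^^ Suc N) y + (L_h ^^ Suc (Suc N)) x = (L_h ^^ Suc N) x + e"
      by (simp add: funpow_swap1)
    then have "(\<Sum>n\<le>Suc N. (L_h ^^ n) y) + (L_h ^^ Suc (Suc N)) x
        = (\<Sum>n\<le>N. (L_h ^^ n) y) + ((L_h ^^ Suc N) x + e)"
      by (simp only: sum.atMost_Suc add.assoc)
    also have "\<dots> = x + (s + e)" by (simp only: add.assoc[symmetric] s(3))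
    finally have "(\<Sum>n\<le>Suc N. (L_h ^^ n) y) + (L_h ^^ Suc (Suc N)) x = x + (s + e)" .
    moreover have "s + e \<in> V \<times> V" using s(1) e(1) subspace_VV by (simp add: subspace_add del: mem_Times_iff)
    moreover have "enorm (s + e) \<le> (real (Suc N) + 1) * enorm d"
      using enorm_triangle[OF VD[OF s(1)] VD[OF e(1)]] s(2) e(2) by (simp add: algebra_simps)
    ultimately show ?case by (intro bexI[of _ "s + e"] conjI)
  qed
qed

end

section \<open>Error analysis\<close>

context positive_root begin

definition emb :: "'h \<times> 'h \<Rightarrow> 'h \<times> 'h" where "emb z = (R (fst z), snd z)"

definition phys :: "'h \<times> 'h \<Rightarrow> 'h \<times> 'h" where "phys z = (S (fst z), snd z)"

lemma phys_mem: "z \<in> D \<times> D \<Longrightarrow> phys z \<in> D \<times> D" by (auto simp: phys_def)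

lemma phys_X [simp]: "phys z \<in> D \<times> UNIV" by (simp add: phys_def)

lemma emb_phys [simp]: "emb (phys z) = z" by (simp add: emb_def phys_def)

lemma phys_emb [simp]: "z \<in> D \<times> UNIV \<Longrightarrow> phys (emb z) = z" by (auto simp: emb_def phys_def)

lemma norm_emb: "norm (emb z) = energy_norm R z" by (simp add: emb_def energy_norm_def norm_Pair)

lemma linear_phys: "linear phys"
  using bounded_linear.linear[OF bounded_linear_S]
  by (intro linearI) (auto simp: phys_def linear_add linear_cmul)

lemma emb_add: "z \<in> D \<times> UNIV \<Longrightarrow> w \<in> D \<times> UNIV \<Longrightarrow> emb (z + w) = emb z + emb w"
  and emb_diff: "z \<in> D \<times> UNIV \<Longrightarrow> w \<in> D \<times> UNIV \<Longrightarrow> emb (z - w) = emb z - emb w"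
  and emb_scale: "z \<in> D \<times> UNIV \<Longrightarrow> emb (a *\<^sub>R z) = a *\<^sub>R emb z"
  by (auto simp: emb_def R_add R_diff R_scale)

lemma subspace_X: "subspace (D \<times> (UNIV :: 'h set))" by (intro subspace_Times subspace_D subspace_UNIV)

lemmas X_closed = subspace_diff[OF subspace_X] subspace_scale[OF subspace_X]

lemma norm_emb_quotient:
  assumes "x \<in> D \<times> UNIV" "y \<in> D \<times> UNIV" "d \<in> D \<times> UNIV"
  shows "energy_norm R (a *\<^sub>R (x - y) - d) = norm (a *\<^sub>R (emb x - emb y) - emb d)"
  unfolding norm_emb[symmetric]
  using assms X_closed by (simp add: emb_diff emb_scale del: mem_Times_iff)

end

context damped_wave begin

text \<open>The constants bound \<open>G\<close>, \<open>G\<^sup>2\<close> and the damped semigroup by the norm of \<open>skew\<^sup>2\<close>.\<close>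

definition \<kappa>1 where "\<kappa>1 = c + b * c\<^sup>2"
definition \<kappa>2 where "\<kappa>2 = 1 + K * c + b * \<kappa>1"
definition \<kappa>3 where "\<kappa>3 = q + 2 * q * K * c"
definition \<kappa> where "\<kappa> = \<kappa>2 + b * \<kappa>1"

end

text \<open>One fixed \<open>h\<close>: \<open>V\<close> stands for the Galerkin space and
  \<open>\<epsilon>\<close> for the approximation bound \<open>M0 * h powr \<theta>\<close>. The
  constants \<open>\<kappa>\<close> depend on neither.\<close>

locale wave_galerkin = damped_wave D R S c B P N b K + galerkin_flow D R S c B V b C0 \<tau>
  for D :: "'h::{real_inner, complete_space} set" and R S c and B :: "'h \<Rightarrow> 'h" and P N b K V
    and C0 :: "'h \<Rightarrow> 'y::real_inner" and \<tau> +
  fixes \<epsilon> :: real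
  assumes \<epsilon>_nonneg: "\<epsilon> \<ge> 0" and approx: "\<phi> \<in> D \<Longrightarrow> norm (prj \<phi> - \<phi>) \<le> \<epsilon> * norm (R \<phi>)"
begin

text \<open>Takes the coordinates \<open>(R p, v)\<close> to discrete data. Both components use the
  energy projection, as in the definition of the discrete semigroups.\<close>

definition ph :: "'h \<times> 'h \<Rightarrow> 'h \<times> 'h" where "ph z = (prj (S (fst z)), prj (snd z))"

lemma ph_mem [simp]: "ph z \<in> V \<times> V" by (simp add: ph_def)

lemma VV_D: "z \<in> V \<times> V \<Longrightarrow> z \<in> D \<times> D" using V_D by auto

lemma enorm_phys: "enorm (phys z) = norm z" by (simp add: enorm_def energy_def phys_def)

lemma prj_minus: "x \<in> D \<Longrightarrow> prj (- x) = - prj x"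
  using prj_diff[of 0 x] prj_id[of 0] by (simp add: D_closed V_closed)


abbreviation "norm2 z \<equiv> norm (skew (skew z))"

lemma D2D: "z \<in> D2 \<Longrightarrow> z \<in> D \<times> D" "z \<in> D2 \<Longrightarrow> skew z \<in> D \<times> D"
  by (auto simp: D2_def)

lemma norm_skew_le: "z \<in> D2 \<Longrightarrow> norm (skew z) \<le> c * norm2 z"
  by (rule norm_le_skew[OF D2D(2)])

lemma norm_le_norm2: "z \<in> D2 \<Longrightarrow> norm z \<le> c\<^sup>2 * norm2 z"
  using norm_le_skew[OF D2D(1), of z] mult_left_mono[OF norm_skew_le[of z], of c] c_pos
  unfolding power2_eq_square mult.assoc by linarith

lemma \<kappa>_pos: "\<kappa>1 > 0" "\<kappa>2 > 0" "\<kappa>3 > 0"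
proof -
  show 1: "\<kappa>1 > 0" using c_pos b_nonneg by (simp add: \<kappa>1_def add_pos_nonneg)
  show "\<kappa>2 > 0" using 1 c_pos b_nonneg K_nonneg by (simp add: \<kappa>2_def add_pos_nonneg)
  show "\<kappa>3 > 0" using q_pos c_pos K_nonneg by (simp add: \<kappa>3_def add_pos_nonneg)
qed

lemma generator_bounds:
  assumes z: "z \<in> D2" and G: "G = Gp \<or> G = Gm"
  shows "G z \<in> D \<times> D" "norm (G z) \<le> \<kappa>1 * norm2 z" "norm (G (G z)) \<le> \<kappa>2 * norm2 z"
proof -
  note z1 = D2D(1)[OF z] D2D(2)[OF z]
  show Gz: "G z \<in> D \<times> D"
    using G z1 by (auto simp only: Gp_def Gm_def intro!: DD_diff DD_neg damp_mem)
  have le: "norm (G w) \<le> norm (skew w) + b * norm w" for w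
    using G norm_triangle_ineq4[of "skew w" "damp w"] norm_triangle_ineq4[of "- skew w" "damp w"] norm_damp[of w]
    by (auto simp: Gp_def Gm_def)
  have 1: "norm (skew z) + b * norm z \<le> \<kappa>1 * norm2 z"
    using norm_skew_le[OF z] mult_left_mono[OF norm_le_norm2[OF z] b_nonneg]
    by (simp add: \<kappa>1_def algebra_simps)
  then show 2: "norm (G z) \<le> \<kappa>1 * norm2 z" using le[of z] by linarith
  have "norm (skew (G z)) \<le> norm (skew (skew z)) + norm (skew (damp z))"
  proof -
    have "skew (G z) = skew (skew z) - skew (damp z) \<or> skew (G z) = - skew (skew z) - skew (damp z)"
      using G z1 damp_mem[OF z1(1)] skew_diff[OF z1(2) damp_mem[OF z1(1)]]
        skew_diff[OF DD_neg[OF z1(2)] damp_mem[OF z1(1)]] skew_scale[OF z1(2), of "-1"]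
      by (auto simp only: Gp_def Gm_def scaleR_minus1_left)
    then show ?thesis
      using norm_triangle_ineq4[of "skew (skew z)" "skew (damp z)"]
        norm_triangle_ineq4[of "- skew (skew z)" "skew (damp z)"] by auto
  qed
  also have "norm (skew (damp z)) \<le> K * (c * norm2 z)"
    using norm_skew_damp[OF z1(1)] mult_left_mono[OF norm_skew_le[OF z] K_nonneg] by linarith
  finally have "norm (skew (G z)) \<le> (1 + K * c) * norm2 z" by (simp add: algebra_simps)
  moreover have "b * norm (G z) \<le> b * (\<kappa>1 * norm2 z)" by (rule mult_left_mono[OF 2 b_nonneg])
  ultimately show "norm (G (G z)) \<le> \<kappa>2 * norm2 z"
    using le[of "G z"] by (simp add: \<kappa>2_def algebra_simps)
qed

lemma norm2_P: assumes z: "z \<in> D2" and t: "t \<ge> 0" shows "norm2 (P t z) \<le> \<kappa>3 * norm2 z"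
proof -
  note z1 = D2D(1)[OF z] D2D(2)[OF z]
  have mem: "P t (skew z) \<in> D \<times> D" "P t (damp z) \<in> D \<times> D" "damp (P t z) \<in> D \<times> D"
    using t z1 damp_mem by (auto simp del: mem_Times_iff intro!: P.dom damp_mem)
  have "skew (skew (P t z)) = skew (P t (skew z)) - skew (P t (damp z)) + skew (damp (P t z))"
    unfolding skew_P[OF z1(1) t] by (simp only: skew_add[OF DD_diff[OF mem(1,2)] mem(3)] skew_diff[OF mem(1,2)])
  then have "norm2 (P t z) \<le> norm (skew (P t (skew z))) + norm (skew (P t (damp z))) + norm (skew (damp (P t z)))"
    by (simp only: norm_triangle3)
  moreover have "norm (skew (P t (skew z))) \<le> q * norm2 z" by (rule norm_skew_P[OF z1(2) t])
  moreover have "norm (skew (P t (damp z))) \<le> q * (K * (c * norm2 z))"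
  proof -
    have "norm (skew (P t (damp z))) \<le> q * norm (skew (damp z))" by (rule norm_skew_P[OF damp_mem[OF z1(1)] t])
    also have "\<dots> \<le> q * (K * norm (skew z))" using q_pos by (intro mult_left_mono norm_skew_damp z1) auto
    also have "\<dots> \<le> q * (K * (c * norm2 z))"
      using q_pos K_nonneg by (intro mult_left_mono norm_skew_le z) auto
    finally show ?thesis .
  qed
  moreover have "norm (skew (damp (P t z))) \<le> K * (q * (c * norm2 z))"
  proof -
    have "norm (skew (damp (P t z))) \<le> K * norm (skew (P t z))" by (rule norm_skew_damp[OF P.dom[OF t z1(1)]])
    also have "\<dots> \<le> K * (q * norm (skew z))" by (intro mult_left_mono norm_skew_P z1 t K_nonneg)
    also have "\<dots> \<le> K * (q * (c * norm2 z))"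
      using q_pos K_nonneg by (intro mult_left_mono norm_skew_le z) auto
    finally show ?thesis .
  qed
  ultimately show ?thesis by (simp add: \<kappa>3_def algebra_simps)
qed


lemma \<kappa>_pos': "\<kappa> > 0" using \<kappa>_pos b_nonneg by (simp add: \<kappa>_def add_pos_nonneg)

lemma energy_0 [simp]: "energy 0 0 = 0" by (simp add: energy_def norm_Pair)

text \<open>With the velocity \<open>s *\<^sub>R snd\<close>, orbits of both damped semigroups solve
  the same damped equation, which is why the discrete semigroups differ only by a sign of the
  velocity. The Galerkin solution starts at the projected data, so the error consists of the
  residuals alone.\<close>

lemma one_step:
  assumes T: "contraction_semigroup T (D \<times> D) G" and z: "z \<in> D2" and GG: "G = Gp \<or> G = Gm"
    and s: "\<bar>s\<bar> = 1" and G: "\<And>z. G z = s *\<^sub>R skew z - damp z"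
    and sol: "gsol (prj (S (fst z))) (s *\<^sub>R prj (snd z)) p v"
  shows "energy (p \<tau> - prj (S (fst (T \<tau> z)))) (v \<tau> - s *\<^sub>R prj (snd (T \<tau> z))) \<le> 2 * \<tau> * (\<epsilon> * (\<kappa> * norm2 z))"
proof -
  interpret T: contraction_semigroup T "D \<times> D" G by (rule T)
  note Gb = generator_bounds[OF z GG] and z1 = D2D(1)[OF z]
  have ss: "s * s = 1" using s by (simp add: abs_square_eq_1 power2_eq_square[symmetric])
  have fG: "fst (G z) = s *\<^sub>R R (snd z)" for z by (simp add: G skew_def damp_def)
  note sm = smooth_path_semigroup[OF T fG z1 Gb(1)]
  have prj_s: "prj (s *\<^sub>R x) = s *\<^sub>R prj x" if "x \<in> D" for x
    using s that by (cases "s \<ge> 0") (auto simp: abs_if prj_minus split: if_splits)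
  have mem: "T t z \<in> D \<times> D" if "t \<ge> 0" for t by (rule T.dom[OF that z1])
  have mem': "fst (T t z) \<in> D" "snd (T t z) \<in> D" if "t \<ge> 0" for t using mem[OF that] by (auto simp: mem_Times_iff)
  have "energy (p \<tau> - prj (S (fst (T \<tau> z)))) (v \<tau> - prj (s *\<^sub>R snd (T \<tau> z)))
    \<le> energy (p 0 - prj (S (fst (T 0 z)))) (v 0 - prj (s *\<^sub>R snd (T 0 z)))
      + (2 * integral {0..\<tau>} (\<lambda>_. 0) + 2 * \<tau> * (\<epsilon> * (\<kappa>2 * norm2 z + b * (\<kappa>1 * norm2 z))))"
  proof (rule consistency(1)[OF sm(1) \<tau>_pos _ _ gsol_weak[OF sol] _ _ approx \<epsilon>_nonneg, where g="\<lambda>_. 0"])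
    fix t assume t: "t \<in> {0..\<tau>}"
    then have t0: "t \<ge> 0" by simp
    show "norm (R (s *\<^sub>R snd (T t z))) \<le> \<kappa>1 * norm2 z"
      unfolding sm(2)[OF t0] using norm_fst_snd_le(1)[of "T t (G z)"] T.contr[OF t0, of "G z"] Gb(2) by linarith
    show "norm (R (s *\<^sub>R snd (G (T t z)))) \<le> \<kappa>2 * norm2 z"
      unfolding sm(3)[OF t0] using norm_fst_snd_le(1)[of "T t (G (G z))"] T.contr[OF t0, of "G (G z)"] Gb(3) by linarith
    fix \<phi> assume \<phi>: "\<phi> \<in> V"
    have "s *\<^sub>R snd (G (T t z)) = - R (fst (T t z)) - s *\<^sub>R B (snd (T t z))"
      using ss by (simp add: G skew_def damp_def scaleR_diff_right)
    moreover have "B (s *\<^sub>R snd (T t z)) = s *\<^sub>R B (snd (T t z))"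
      using bounded_linear.linear[OF linear_B] by (simp add: linear_cmul)
    ultimately show "inner (s *\<^sub>R snd (G (T t z))) \<phi> + inner (R (S (fst (T t z)))) (R \<phi>) + 1 * inner (B (s *\<^sub>R snd (T t z))) \<phi> = inner 0 \<phi>"
      using R_sym[OF mem'(1)[OF t0] V_memD[OF \<phi>]] by (simp add: inner_diff_left)
  qed (simp_all add: integrable_0)
  also have "energy (p 0 - prj (S (fst (T 0 z)))) (v 0 - prj (s *\<^sub>R snd (T 0 z))) = 0"
    using sol mem'(2)[of 0] prj_s[of "snd z"] by (simp add: galerkin_solution_def)
  finally show ?thesis using prj_s[OF mem'(2)[of \<tau>]] \<tau>_pos by (simp add: \<kappa>_def algebra_simps)
qed

lemma enorm_diff: "enorm (x - y) = energy (fst x - fst y) (snd x - snd y)" by (simp add: enorm_def)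

lemma one_step_plus:
  assumes z: "z \<in> D2"
  shows "enorm (plus_h (ph z) - ph (P \<tau> z)) \<le> 2 * \<tau> * (\<epsilon> * (\<kappa> * norm2 z))"
proof -
  obtain p v where sol: "gsol (prj (S (fst z))) (prj (snd z)) p v" using gsol_exists by (meson prj_mem)
  then have "plus_h (ph z) = (p \<tau>, v \<tau>)" by (intro plus_h_eq) (auto simp: ph_def)
  then show ?thesis
    using one_step[OF contraction_P z, of 1 p v] sol by (simp add: enorm_def ph_def Gp_def)
qed

lemma one_step_minus:
  assumes z: "z \<in> D2"
  shows "enorm (minus_h (ph z) - ph (N \<tau> z)) \<le> 2 * \<tau> * (\<epsilon> * (\<kappa> * norm2 z))"
proof -
  have "- prj (snd z) \<in> V" by (intro V_closed) simp
  then obtain p v where sol: "gsol (prj (S (fst z))) (- prj (snd z)) p v" using gsol_exists by (meson prj_mem)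
  then have "minus_h (ph z) = (p \<tau>, - v \<tau>)" by (intro minus_h_eq) (auto simp: ph_def)
  moreover have "energy x (- y - w) = energy x (y + w)" for x y w
    using energy_minus[of x "y + w"] by simp
  ultimately show ?thesis
    using one_step[OF contraction_N z, of "-1" p v] sol by (simp add: enorm_def ph_def Gm_def)
qed

lemma VV_diff: "x \<in> V \<times> V \<Longrightarrow> y \<in> V \<times> V \<Longrightarrow> x - y \<in> V \<times> V"
  by (rule subspace_diff[OF subspace_VV])

lemma VV_add: "x \<in> V \<times> V \<Longrightarrow> y \<in> V \<times> V \<Longrightarrow> x + y \<in> V \<times> V"
  by (rule subspace_add[OF subspace_VV])

text \<open>The factor \<open>2 * \<tau> * \<kappa>\<close> is one half of a round trip. The 1 is
  the forward half at \<open>z\<close>; the backward half starts at \<open>P \<tau> z\<close>, whose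
  regularity costs \<open>\<kappa>3\<close>.\<close>

definition \<kappa>4 where "\<kappa>4 = 2 * \<tau> * \<kappa> * (1 + \<kappa>3)"

lemma one_step_L:
  assumes z: "z \<in> D2"
  shows "enorm (L_h (ph z) - ph (L \<tau> z)) \<le> \<epsilon> * \<kappa>4 * norm2 z"
proof -
  have \<tau>0: "\<tau> \<ge> 0" using \<tau>_pos by simp
  define x where "x = plus_h (ph z)"
  define y where "y = ph (P \<tau> z)"
  have x: "x \<in> V \<times> V" unfolding x_def by (rule plus_h(1)[OF ph_mem ph_mem])
  have y: "y \<in> V \<times> V" by (simp only: y_def ph_mem)
  have Pz: "P \<tau> z \<in> D2" by (rule P_D2[OF z \<tau>0])
  have "minus_h x = minus_h (x - y) + minus_h y"
    using minus_h(3)[OF VV_diff[OF x y] y] by simp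
  then have eq: "L_h (ph z) - ph (L \<tau> z) = minus_h (x - y) + (minus_h y - ph (L \<tau> z))"
    by (simp add: disc_L_def x_def)
  have "enorm (L_h (ph z) - ph (L \<tau> z)) \<le> enorm (minus_h (x - y)) + enorm (minus_h y - ph (L \<tau> z))"
    unfolding eq
    by (intro enorm_triangle VV_D VV_diff minus_h(1)[OF VV_diff[OF x y] y] minus_h(1)[OF y y] ph_mem)
  also have "enorm (minus_h (x - y)) \<le> 2 * \<tau> * (\<epsilon> * (\<kappa> * norm2 z))"
    using minus_h(2)[OF VV_diff[OF x y] y] one_step_plus[OF z] by (simp add: x_def y_def)
  also have "enorm (minus_h y - ph (L \<tau> z)) \<le> 2 * \<tau> * (\<epsilon> * (\<kappa> * norm2 (P \<tau> z)))"
    unfolding y_def L_def by (rule one_step_minus[OF Pz])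
  also have "\<dots> \<le> 2 * \<tau> * (\<epsilon> * (\<kappa> * (\<kappa>3 * norm2 z)))"
    using \<tau>0 \<epsilon>_nonneg \<kappa>_pos' by (intro mult_left_mono norm2_P z) auto
  finally show ?thesis by (simp add: \<kappa>4_def algebra_simps)
qed

lemma \<kappa>4_nonneg: "\<kappa>4 \<ge> 0" using \<tau>_pos \<kappa>_pos' \<kappa>_pos by (simp add: \<kappa>4_def)

text \<open>Each application adds one consistency error, taken at a power of \<open>L\<close> whose
  regularity is bounded by \<open>C\<close> independently of \<open>n\<close>, and
  \<open>L_h\<close> carries the earlier errors without growth. Hence the bound is linear in
  \<open>n\<close>.\<close>

lemma L_pow_error:
  assumes z: "z \<in> D2" and reg: "\<And>n. (L \<tau> ^^ n) z \<in> D2 \<and> norm2 ((L \<tau> ^^ n) z) \<le> C * norm2 z"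
  shows "enorm ((L_h ^^ n) (ph z) - ph ((L \<tau> ^^ n) z)) \<le> real n * (\<epsilon> * \<kappa>4 * (C * norm2 z))"
proof (induction n)
  case 0
  then show ?case by (simp add: enorm_def)
next
  case (Suc n)
  define x where "x = (L_h ^^ n) (ph z)"
  define y where "y = (L \<tau> ^^ n) z"
  have x: "x \<in> V \<times> V" unfolding x_def by (rule L_h_pow(1)[OF ph_mem ph_mem])
  have y: "y \<in> D2" "norm2 y \<le> C * norm2 z" using reg by (auto simp: y_def)
  have d: "x - ph y \<in> V \<times> V" by (rule VV_diff[OF x ph_mem])
  have "L_h x = L_h (x - ph y) + L_h (ph y)" using L_h(3)[OF d ph_mem, of y] by simp
  then have eq: "(L_h ^^ Suc n) (ph z) - ph ((L \<tau> ^^ Suc n) z) = L_h (x - ph y) + (L_h (ph y) - ph (L \<tau> y))"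
    by (simp add: x_def y_def)
  have "enorm ((L_h ^^ Suc n) (ph z) - ph ((L \<tau> ^^ Suc n) z)) \<le> enorm (L_h (x - ph y)) + enorm (L_h (ph y) - ph (L \<tau> y))"
    unfolding eq by (intro enorm_triangle VV_D VV_diff L_h(1)[OF d d] L_h(1)[OF ph_mem ph_mem] ph_mem)
  also have "enorm (L_h (x - ph y)) \<le> real n * (\<epsilon> * \<kappa>4 * (C * norm2 z))"
    using L_h(2)[OF d d] Suc by (simp add: x_def y_def)
  also have "enorm (L_h (ph y) - ph (L \<tau> y)) \<le> \<epsilon> * \<kappa>4 * (C * norm2 z)"
    using one_step_L[OF y(1)] mult_left_mono[OF y(2), of "\<epsilon> * \<kappa>4"] \<epsilon>_nonneg \<kappa>4_nonneg by simp
  finally show ?case by (simp add: algebra_simps)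
qed

text \<open>The first component is measured in the energy norm and uses the duality estimate, the
  second uses the approximation property directly; each contributes
  \<open>\<epsilon> * norm (skew z)\<close>, whence \<open>2 * c\<close>.\<close>

lemma projection_error:
  assumes z: "z \<in> D2"
  shows "enorm (phys z - ph z) \<le> \<epsilon> * (2 * c) * norm2 z"
proof -
  have mem: "fst z \<in> D" "snd z \<in> D" using z by (auto simp: D2_def mem_Times_iff)
  have "norm (R (S (fst z) - prj (S (fst z)))) \<le> \<epsilon> * norm (R (fst z))"
    using norm_R_prj_diff[OF approx, of "S (fst z)"] mem by simp
  moreover have "norm (snd z - prj (snd z)) \<le> \<epsilon> * norm (R (snd z))"
    using approx[OF mem(2)] by (simp add: norm_minus_commute)
  moreover have "norm (R (fst z)) \<le> norm (skew z)" "norm (R (snd z)) \<le> norm (skew z)"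
    using norm_fst_snd_le[of "skew z"] by (simp_all add: skew_def)
  ultimately have "norm (R (S (fst z) - prj (S (fst z)))) \<le> \<epsilon> * norm (skew z)"
    "norm (snd z - prj (snd z)) \<le> \<epsilon> * norm (skew z)"
    using \<epsilon>_nonneg by (meson mult_left_mono order_trans)+
  then have "enorm (phys z - ph z) \<le> \<epsilon> * norm (skew z) + \<epsilon> * norm (skew z)"
    unfolding enorm_diff energy_def phys_def ph_def fst_conv snd_conv
    by (meson add_mono norm_Pair_le order_trans)
  also have "\<dots> \<le> \<epsilon> * (c * norm2 z) + \<epsilon> * (c * norm2 z)"
    using \<epsilon>_nonneg norm_skew_le[OF z] by (intro add_mono mult_left_mono)
  finally show ?thesis by (simp add: algebra_simps)
qed

text \<open>Both observers are compared with the undamped solution: adding the discrete damped solution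
  started at \<open>ph z\<close> cancels the initial error of the forward observer, and its continuation by
  \<open>minus_h\<close>, run backwards, cancels the resulting final error.\<close>

lemma observer_error:
  assumes z: "z \<in> D2"
    and forward: "weak_sol \<tau> 1 f wp vp" "wp 0 = 0" "vp 0 = 0"
    and backward: "weak_sol \<tau> (-1) (\<lambda>t. - f t) wm vm" "wm \<tau> = wp \<tau>" "vm \<tau> = vp \<tau>"
    and F: "(\<lambda>t. norm (B (snd (U t z)) - f t)) integrable_on {0..\<tau>}"
  defines "I \<equiv> integral {0..\<tau>} (\<lambda>t. norm (B (snd (U t z)) - f t))"
  shows "\<exists>d\<in>V \<times> V. (wm 0, vm 0) + L_h (ph z) = ph z + d \<and>
    enorm d \<le> 4 * I + \<epsilon> * (4 * \<tau> * (1 + b * c)) * norm2 z"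
proof -
  interpret U: contraction_semigroup U "D \<times> D" skew by (rule contraction_U)
  have \<tau>0: "0 \<in> {0..\<tau>}" "\<tau> \<in> {0..\<tau>}" using \<tau>_pos by auto
  note z1 = D2D[OF z]
  have fG: "fst (skew w) = 1 *\<^sub>R R (snd w)" for w by (simp add: skew_def)
  note sm = smooth_path_semigroup[OF contraction_U fG z1, unfolded scaleR_one]
  define \<Phi> where "\<Phi> = 2 * I + 2 * \<tau> * (\<epsilon> * (norm2 z + b * (c * norm2 z)))"
  have mem: "fst (U t z) \<in> D" "snd (U t z) \<in> D" if "t \<ge> 0" for t
    using U.dom[OF that z1(1)] by (auto simp: mem_Times_iff)
  have bounds: "norm (R (snd (U t z))) \<le> c * norm2 z" "norm (R (snd (skew (U t z)))) \<le> norm2 z" if "t \<in> {0..\<tau>}" for t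
  proof -
    have t0: "t \<ge> 0" using that by simp
    show "norm (R (snd (U t z))) \<le> c * norm2 z"
      unfolding sm(2)[OF t0]
      using norm_fst_snd_le(1)[of "U t (skew z)"] U.contr[OF t0, of "skew z"] norm_skew_le[OF z] by linarith
    show "norm (R (snd (skew (U t z)))) \<le> norm2 z"
      unfolding sm(3)[OF t0]
      using norm_fst_snd_le(1)[of "U t (skew (skew z))"] U.contr[OF t0, of "skew (skew z)"] by linarith
  qed
  have pde: "inner (snd (skew (U t z))) \<phi> + inner (R (S (fst (U t z)))) (R \<phi>) = 0" if "t \<in> {0..\<tau>}" "\<phi> \<in> V" for t \<phi>
    using R_sym[OF mem(1)[of t] V_memD[OF that(2)]] that by (simp add: skew_def)
  obtain p1 v1 where sol1: "gsol (fst (ph z)) (snd (ph z)) p1 v1"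
    using gsol_exists[of "fst (ph z)" "snd (ph z)"] by (auto simp: ph_def)
  have plus: "plus_h (ph z) = (p1 \<tau>, v1 \<tau>)" by (rule plus_h_eq[OF ph_mem sol1])
  have V1: "p1 \<tau> \<in> V" "- v1 \<tau> \<in> V" using gsol_memD[OF sol1 \<tau>0(2)] by (auto intro: V_closed)
  obtain p2 v2 where sol2: "gsol (p1 \<tau>) (- v1 \<tau>) p2 v2" using gsol_exists[OF V1] by blast
  have Lh: "L_h (ph z) = (p2 \<tau>, - v2 \<tau>)"
    unfolding disc_L_def plus
    by (rule minus_h_eq) (use sol2 V1 gsol_memD[OF sol1 \<tau>0(2)] in auto)
  have ini1: "p1 0 = prj (S (fst z))" "v1 0 = prj (snd z)" "p2 0 = p1 \<tau>" "v2 0 = - v1 \<tau>"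
    using sol1 sol2 by (auto simp: galerkin_solution_def ph_def)
  have e1: "energy (wp \<tau> + 1 *\<^sub>R p1 \<tau> - prj (S (fst (U \<tau> z)))) (vp \<tau> + 1 *\<^sub>R v1 \<tau> - prj (snd (U \<tau> z)))
    \<le> energy (wp 0 + 1 *\<^sub>R p1 0 - prj (S (fst (U 0 z)))) (vp 0 + 1 *\<^sub>R v1 0 - prj (snd (U 0 z))) + \<Phi>"
    unfolding \<Phi>_def I_def
  proof (rule consistency(1)[OF sm(1) \<tau>_pos _ _ weak_sol_linear[OF forward(1) gsol_weak[OF sol1], of 1]
        F _ approx \<epsilon>_nonneg bounds, where g="\<lambda>t. B (snd (U t z))"])
    show "inner (snd (skew (U t z))) \<phi> + inner (R (S (fst (U t z)))) (R \<phi>) + 1 * inner (B (snd (U t z))) \<phi>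
        = inner (B (snd (U t z))) \<phi>" if "t \<in> {0..\<tau>}" "\<phi> \<in> V" for t \<phi> using pde[OF that] by simp
  qed (simp_all add: norm_minus_commute)
  \<comment> \<open>At time \<open>\<tau>\<close> the reversed solution has value
    \<open>p1 \<tau>\<close> and velocity \<open>v1 \<tau>\<close>, so the energy on the right is
    the one bounded by \<open>e1\<close>.\<close>
  have e2: "energy (wm 0 + 1 *\<^sub>R p2 (\<tau> - 0) - prj (S (fst (U 0 z)))) (vm 0 + 1 *\<^sub>R (- v2 (\<tau> - 0)) - prj (snd (U 0 z)))
    \<le> energy (wm \<tau> + 1 *\<^sub>R p2 (\<tau> - \<tau>) - prj (S (fst (U \<tau> z)))) (vm \<tau> + 1 *\<^sub>R (- v2 (\<tau> - \<tau>)) - prj (snd (U \<tau> z))) + \<Phi>"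
    unfolding \<Phi>_def I_def
  proof (rule consistency(2)[OF sm(1) \<tau>_pos _ _ weak_sol_linear[OF backward(1) gsol_reverse_weak[OF sol2], of 1]
        F _ approx \<epsilon>_nonneg bounds, where g="\<lambda>t. - B (snd (U t z))"])
    show "inner (snd (skew (U t z))) \<phi> + inner (R (S (fst (U t z)))) (R \<phi>) + - 1 * inner (B (snd (U t z))) \<phi>
        = inner (- B (snd (U t z))) \<phi>" if "t \<in> {0..\<tau>}" "\<phi> \<in> V" for t \<phi> using pde[OF that] by simp
  qed (simp_all add: norm_minus_commute)
  define d where "d = (wm 0, vm 0) + L_h (ph z) - ph z"
  have "fst d = wm 0 + p2 \<tau> - prj (S (fst z))" "snd d = vm 0 - v2 \<tau> - prj (snd z)"
    by (simp_all add: d_def Lh) (simp_all add: ph_def)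
  \<comment> \<open>One \<open>\<Phi>\<close> for each observer; the initial energy in
    \<open>e1\<close> is zero.\<close>
  then have "energy (fst d) (snd d) \<le> 2 * \<Phi>"
    using e1 e2 by (simp add: ini1 forward backward)
  then have "enorm d \<le> 4 * I + \<epsilon> * (4 * \<tau> * (1 + b * c)) * norm2 z"
    by (simp add: enorm_def \<Phi>_def algebra_simps)
  moreover have "d \<in> V \<times> V"
    unfolding d_def using weak_sol_memD[OF backward(1) \<tau>0(1)]
    by (intro VV_diff VV_add L_h(1)[OF ph_mem ph_mem] ph_mem) auto
  ultimately show ?thesis by (intro bexI[of _ d]) (auto simp: d_def)
qed

lemma enorm_minus: "w \<in> D \<times> D \<Longrightarrow> enorm (- w) = enorm w"
  by (auto simp: enorm_def energy_def R_minus norm_Pair)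

theorem reconstruction_error:
  assumes z: "z \<in> D2" and reg: "\<And>n. (L \<tau> ^^ n) z \<in> D2 \<and> norm2 ((L \<tau> ^^ n) z) \<le> C * norm2 z" and C: "C \<ge> 0"
    and forward: "weak_sol \<tau> 1 f wp vp" "wp 0 = 0" "vp 0 = 0"
    and backward: "weak_sol \<tau> (-1) (\<lambda>t. - f t) wm vm" "wm \<tau> = wp \<tau>" "vm \<tau> = vp \<tau>"
    and F: "(\<lambda>t. norm (B (snd (U t z)) - f t)) integrable_on {0..\<tau>}"
  defines "I \<equiv> integral {0..\<tau>} (\<lambda>t. norm (B (snd (U t z)) - f t))"
  shows "(\<Sum>n\<le>M. (L_h ^^ n) (wm 0, vm 0)) \<in> V \<times> V"
    and "enorm (phys z - (\<Sum>n\<le>M. (L_h ^^ n) (wm 0, vm 0)))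
      \<le> norm ((L \<tau> ^^ Suc M) z) + 4 * (real M + 1) * I
        + \<epsilon> * (real M + 1) * (4 * \<tau> * (1 + b * c) + \<kappa>4 * C + 2 * c * (1 + C)) * norm2 z"
proof -
  obtain d where d: "d \<in> V \<times> V" "(wm 0, vm 0) + L_h (ph z) = ph z + d"
      "enorm d \<le> 4 * I + \<epsilon> * (4 * \<tau> * (1 + b * c)) * norm2 z"
    using observer_error[OF z forward backward F] unfolding I_def by blast
  obtain s where s: "s \<in> V \<times> V" "enorm s \<le> (real M + 1) * enorm d"
    "(\<Sum>n\<le>M. (L_h ^^ n) (wm 0, vm 0)) + (L_h ^^ Suc M) (ph z) = ph z + s"
    using neumann_sum[OF ph_mem d(1,2)] by blast
  define \<Sigma> where "\<Sigma> = (\<Sum>n\<le>M. (L_h ^^ n) (wm 0, vm 0))"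
  define x where "x = (L \<tau> ^^ Suc M) z"
  define y where "y = (L_h ^^ Suc M) (ph z)"
  have y: "y \<in> V \<times> V" unfolding y_def by (rule L_h_pow(1)[OF ph_mem ph_mem])
  have x: "x \<in> D2" "norm2 x \<le> C * norm2 z" using reg by (auto simp only: x_def)
  have \<Sigma>: "\<Sigma> = ph z + s - y" using s(3) by (simp add: \<Sigma>_def y_def algebra_simps)
  have "\<Sigma> \<in> V \<times> V" unfolding \<Sigma> by (intro VV_diff VV_add ph_mem s y)
  then show "(\<Sum>n\<le>M. (L_h ^^ n) (wm 0, vm 0)) \<in> V \<times> V" by (simp only: \<Sigma>_def)
  have Dx: "z \<in> D \<times> D" "x \<in> D \<times> D" using z x(1) D2D(1) by auto
  have m1: "phys z - ph z \<in> D \<times> D" "ph x - phys x \<in> D \<times> D" "phys x \<in> D \<times> D" "y - ph x \<in> D \<times> D" "- s \<in> D \<times> D"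
    by (intro DD_diff DD_neg phys_mem VV_D ph_mem y s Dx)+
  \<comment> \<open>In order: projection error of the data, accumulated observer errors, discrete
    against continuous power of \<open>L\<close>, projection error of that power, and the truncated
    tail itself.\<close>
  have "phys z - \<Sigma> = (phys z - ph z) + (- s + ((y - ph x) + ((ph x - phys x) + phys x)))"
    by (simp add: \<Sigma>)
  then have "enorm (phys z - \<Sigma>) \<le> enorm (phys z - ph z) + (enorm (- s) + (enorm (y - ph x) + (enorm (ph x - phys x) + enorm (phys x))))"
    by (smt (verit, best) DD_add enorm_triangle m1)
  moreover have "enorm (phys z - ph z) \<le> \<epsilon> * (2 * c) * norm2 z" by (rule projection_error[OF z])
  moreover have "enorm (ph x - phys x) \<le> \<epsilon> * (2 * c) * (C * norm2 z)"
  proof -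
    have "\<epsilon> * (2 * c) * norm2 x \<le> \<epsilon> * (2 * c) * (C * norm2 z)"
      using \<epsilon>_nonneg c_pos x(2) by (intro mult_left_mono) auto
    moreover have "enorm (ph x - phys x) = enorm (phys x - ph x)" using enorm_minus[OF m1(2)] by simp
    ultimately show ?thesis using projection_error[OF x(1)] by linarith
  qed
  moreover have "enorm (y - ph x) \<le> real (Suc M) * (\<epsilon> * \<kappa>4 * (C * norm2 z))"
    unfolding y_def x_def by (rule L_pow_error[OF z reg])
  moreover have "enorm (- s) \<le> (real M + 1) * (4 * I + \<epsilon> * (4 * \<tau> * (1 + b * c)) * norm2 z)"
  proof -
    have "(real M + 1) * enorm d \<le> (real M + 1) * (4 * I + \<epsilon> * (4 * \<tau> * (1 + b * c)) * norm2 z)"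
      by (intro mult_left_mono d(3)) simp
    then show ?thesis using s(2) enorm_minus[OF VV_D[OF s(1)]] by linarith
  qed
  ultimately have "enorm (phys z - \<Sigma>) \<le> \<epsilon> * (2 * c) * norm2 z
      + ((real M + 1) * (4 * I + \<epsilon> * (4 * \<tau> * (1 + b * c)) * norm2 z)
      + (real (Suc M) * (\<epsilon> * \<kappa>4 * (C * norm2 z)) + (\<epsilon> * (2 * c) * (C * norm2 z) + norm x)))"
    using enorm_phys[of x] by linarith
  also have "\<dots> = norm x + 4 * (real M + 1) * I
        + \<epsilon> * (real M + 1) * (4 * \<tau> * (1 + b * c) + \<kappa>4 * C) * norm2 z + 1 * (\<epsilon> * (2 * c * (1 + C)) * norm2 z)"
    by (simp add: algebra_simps)
  \<comment> \<open>The projection errors do not grow with \<open>M\<close>; the factor 1 is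
    enlarged to \<open>M + 1\<close> only to collect the terms.\<close>
  also have "\<dots> \<le> norm x + 4 * (real M + 1) * I
        + \<epsilon> * (real M + 1) * (4 * \<tau> * (1 + b * c) + \<kappa>4 * C) * norm2 z + (real M + 1) * (\<epsilon> * (2 * c * (1 + C)) * norm2 z)"
    using \<epsilon>_nonneg c_pos C by (intro add_left_mono mult_right_mono) auto
  finally show "enorm (phys z - (\<Sum>n\<le>M. (L_h ^^ n) (wm 0, vm 0)))
      \<le> norm ((L \<tau> ^^ Suc M) z) + 4 * (real M + 1) * I
        + \<epsilon> * (real M + 1) * (4 * \<tau> * (1 + b * c) + \<kappa>4 * C + 2 * c * (1 + C)) * norm2 z"
    by (simp add: \<Sigma>_def x_def algebra_simps)
qed

end

section \<open>Transport between the energy space and the product space\<close>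

context positive_root begin

text \<open>\<open>T\<close> is specified only on the carrier, so it is conjugated with
  \<open>phys\<close> before and \<open>emb\<close> after; this yields operators on a complete type
  whose norm is the energy norm. The graph equality gives both directions of the generator relation,
  and contractivity follows from \<open>diss\<close>.\<close>

lemma contraction_semigroup_transport:
  assumes T: "semigroup_generated_by (D \<times> UNIV) (energy_norm R) T D' G'"
    and dom: "\<And>z. z \<in> D \<times> D \<longleftrightarrow> phys z \<in> D'"
    and G: "\<And>z. z \<in> D \<times> D \<Longrightarrow> G z = emb (G' (phys z))"
    and diss: "\<And>z. z \<in> D \<times> D \<Longrightarrow> inner (G z) z \<le> 0"
  shows "contraction_semigroup (\<lambda>t z. emb (T t (phys z))) (D \<times> D) G"
    and "\<And>t z. t \<ge> 0 \<Longrightarrow> z \<in> D \<times> UNIV \<Longrightarrow> T t z \<in> D \<times> UNIV"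
proof -
  have C0: "C0_semigroup (D \<times> UNIV) (energy_norm R) T"
    and graph: "{(x, G' x) | x. x \<in> D'} = {(x, y). x \<in> D \<times> UNIV \<and> y \<in> D \<times> UNIV \<and>
          ((\<lambda>t. energy_norm R ((1 / t) *\<^sub>R (T t x - x) - y)) \<longlongrightarrow> 0) (at_right 0)}"
    using T by (auto simp only: semigroup_generated_by_def)
  have gr: "x \<in> D' \<and> G' x = y \<longleftrightarrow> x \<in> D \<times> UNIV \<and> y \<in> D \<times> UNIV \<and>
          ((\<lambda>t. energy_norm R ((1 / t) *\<^sub>R (T t x - x) - y)) \<longlongrightarrow> 0) (at_right 0)" for x y
  proof -
    have "(x, y) \<in> {(x, G' x) | x. x \<in> D'} \<longleftrightarrow> x \<in> D' \<and> G' x = y" by blast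
    then show ?thesis using eqset_imp_iff[OF graph, of "(x, y)"] by simp
  qed
  have lin: "T t (x + y) = T t x + T t y" "T t (a *\<^sub>R x) = a *\<^sub>R T t x"
    if "t \<ge> 0" "x \<in> D \<times> UNIV" "y \<in> D \<times> UNIV" for t x y a
    using C0 that unfolding C0_semigroup_def bounded_linear_on_def by blast+
  have bnd: "\<exists>K. \<forall>x\<in>D \<times> UNIV. T t x \<in> D \<times> UNIV \<and> energy_norm R (T t x) \<le> K * energy_norm R x" if "t \<ge> 0" for t
    using C0 that unfolding C0_semigroup_def bounded_linear_on_def maps_boundedly_def by blast
  then show X: "T t z \<in> D \<times> UNIV" if "t \<ge> 0" "z \<in> D \<times> UNIV" for t z using that by blast
  have zero: "T 0 x = x" if "x \<in> D \<times> UNIV" for x using C0 that unfolding C0_semigroup_def by blast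
  have add: "T (s + t) x = T s (T t x)" if "s \<ge> 0" "t \<ge> 0" "x \<in> D \<times> UNIV" for s t x
    using C0 that unfolding C0_semigroup_def by blast
  have cont: "((\<lambda>t. energy_norm R (T t x - x)) \<longlongrightarrow> 0) (at_right 0)" if "x \<in> D \<times> UNIV" for x
    using C0 that unfolding C0_semigroup_def by blast
  have quot: "((\<lambda>t. (1 / t) *\<^sub>R (emb (T t (phys z)) - z)) \<longlongrightarrow> emb y) (at_right 0) \<longleftrightarrow>
      ((\<lambda>t. energy_norm R ((1 / t) *\<^sub>R (T t (phys z) - phys z) - y)) \<longlongrightarrow> 0) (at_right 0)"
    if y: "y \<in> D \<times> UNIV" for z y
  proof -
    have "((\<lambda>t. energy_norm R ((1 / t) *\<^sub>R (T t (phys z) - phys z) - y)) \<longlongrightarrow> 0) (at_right 0) \<longleftrightarrow>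
        ((\<lambda>t. norm ((1 / t) *\<^sub>R (emb (T t (phys z)) - z) - emb y)) \<longlongrightarrow> 0) (at_right 0)"
    proof (rule filterlim_cong[OF refl refl])
      show "eventually (\<lambda>t. energy_norm R ((1 / t) *\<^sub>R (T t (phys z) - phys z) - y)
          = norm ((1 / t) *\<^sub>R (emb (T t (phys z)) - z) - emb y)) (at_right 0)"
        using eventually_at_right_less
        by eventually_elim (simp add: norm_emb_quotient X y del: mem_Times_iff)
    qed
    also have "\<dots> \<longleftrightarrow> ((\<lambda>t. (1 / t) *\<^sub>R (emb (T t (phys z)) - z)) \<longlongrightarrow> emb y) (at_right 0)"
      by (simp add: tendsto_norm_zero_iff LIM_zero_iff)
    finally show ?thesis ..
  qed
  show "contraction_semigroup (\<lambda>t z. emb (T t (phys z))) (D \<times> D) G"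
  proof (rule contraction_semigroupI[OF _ _ _ _ _ _ diss dense_DD])
    show "bounded_linear (\<lambda>z. emb (T t (phys z)))" if t: "t \<ge> 0" for t
    proof -
      obtain K where K: "\<And>x. x \<in> D \<times> UNIV \<Longrightarrow> energy_norm R (T t x) \<le> K * energy_norm R x"
        using bnd[OF t] by blast
      show ?thesis
      proof (rule bounded_linear_intro[where K=K])
        show "emb (T t (phys (x + y))) = emb (T t (phys x)) + emb (T t (phys y))" for x y
          by (simp only: linear_add[OF linear_phys] lin(1)[OF t phys_X phys_X] emb_add[OF X[OF t phys_X] X[OF t phys_X]])
        show "emb (T t (phys (a *\<^sub>R x))) = a *\<^sub>R emb (T t (phys x))" for a x
          by (simp only: linear_cmul[OF linear_phys] lin(2)[OF t phys_X phys_X] emb_scale[OF X[OF t phys_X]])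
        show "norm (emb (T t (phys x))) \<le> norm x * K" for x
          using K[OF phys_X[of x]] norm_emb[of "phys x"] by (simp add: norm_emb mult.commute)
      qed
    qed
    show "emb (T 0 (phys x)) = x" for x by (simp only: zero[OF phys_X] emb_phys)
    show "emb (T (s + t) (phys x)) = emb (T s (phys (emb (T t (phys x)))))" if "s \<ge> 0" "t \<ge> 0" for s t x
      by (simp only: add[OF that phys_X] phys_emb[OF X[OF that(2) phys_X]])
    show "((\<lambda>t. emb (T t (phys x))) \<longlongrightarrow> x) (at_right 0)" for x
    proof -
      have "((\<lambda>t. norm (emb (T t (phys x)) - x)) \<longlongrightarrow> 0) (at_right 0)"
      proof (rule Lim_transform_eventually[OF cont[OF phys_X[of x]]])
        show "eventually (\<lambda>t. energy_norm R (T t (phys x) - phys x) = norm (emb (T t (phys x)) - x)) (at_right 0)"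
          using eventually_at_right_less
          by eventually_elim (simp add: norm_emb[symmetric] emb_diff X del: mem_Times_iff)
      qed
      then show ?thesis by (simp add: tendsto_norm_zero_iff LIM_zero_iff)
    qed
    show "((\<lambda>t. (1 / t) *\<^sub>R (emb (T t (phys x)) - x)) \<longlongrightarrow> G x) (at_right 0)" if x: "x \<in> D \<times> D" for x
      using gr[of "phys x" "G' (phys x)"] quot[of "G' (phys x)" x] dom[of x] x G[OF x] by simp
    show "x \<in> D \<times> D \<and> G x = y" if "((\<lambda>t. (1 / t) *\<^sub>R (emb (T t (phys x)) - x)) \<longlongrightarrow> y) (at_right 0)" for x y
    proof -
      have "phys x \<in> D' \<and> G' (phys x) = phys y"
        unfolding gr using quot[of "phys y" x] that by simp
      then have "x \<in> D \<times> D" "G' (phys x) = phys y" using dom by auto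
      then show ?thesis using G by simp
    qed
  qed
qed

text \<open>A derivative in the energy norm becomes an ordinary one under \<open>emb\<close>, and
  uniqueness then applies. This identifies the observed velocity with that of the orbit of
  \<open>U\<close>.\<close>

lemma classical_solution_emb:
  assumes z: "classical_solution (energy_norm R) D' A z" and D': "D' \<subseteq> D \<times> UNIV"
    and A: "\<And>x. x \<in> D' \<Longrightarrow> A x \<in> D \<times> UNIV \<and> emb (A x) = skew (emb x) \<and> emb x \<in> D \<times> D"
  shows "t \<in> {0..\<tau>} \<Longrightarrow> emb (z t) = U t (emb (z 0))"
proof (rule undamped_unique[of \<tau> "\<lambda>t. emb (z t)"])
  fix t assume t: "t \<in> {0..\<tau>}"
  have zD: "z s \<in> D'" if "s \<ge> 0" for s using z that by (simp add: classical_solution_def)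
  then show "emb (z t) \<in> D \<times> D" using A t by simp
  have lim: "((\<lambda>s. energy_norm R ((1 / (s - t)) *\<^sub>R (z s - z t) - A (z t))) \<longlongrightarrow> 0) (at t within {0..})"
    using z t by (simp add: classical_solution_def has_deriv_wrt_def)
  have "((\<lambda>s. norm ((1 / (s - t)) *\<^sub>R (emb (z s) - emb (z t)) - emb (A (z t)))) \<longlongrightarrow> 0) (at t within {0..})"
  proof (rule Lim_transform_eventually[OF lim])
    have "energy_norm R ((1 / (s - t)) *\<^sub>R (z s - z t) - A (z t))
      = norm ((1 / (s - t)) *\<^sub>R (emb (z s) - emb (z t)) - emb (A (z t)))" if "s \<ge> 0" for s
      by (rule norm_emb_quotient) (use zD A D' that t in \<open>auto simp del: mem_Times_iff\<close>)
    then show "eventually (\<lambda>s. energy_norm R ((1 / (s - t)) *\<^sub>R (z s - z t) - A (z t))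
      = norm ((1 / (s - t)) *\<^sub>R (emb (z s) - emb (z t)) - emb (A (z t)))) (at t within {0..})"
      by (auto simp: eventually_at_filter)
  qed
  then have "((\<lambda>t. emb (z t)) has_vector_derivative emb (A (z t))) (at t within {0..})"
    unfolding has_vector_derivative_quotient by (simp add: tendsto_norm_zero_iff)
  then show "((\<lambda>t. emb (z t)) has_vector_derivative skew (emb (z t))) (at t within {0..\<tau>})"
    using A[OF zD] t by (auto intro: has_vector_derivative_within_subset)
qed

text \<open>Makes the observability inequality, which quantifies over classical solutions, available
  for every \<open>z\<close> in the domain.\<close>

lemma classical_solution_phys:
  assumes z: "z \<in> D \<times> D" and D': "\<And>x. x \<in> D \<times> D \<Longrightarrow> phys x \<in> D'"
    and A: "\<And>x. x \<in> D \<times> D \<Longrightarrow> A (phys x) \<in> D \<times> UNIV \<and> emb (A (phys x)) = skew x"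
  shows "classical_solution (energy_norm R) D' A (\<lambda>t. phys (U t z))"
  unfolding classical_solution_def has_deriv_wrt_def
proof (intro allI impI conjI)
  interpret U: contraction_semigroup U "D \<times> D" skew by (rule contraction_U)
  fix t :: real assume t: "t \<ge> 0"
  have Uz: "U t z \<in> D \<times> D" by (rule U.dom[OF t z])
  then show "phys (U t z) \<in> D'" by (rule D')
  have "((\<lambda>s. U s z) has_vector_derivative skew (U t z)) (at t within {0..t+1})"
    by (rule U.has_derivative_T_comp[OF z]) (use t in simp)
  also have "at t within {0..t+1} = at t within {0..}"
    by (rule at_within_nhd[of _ "{..<t+1}"]) auto
  finally have "((\<lambda>s. norm ((1 / (s - t)) *\<^sub>R (U s z - U t z) - skew (U t z))) \<longlongrightarrow> 0) (at t within {0..})"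
    unfolding has_vector_derivative_quotient by (simp add: tendsto_norm_zero_iff)
  moreover have "norm ((1 / (s - t)) *\<^sub>R (U s z - U t z) - skew (U t z))
    = energy_norm R ((1 / (s - t)) *\<^sub>R (phys (U s z) - phys (U t z)) - A (phys (U t z)))" for s
    using norm_emb_quotient[OF phys_X phys_X, of "A (phys (U t z))"] A[OF Uz] by simp
  ultimately show "((\<lambda>s. energy_norm R ((1 / (s - t)) *\<^sub>R (phys (U s z) - phys (U t z)) - A (phys (U t z)))) \<longlongrightarrow> 0) (at t within {0..})"
    by simp
qed

end

text \<open>Ensures that the output error in the estimate is a genuine integral and not the default
  value 0 of a non-integrable function.\<close>

lemma bochner_L1_integrable_norm_diff:
  fixes y :: "real \<Rightarrow> 'y::real_normed_vector" and A :: "'y \<Rightarrow> 'b::real_normed_vector"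
  assumes y: "bochner_L1 \<tau> y" and A: "bounded_linear A" and g: "continuous_on {0..\<tau>} g"
  shows "(\<lambda>t. norm (g t - A (y t))) integrable_on {0..\<tau>}"
proof -
  let ?M = "lebesgue_on {0..\<tau>}"
  obtain S where S: "countable S" "AE t in ?M. y t \<in> closure S"
    and ym: "y \<in> borel_measurable ?M" and yi: "integrable ?M (\<lambda>t. norm (y t))"
    using y unfolding bochner_L1_def by blast
  obtain K where K: "\<And>x. norm (A x) \<le> norm x * K" using bounded_linear.bounded[OF A] by blast
  have meas: "(\<lambda>t. norm (g t - A (y t))) \<in> borel_measurable ?M"
  proof (rule measurable_norm_diff[OF _ g])
    show "(\<lambda>t. A (y t)) \<in> borel_measurable ?M"
      by (rule measurable_compose[OF ym borel_measurable_continuous_onI[OF linear_continuous_on[OF A]]])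
    show "countable (A ` S)" using S(1) by simp
    have "A ` closure S \<subseteq> closure (A ` S)"
      using linear_continuous_on[OF A, of "closure S"] by (intro image_closure_subset) (auto simp: closure_subset)
    then show "AE t in ?M. A (y t) \<in> closure (A ` S)" using S(2) by (auto elim!: AE_mp)
  qed
  have gi: "integrable ?M (\<lambda>t. norm (g t))"
    using absolutely_integrable_continuous_real[of 0 \<tau> "\<lambda>t. norm (g t)"] g
    by (simp add: absolutely_integrable_iff_lebesgue_on continuous_on_norm)
  have "integrable ?M (\<lambda>t. norm (g t - A (y t)))"
  proof (rule Bochner_Integration.integrable_bound[OF Bochner_Integration.integrable_add[OF gi integrable_mult_left[OF yi, of K]] meas])
    show "AE t in ?M. norm (norm (g t - A (y t))) \<le> norm (norm (g t) + norm (y t) * K)"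
    proof (rule AE_I2)
      fix t
      have "norm (g t - A (y t)) \<le> norm (g t) + norm (y t) * K"
        using norm_triangle_ineq4[of "g t" "A (y t)"] K[of "y t"] by linarith
      then show "norm (norm (g t - A (y t))) \<le> norm (norm (g t) + norm (y t) * K)" by simp
    qed
  qed
  then have "(\<lambda>t. norm (g t - A (y t))) absolutely_integrable_on {0..\<tau>}"
    by (simp only: absolutely_integrable_iff_lebesgue_on)
  then show ?thesis by (rule set_lebesgue_integral_eq_integral(1))
qed

context galerkin_flow begin

text \<open>Pairing with a fixed test vector turns the Bochner integrable acceleration into a scalar
  function dominated by a multiple of its norm. That \<open>v\<close> stays in \<open>V\<close>
  follows from \<open>w\<close> doing so.\<close>

lemma weak_wave_weak_sol:
  assumes sol: "weak_wave_solution R B' V \<tau> f w v" and B': "\<And>x. B' x = \<beta> *\<^sub>R B x"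
  shows "weak_sol \<tau> \<beta> f w v"
proof -
  obtain a where w: "\<And>t. t \<in> {0..\<tau>} \<Longrightarrow> w t \<in> V \<and> (w has_vector_derivative v t) (at t within {0..\<tau>})"
    and a: "bochner_L1 \<tau> a" "\<And>t. t \<in> {0..\<tau>} \<Longrightarrow> (a has_integral (v t - v 0)) {0..t}"
    and eq: "AE t in lebesgue_on {0..\<tau>}. \<forall>\<phi>\<in>V.
           inner (a t) \<phi> + inner (R (w t)) (R \<phi>) + inner (B' (v t)) \<phi> = inner (f t) \<phi>"
    using sol unfolding weak_wave_solution_def by blast
  obtain Z where Z: "negligible Z" "\<And>t. t \<in> {0..\<tau>} - Z \<Longrightarrow> \<forall>\<phi>\<in>V.
           inner (a t) \<phi> + inner (R (w t)) (R \<phi>) + inner (B' (v t)) \<phi> = inner (f t) \<phi>"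
    using AE_lebesgue_on_negligible[OF eq] by auto
  show ?thesis
    unfolding weak_sol_def
  proof (intro conjI ballI exI[of _ a] exI[of _ Z])
    show "v t \<in> V" if "t \<in> {0..\<tau>}" for t
      using EV.derivative_in_span[of w "v t" t \<tau>] w that \<tau>_pos by (simp add: EV(2))
    show "(\<lambda>t. inner (a t) \<phi>) absolutely_integrable_on {0..\<tau>}" for \<phi>
      unfolding absolutely_integrable_iff_lebesgue_on
    proof (rule Bochner_Integration.integrable_bound)
      show "integrable (lebesgue_on {0..\<tau>}) (\<lambda>t. norm (a t) * norm \<phi>)"
        using a(1) unfolding bochner_L1_def by (intro integrable_mult_left) blast
      have "a \<in> borel_measurable (lebesgue_on {0..\<tau>})" using a(1) unfolding bochner_L1_def by blast
      then show "(\<lambda>t. inner (a t) \<phi>) \<in> borel_measurable (lebesgue_on {0..\<tau>})"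
        by (rule measurable_compose) (intro borel_measurable_continuous_onI continuous_intros)
    qed (simp add: Cauchy_Schwarz_ineq2)
    show "((\<lambda>s. inner (a s) \<phi>) has_integral inner (v t - v 0) \<phi>) {0..t}" if "t \<in> {0..\<tau>}" for t \<phi>
      using has_integral_linear[OF a(2)[OF that] bounded_linear_inner_left, of \<phi>] by (simp add: o_def)
    show "inner (a t) \<phi> + inner (R (w t)) (R \<phi>) + \<beta> * inner (B (v t)) \<phi> = inner (f t) \<phi>"
      if "t \<in> {0..\<tau>} - Z" "\<phi> \<in> V" for t \<phi>
      using Z(2)[OF that(1)] that(2) by (simp add: B')
  qed (use w Z in auto)
qed

end

section \<open>The norm of \<open>L\<close> and an error bound uniform in the discretization\<close>

context damped_wave begin

definition L_norm where "L_norm t = Sup {norm (L t z) | z. norm z \<le> 1}"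

lemma L_norm_bound: assumes t: "t \<ge> 0" shows "norm (L t z) \<le> L_norm t * norm z"
proof (cases "z = 0")
  case True
  then show ?thesis using linear_0[OF linear_L[OF t]] by simp
next
  case False
  have "bdd_above {norm (L t z) | z. norm z \<le> 1}"
    using norm_L[OF t] by (intro bdd_aboveI[of _ 1]) (auto intro: order_trans)
  moreover have "norm ((1 / norm z) *\<^sub>R z) \<le> 1" using False by simp
  ultimately have "norm (L t ((1 / norm z) *\<^sub>R z)) \<le> L_norm t"
    unfolding L_norm_def by (intro cSup_upper) blast+
  then show ?thesis using False by (simp add: linear_cmul[OF linear_L[OF t]] field_simps)
qed

lemma L_norm_le: assumes "\<And>z. norm (L t z) \<le> \<rho> * norm z" "\<rho> \<ge> 0" shows "L_norm t \<le> \<rho>"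
  unfolding L_norm_def
proof (rule cSup_least)
  show "{norm (L t z) | z. norm z \<le> 1} \<noteq> {}" by (auto simp del: split_paired_Ex intro!: exI[of _ 0])
  fix x assume "x \<in> {norm (L t z) | z. norm z \<le> 1}"
  then obtain z where z: "x = norm (L t z)" "norm z \<le> 1" by blast
  have "\<rho> * norm z \<le> \<rho> * 1" by (intro mult_left_mono z assms)
  then show "x \<le> \<rho>" using assms(1)[of z] z by simp
qed

lemma L_norm_pow: assumes t: "t \<ge> 0" and "L_norm t \<ge> 0"
  shows "norm ((L t ^^ n) z) \<le> L_norm t ^ n * norm z"
proof (induction n)
  case (Suc n)
  have "norm (L t ((L t ^^ n) z)) \<le> L_norm t * norm ((L t ^^ n) z)" by (rule L_norm_bound[OF t])
  also have "\<dots> \<le> L_norm t * (L_norm t ^ n * norm z)" by (intro mult_left_mono Suc assms)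
  finally show ?case by (simp add: mult.assoc)
qed simp

text \<open>The order of the quantifiers is the point: \<open>C\<close> may depend on
  \<open>\<tau>\<close>, but is fixed before the Galerkin space, \<open>\<epsilon>\<close>, the data
  and the truncation. So the final bound on \<open>h\<close> can be chosen from it.\<close>

lemma uniform_reconstruction_error:
  assumes \<tau>: "\<tau> > 0" and \<eta>: "L_norm \<tau> < 1"
  shows "\<exists>C>0. \<forall>V (C0 :: 'h \<Rightarrow> 'y::real_inner) \<epsilon> z f wp vp wm vm M.
    wave_galerkin D R S c B P N b K V C0 \<tau> \<epsilon> \<and> z \<in> D2 \<and>
    galerkin.weak_sol R B V \<tau> 1 f wp vp \<and> wp 0 = 0 \<and> vp 0 = 0 \<and>
    galerkin.weak_sol R B V \<tau> (-1) (\<lambda>t. - f t) wm vm \<and> wm \<tau> = wp \<tau> \<and> vm \<tau> = vp \<tau> \<and>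
    (\<lambda>t. norm (B (snd (U t z)) - f t)) integrable_on {0..\<tau>} \<longrightarrow>
    (let \<Sigma> = (\<Sum>n\<le>M. (disc_L R C0 V \<tau> ^^ n) (wm 0, vm 0)) in
      \<Sigma> \<in> D \<times> D \<and> energy_norm R (phys z - \<Sigma>)
      \<le> norm ((L \<tau> ^^ Suc M) z)
        + 4 * (real M + 1) * integral {0..\<tau>} (\<lambda>t. norm (B (snd (U t z)) - f t))
        + \<epsilon> * (real M + 1) * C * norm (skew (skew z)))"
proof -
  obtain C where C: "C > 0" "\<And>z n. z \<in> D2 \<Longrightarrow> (L \<tau> ^^ n) z \<in> D2 \<and> norm (skew (skew ((L \<tau> ^^ n) z))) \<le> C * norm (skew (skew z))"
    using L_pow_regularity[OF less_imp_le[OF \<tau>] \<eta> L_norm_bound[OF less_imp_le[OF \<tau>]]] by blast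
  \<comment> \<open>The constant of \<open>reconstruction_error\<close> with
    \<open>\<kappa>4\<close> unfolded, since \<open>\<kappa>4\<close> belongs to a context that
    fixes the Galerkin space.\<close>
  define C' where "C' = 4 * \<tau> * (1 + b * c) + 2 * \<tau> * \<kappa> * (1 + \<kappa>3) * C + 2 * c * (1 + C)"
  have "C' > 0"
  proof -
    have "\<kappa> \<ge> 0" "\<kappa>3 \<ge> 0"
      using b_nonneg c_pos K_nonneg q_pos by (simp_all add: \<kappa>_def \<kappa>1_def \<kappa>2_def \<kappa>3_def)
    then show ?thesis unfolding C'_def using \<tau> b_nonneg c_pos C(1)
      by (intro add_nonneg_pos add_nonneg_nonneg) auto
  qed
  moreover have "(\<Sum>n\<le>M. (disc_L R C0 V \<tau> ^^ n) (wm 0, vm 0)) \<in> D \<times> D \<and>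
      energy_norm R (phys z - (\<Sum>n\<le>M. (disc_L R C0 V \<tau> ^^ n) (wm 0, vm 0)))
      \<le> norm ((L \<tau> ^^ Suc M) z)
        + 4 * (real M + 1) * integral {0..\<tau>} (\<lambda>t. norm (B (snd (U t z)) - f t))
        + \<epsilon> * (real M + 1) * C' * norm (skew (skew z))"
    if wg: "wave_galerkin D R S c B P N b K V C0 \<tau> \<epsilon>" and z: "z \<in> D2"
      and f: "galerkin.weak_sol R B V \<tau> 1 f wp vp" "wp 0 = 0" "vp 0 = 0"
      and bw: "galerkin.weak_sol R B V \<tau> (-1) (\<lambda>t. - f t) wm vm" "wm \<tau> = wp \<tau>" "vm \<tau> = vp \<tau>"
      and F: "(\<lambda>t. norm (B (snd (U t z)) - f t)) integrable_on {0..\<tau>}"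
    for V and C0 :: "'h \<Rightarrow> 'y" and \<epsilon> z f wp vp wm vm M
  proof -
    interpret wg: wave_galerkin D R S c B P N b K V C0 \<tau> \<epsilon> by (rule wg)
    have en: "energy_norm R x = wg.enorm x" for x
      by (simp add: wg.enorm_def wg.energy_def energy_norm_def norm_Pair)
    show ?thesis
      using wg.reconstruction_error[OF z C(2)[OF z] less_imp_le[OF C(1)] f bw F, of M] wg.VV_D
      unfolding C'_def en wg.\<kappa>4_def by (simp del: mem_Times_iff)
  qed
  ultimately show ?thesis unfolding Let_def by blast
qed

end

text \<open>For \<open>N \<ge> A / \<tau>\<close> the second term on the right suffices; the finitely many other \<open>N\<close> are covered
  by the first one once \<open>h\<close> is small.\<close>

lemma step_size_exists:
  fixes \<theta> \<tau> \<eta> A h0 :: real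
  assumes "\<theta> > 0" "\<tau> > 0" "0 < \<eta>" "\<eta> < 1" "A > 0" "h0 > 0"
  shows "\<exists>hs>0. hs \<le> h0 \<and> (\<forall>h\<in>{0<..<hs}. \<forall>N::nat. N > 0 \<longrightarrow>
    h powr \<theta> * (A * real N) \<le> \<eta> ^ (N + 1) / (1 - \<eta>) + h powr \<theta> * \<tau> * (real N)\<^sup>2)"
proof -
  define n where "n = nat \<lceil>A / \<tau>\<rceil>"
  \<comment> \<open>Chosen so that \<open>r * (A * n + 1)\<close> is the smallest power of
    \<open>\<eta>\<close> needed below the threshold \<open>n\<close>; the \<open>+ 1\<close> keeps
    the denominator positive. \<open>hs\<close> makes
    \<open>h powr \<theta> \<le> r\<close>.\<close>
  define r where "r = \<eta> ^ (n + 1) / (A * real n + 1)"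
  have An: "A * real n + 1 > 0" using assms by (simp add: add_nonneg_pos)
  have r: "r > 0" using An assms by (simp add: r_def)
  define hs where "hs = min h0 (r powr (1 / \<theta>))"
  have "h powr \<theta> * (A * real N) \<le> \<eta> ^ (N + 1) / (1 - \<eta>) + h powr \<theta> * \<tau> * (real N)\<^sup>2"
    if h: "h \<in> {0<..<hs}" and N: "N > 0" for h and N :: nat
  proof (cases "A / \<tau> \<le> real N")
    case True
    then have "A \<le> \<tau> * real N" using assms by (simp add: field_simps)
    then have "h powr \<theta> * (A * real N) \<le> h powr \<theta> * (\<tau> * real N * real N)"
      by (intro mult_left_mono mult_right_mono) auto
    moreover have "0 \<le> \<eta> ^ (N + 1) / (1 - \<eta>)" using assms by simp
    ultimately show ?thesis by (simp add: power2_eq_square mult.assoc)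
  next
    case False
    then have Nn: "N \<le> n" unfolding n_def by linarith
    have "h powr \<theta> \<le> (r powr (1 / \<theta>)) powr \<theta>" using h assms by (intro powr_mono2) (auto simp: hs_def)
    also have "\<dots> = r" using assms r by (simp add: powr_powr)
    finally have "h powr \<theta> * (A * real N) \<le> r * (A * real n + 1)"
      using Nn assms r by (intro mult_mono) (auto intro: add_increasing2 mult_left_mono)
    also have "\<dots> = \<eta> ^ (n + 1)" using An by (simp add: r_def)
    also have "\<dots> \<le> \<eta> ^ (N + 1)" using assms Nn by (intro power_decreasing) auto
    also have "\<dots> \<le> \<eta> ^ (N + 1) / (1 - \<eta>)" using assms by (simp add: le_divide_eq mult_left_le)
    also have "\<dots> \<le> \<eta> ^ (N + 1) / (1 - \<eta>) + h powr \<theta> * \<tau> * (real N)\<^sup>2" using assms by simp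
    finally show ?thesis .
  qed
  then show ?thesis using assms r by (intro exI[of _ hs]) (auto simp: hs_def)
qed

theorem theorem3p1:
  fixes D0 D12 :: "'h::{real_inner, complete_space} set"
    and A0 R :: "'h \<Rightarrow> 'h"
    and C0 :: "'h \<Rightarrow> 'y::{real_inner, complete_space}"
    and Tp Tm :: "real \<Rightarrow> 'h \<times> 'h \<Rightarrow> 'h \<times> 'h"
    and Hh :: "real \<Rightarrow> 'h set"
    and \<theta> :: real
  assumes "self_adjoint_on D0 A0" and "strictly_positive_on D0 A0"
    and "is_sqrt_of D12 R D0 A0"
    and "bounded_linear C0"
    and "maps_boundedly (dom_three_halves D0 A0 D12) (norm_three_halves A0 R)
           (\<lambda>x. adjoint C0 (C0 x))"
    and "maps_boundedly D12 (\<lambda>x. norm (R x)) (\<lambda>x. adjoint C0 (C0 x))"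
    and "semigroup_generated_by (D12 \<times> UNIV) (energy_norm R) Tp (D0 \<times> D12)
           (\<lambda>z. wave_op A0 z - obs_gram C0 z)"
    and "semigroup_generated_by (D12 \<times> UNIV) (energy_norm R) Tm (D0 \<times> D12)
           (\<lambda>z. - wave_op A0 z - obs_gram C0 z)"
    and "\<forall>h>0. subspace (Hh h) \<and> (\<exists>B. finite B \<and> span B = Hh h) \<and> Hh h \<subseteq> D12"
    and "\<theta> > 0"
    and "\<exists>M0>0. \<exists>h0>0. \<forall>h\<in>{0<..<h0}. \<forall>\<phi>\<in>D12.
           norm (energy_proj R (Hh h) \<phi> - \<phi>) \<le> M0 * h powr \<theta> * norm (R \<phi>)"
  shows "\<exists>M>0. \<forall>\<tau>>0. exactly_observable D0 A0 D12 R C0 \<tau> \<longrightarrow>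
    (\<exists>hs>0. \<forall>w0\<in>dom_three_halves D0 A0 D12. \<forall>w1\<in>D0. \<forall>w v.
      classical_solution (energy_norm R) (D0 \<times> D12) (wave_op A0) (\<lambda>t. (w t, v t)) \<and>
      w 0 = w0 \<and> v 0 = w1 \<longrightarrow>
      (\<forall>h\<in>{0<..<hs}. \<forall>N::nat. \<forall>yh wp vp wm vm.
        N > 0 \<and> bochner_L1 \<tau> yh \<and>
        forward_observer R C0 (Hh h) \<tau> yh wp vp \<and>
        backward_observer R C0 (Hh h) \<tau> yh (wp \<tau>) (vp \<tau>) wm vm \<longrightarrow>
        (let \<eta> = op_norm_on (D12 \<times> UNIV) (energy_norm R) (\<lambda>z. Tm \<tau> (Tp \<tau> z));
             (w0h, w1h) = (\<Sum>n\<le>N. (disc_L R C0 (Hh h) \<tau> ^^ n) (wm 0, vm 0))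
         in norm (R (w0 - w0h)) + norm (w1 - w1h)
            \<le> M * ((\<eta> ^ (N + 1) / (1 - \<eta>) + h powr \<theta> * \<tau> * (real N)\<^sup>2)
                     * (norm_three_halves A0 R w0 + norm (A0 w1))
                   + real N * integral {0..\<tau>} (\<lambda>s. norm (adjoint C0 (C0 (v s) - yh s)))))))"
proof -
  obtain S c where root: "positive_root D12 R S c"
    using square_root_facts[OF assms(1-3)] by blast
  interpret positive_root D12 R S c by (rule root)
  have D0: "D0 = {x\<in>D12. R x \<in> D12}" and AR: "\<And>x. x \<in> D0 \<Longrightarrow> A0 x = R (R x)"
    using assms(3) unfolding is_sqrt_of_def by (elim conjE; blast)+
  define B where "B x = adjoint C0 (C0 x)" for x
  have adj: "inner (adjoint C0 y) x = inner y (C0 x)" for x y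
    using inner_adjoint[OF assms(4), of x y] by (simp add: inner_commute)
  have adj_bl: "bounded_linear (adjoint C0)" by (rule bounded_linear_adjoint[OF assms(4)])
  have B_bl: "bounded_linear B"
    unfolding B_def by (rule bounded_linear_compose[OF adj_bl assms(4)])
  have B_sym: "inner (B x) y = inner x (B y)" for x y
    unfolding B_def adj by (rule inner_adjoint[OF assms(4)])
  have B_inner: "inner (B x) x = (norm (C0 x))\<^sup>2" for x
    unfolding B_def adj by (simp add: power2_norm_eq_inner)
  obtain k where k: "k > 0" "\<And>x. norm (C0 x) \<le> norm x * k"
    using bounded_linear.pos_bounded[OF assms(4)] by blast
  define b where "b = k\<^sup>2"
  have b: "b \<ge> 0" by (simp add: b_def)
  have B_sq: "(norm (B x))\<^sup>2 \<le> b * inner (B x) x" for x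
  proof -
    have "norm (B x) * norm (B x) = inner (C0 x) (C0 (B x))"
      unfolding B_def adj[symmetric] by (simp add: power2_norm_eq_inner[symmetric] power2_eq_square)
    also have "\<dots> \<le> norm (C0 x) * norm (C0 (B x))" by (rule norm_cauchy_schwarz)
    also have "\<dots> \<le> norm (C0 x) * (norm (B x) * k)" by (intro mult_left_mono k) simp
    finally have "norm (B x) * norm (B x) \<le> norm (B x) * (k * norm (C0 x))" by (simp add: mult_ac)
    then have "norm (B x) \<le> k * norm (C0 x)" using k(1) by (cases "B x = 0") auto
    then have "(norm (B x))\<^sup>2 \<le> (k * norm (C0 x))\<^sup>2" by (intro power_mono) auto
    then show ?thesis by (simp add: B_inner b_def power_mult_distrib)
  qed
  obtain K0 where K0: "\<And>x. x \<in> D12 \<Longrightarrow> B x \<in> D12 \<and> norm (R (B x)) \<le> K0 * norm (R x)"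
    using assms(6) unfolding maps_boundedly_def B_def by blast
  define K where "K = \<bar>K0\<bar>"
  have K_nonneg: "K \<ge> 0" by (simp add: K_def)
  have K: "x \<in> D12 \<Longrightarrow> B x \<in> D12" "x \<in> D12 \<Longrightarrow> norm (R (B x)) \<le> K * norm (R x)" for x
    using K0[of x] mult_right_mono[OF abs_ge_self[of K0] norm_ge_zero[of "R x"]] by (auto simp: K_def)
  have B_pos: "inner (B x) x \<ge> 0" for x by (simp add: B_inner)
  have dom: "z \<in> D12 \<times> D12 \<longleftrightarrow> phys z \<in> D0 \<times> D12" for z
    by (auto simp: phys_def D0 mem_Times_iff)
  have A0S: "A0 (S x) = R x" if "x \<in> D12" for x using AR[of "S x"] that by (simp add: D0)
  define P where "P t z = emb (Tp t (phys z))" for t z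
  define Q where "Q t z = emb (Tm t (phys z))" for t z
  have gram: "obs_gram C0 z = (0, B (snd z))" for z by (simp add: obs_gram_def obs_op_def B_def)
  have inner_damp: "inner (0, B (snd z)) z \<ge> 0" for z :: "'h \<times> 'h"
    using B_pos[of "snd z"] by (simp add: inner_prod_def)
  note transport_P = contraction_semigroup_transport[OF assms(7) dom, of "\<lambda>z. skew z - (0, B (snd z))"]
  note transport_Q = contraction_semigroup_transport[OF assms(8) dom, of "\<lambda>z. - skew z - (0, B (snd z))"]
  have GP: "skew z - (0, B (snd z)) = emb (wave_op A0 (phys z) - obs_gram C0 (phys z))"
    and GQ: "- skew z - (0, B (snd z)) = emb (- wave_op A0 (phys z) - obs_gram C0 (phys z))"
    if "z \<in> D12 \<times> D12" for z
    using that by (auto simp: skew_def emb_def wave_op_def phys_def gram A0S R_minus)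
  have disP: "inner (skew z - (0, B (snd z))) z \<le> 0" and disQ: "inner (- skew z - (0, B (snd z))) z \<le> 0"
    if "z \<in> D12 \<times> D12" for z
    using skew_inner[OF that] inner_damp[of z] by (simp_all add: inner_diff_left)
  have sgP: "contraction_semigroup P (D12 \<times> D12) (\<lambda>z. skew z - (0, B (snd z)))"
    unfolding P_def by (rule transport_P(1)[OF GP disP])
  have sgQ: "contraction_semigroup Q (D12 \<times> D12) (\<lambda>z. - skew z - (0, B (snd z)))"
    unfolding Q_def by (rule transport_Q(1)[OF GQ disQ])
  have TpX: "Tp t z \<in> D12 \<times> UNIV" if "t \<ge> 0" "z \<in> D12 \<times> UNIV" for t z by (rule transport_P(2)[OF GP disP that])
  have TmX: "Tm t z \<in> D12 \<times> UNIV" if "t \<ge> 0" "z \<in> D12 \<times> UNIV" for t z by (rule transport_Q(2)[OF GQ disQ that])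
  interpret W: damped_wave D12 R S c B P Q b K
    by (rule damped_wave.intro[OF root sgP sgQ damped_wave_axioms.intro])
      (fact B_bl B_sym B_sq b K K_nonneg)+
  have \<eta>_eq: "op_norm_on (D12 \<times> UNIV) (energy_norm R) (\<lambda>z. Tm \<tau> (Tp \<tau> z)) = W.L_norm \<tau>" if \<tau>: "\<tau> \<ge> 0" for \<tau>
  proof -
    have L: "W.L \<tau> z = emb (Tm \<tau> (Tp \<tau> (phys z)))" for z
      unfolding W.L_def P_def Q_def by (simp only: phys_emb[OF TpX[OF \<tau> phys_X]])
    have "{energy_norm R (Tm \<tau> (Tp \<tau> z)) | z. z \<in> D12 \<times> UNIV \<and> energy_norm R z \<le> 1} = {norm (W.L \<tau> z) | z. norm z \<le> 1}"
    proof (intro equalityI subsetI; elim CollectE exE conjE)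
      fix r z assume "r = energy_norm R (Tm \<tau> (Tp \<tau> z))" "z \<in> D12 \<times> UNIV" "energy_norm R z \<le> 1"
      then show "r \<in> {norm (W.L \<tau> z) | z. norm z \<le> 1}"
        using norm_emb[of "Tm \<tau> (Tp \<tau> z)"] norm_emb[of z] L[of "emb z"] phys_emb[of z]
        by (intro CollectI exI[of _ "emb z"]) simp
    next
      fix r z assume "r = norm (W.L \<tau> z)" "norm z \<le> 1"
      then show "r \<in> {energy_norm R (Tm \<tau> (Tp \<tau> z)) | z. z \<in> D12 \<times> UNIV \<and> energy_norm R z \<le> 1}"
        using norm_emb[of "phys z"] norm_emb[of "Tm \<tau> (Tp \<tau> (phys z))"] L[of z] phys_X[of z]
        by (intro CollectI exI[of _ "phys z"]) simp
    qed
    then show ?thesis by (simp add: op_norm_on_def W.L_norm_def)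
  qed
  have strict: "0 \<le> W.L_norm \<tau> \<and> W.L_norm \<tau> < 1" if \<tau>: "\<tau> > 0" and obs: "exactly_observable D0 A0 D12 R C0 \<tau>" for \<tau>
  proof -
    obtain l where l: "l > 0" "\<And>z. classical_solution (energy_norm R) (D0 \<times> D12) (wave_op A0) z \<Longrightarrow>
        integral {0..\<tau>} (\<lambda>t. (norm (obs_op C0 (z t)))\<^sup>2) \<ge> l\<^sup>2 * (energy_norm R (z 0))\<^sup>2"
      using obs unfolding exactly_observable_def by blast
    have "l\<^sup>2 * (norm z)\<^sup>2 \<le> integral {0..\<tau>} (\<lambda>t. inner (B (snd (U t z))) (snd (U t z)))" if z: "z \<in> D12 \<times> D12" for z
    proof -
      interpret U: contraction_semigroup U "D12 \<times> D12" skew by (rule contraction_U)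
      have "classical_solution (energy_norm R) (D0 \<times> D12) (wave_op A0) (\<lambda>t. phys (U t z))"
      proof (rule classical_solution_phys[OF z])
        show "phys x \<in> D0 \<times> D12" if "x \<in> D12 \<times> D12" for x using dom that by blast
        show "wave_op A0 (phys x) \<in> D12 \<times> UNIV \<and> emb (wave_op A0 (phys x)) = skew x" if "x \<in> D12 \<times> D12" for x
          using that by (auto simp: wave_op_def phys_def emb_def skew_def A0S)
      qed
      moreover have "energy_norm R (phys z) = norm z" "snd (phys x) = snd x" for x
        using norm_emb[of "phys z"] by (simp_all add: phys_def[of x])
      ultimately show ?thesis
        using l(2)[of "\<lambda>t. phys (U t z)"] by (simp add: obs_op_def B_inner)
    qed
    from W.L_strict_contraction[OF \<tau> l(1) this]
    obtain \<rho> where \<rho>: "0 \<le> \<rho>" "\<rho> < 1" "\<And>z. norm (W.L \<tau> z) \<le> \<rho> * norm z" by blast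
    \<comment> \<open>A negative value would make every vector zero, and then the supremum is taken
      over \<open>{0}\<close>.\<close>
    have "0 \<le> W.L_norm \<tau>"
    proof (rule ccontr)
      assume neg: "\<not> 0 \<le> W.L_norm \<tau>"
      have "norm (W.L \<tau> z) = 0 \<and> norm z = 0" for z
      proof -
        have "norm z = 0"
        proof (rule ccontr)
          assume "norm z \<noteq> 0"
          then have "W.L_norm \<tau> * norm z < 0" using neg by (intro mult_neg_pos) auto
          then show False using W.L_norm_bound[of \<tau> z] \<tau> norm_ge_zero[of "W.L \<tau> z"] by linarith
        qed
        then show ?thesis using W.L_norm_bound[of \<tau> z] \<tau> by simp
      qed
      then have "{norm (W.L \<tau> z) | z. norm z \<le> 1} = {0}" by auto
      then show False using neg by (simp add: W.L_norm_def)
    qed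
    then show ?thesis using W.L_norm_le[OF \<rho>(3,1)] \<rho>(2) by simp
  qed
  obtain M0 h0 where M0: "M0 > 0" "h0 > 0" "\<And>h \<phi>. h \<in> {0<..<h0} \<Longrightarrow> \<phi> \<in> D12 \<Longrightarrow>
      norm (energy_proj R (Hh h) \<phi> - \<phi>) \<le> M0 * h powr \<theta> * norm (R \<phi>)"
    using assms(11) by blast
  \<comment> \<open>The sum of the two norms is at most twice the energy norm. The tail contributes
    \<open>2 * c\<^sup>2\<close>, with \<open>c\<^sup>2\<close> from \<open>nz\<close>; the data
    error contributes 16, being twice 4 with \<open>N + 1 \<le> 2 * N\<close>; the discretization
    error, once absorbed, contributes 1. None of these involves \<open>\<tau>\<close>.\<close>
  define M where "M = 2 * c\<^sup>2 + 17"
  have "M > 0" by (simp add: M_def add_nonneg_pos)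
  moreover have "\<exists>hs>0. \<forall>w0\<in>dom_three_halves D0 A0 D12. \<forall>w1\<in>D0. \<forall>w v.
      classical_solution (energy_norm R) (D0 \<times> D12) (wave_op A0) (\<lambda>t. (w t, v t)) \<and>
      w 0 = w0 \<and> v 0 = w1 \<longrightarrow>
      (\<forall>h\<in>{0<..<hs}. \<forall>N::nat. \<forall>yh wp vp wm vm.
        N > 0 \<and> bochner_L1 \<tau> yh \<and>
        forward_observer R C0 (Hh h) \<tau> yh wp vp \<and>
        backward_observer R C0 (Hh h) \<tau> yh (wp \<tau>) (vp \<tau>) wm vm \<longrightarrow>
        (let \<eta> = op_norm_on (D12 \<times> UNIV) (energy_norm R) (\<lambda>z. Tm \<tau> (Tp \<tau> z));
             (w0h, w1h) = (\<Sum>n\<le>N. (disc_L R C0 (Hh h) \<tau> ^^ n) (wm 0, vm 0))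
         in norm (R (w0 - w0h)) + norm (w1 - w1h)
            \<le> M * ((\<eta> ^ (N + 1) / (1 - \<eta>) + h powr \<theta> * \<tau> * (real N)\<^sup>2)
                     * (norm_three_halves A0 R w0 + norm (A0 w1))
                   + real N * integral {0..\<tau>} (\<lambda>s. norm (adjoint C0 (C0 (v s) - yh s))))))"
    if \<tau>: "\<tau> > 0" and obs: "exactly_observable D0 A0 D12 R C0 \<tau>" for \<tau>
  proof -
    define \<eta> where "\<eta> = W.L_norm \<tau>"
    have \<tau>0: "\<tau> \<ge> 0" using \<tau> by simp
    have \<eta>: "0 \<le> \<eta>" "\<eta> < 1" using strict[OF \<tau> obs] by (auto simp: \<eta>_def)
    obtain C where C: "C > 0" and bound: "\<And>V (C0 :: 'h \<Rightarrow> 'y) \<epsilon> z f wp vp wm vm M.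
      wave_galerkin D12 R S c B P Q b K V C0 \<tau> \<epsilon> \<and> z \<in> W.D2 \<and>
      galerkin.weak_sol R B V \<tau> 1 f wp vp \<and> wp 0 = 0 \<and> vp 0 = 0 \<and>
      galerkin.weak_sol R B V \<tau> (-1) (\<lambda>t. - f t) wm vm \<and> wm \<tau> = wp \<tau> \<and> vm \<tau> = vp \<tau> \<and>
      (\<lambda>t. norm (B (snd (U t z)) - f t)) integrable_on {0..\<tau>} \<longrightarrow>
      (let \<Sigma> = (\<Sum>n\<le>M. (disc_L R C0 V \<tau> ^^ n) (wm 0, vm 0)) in
        \<Sigma> \<in> D12 \<times> D12 \<and> energy_norm R (phys z - \<Sigma>)
        \<le> norm ((W.L \<tau> ^^ Suc M) z)
          + 4 * (real M + 1) * integral {0..\<tau>} (\<lambda>t. norm (B (snd (U t z)) - f t))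
          + \<epsilon> * (real M + 1) * C * norm (skew (skew z)))"
      using W.uniform_reconstruction_error[OF \<tau> strict[OF \<tau> obs, THEN conjunct2], where ?'y = 'y] by blast
    \<comment> \<open>Twice the factor \<open>M0 * C\<close> of the discretization error, and
      another 2 from \<open>N + 1 \<le> 2 * N\<close>.\<close>
    define A where "A = 4 * M0 * C"
    have A: "A > 0" using M0 C by (simp add: A_def)
    \<comment> \<open>For \<open>\<eta> = 0\<close> any \<open>hs\<close> will do here, as the
      inequality is then not invoked: the data are zero.\<close>
    have "\<exists>hs>0. hs \<le> h0 \<and> (\<forall>h\<in>{0<..<hs}. \<forall>N::nat. N > 0 \<longrightarrow> \<eta> > 0 \<longrightarrow>
      h powr \<theta> * (A * real N) \<le> \<eta> ^ (N + 1) / (1 - \<eta>) + h powr \<theta> * \<tau> * (real N)\<^sup>2)"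
    proof (cases "\<eta> > 0")
      case True
      then show ?thesis using step_size_exists[OF assms(10) \<tau> True \<eta>(2) A M0(2)] by blast
    qed (use M0(2) in auto)
    then obtain hs where hs: "hs > 0" "hs \<le> h0" "\<And>h N. h \<in> {0<..<hs} \<Longrightarrow> N > (0::nat) \<Longrightarrow> \<eta> > 0 \<Longrightarrow>
      h powr \<theta> * (A * real N) \<le> \<eta> ^ (N + 1) / (1 - \<eta>) + h powr \<theta> * \<tau> * (real N)\<^sup>2" by blast
    have main: "norm (R (w0 - fst \<Sigma>)) + norm (w1 - snd \<Sigma>)
            \<le> M * ((\<eta> ^ (N + 1) / (1 - \<eta>) + h powr \<theta> * \<tau> * (real N)\<^sup>2)
                     * (norm_three_halves A0 R w0 + norm (A0 w1))
                   + real N * integral {0..\<tau>} (\<lambda>s. norm (adjoint C0 (C0 (v s) - yh s))))"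
      if w0: "w0 \<in> dom_three_halves D0 A0 D12" and w1: "w1 \<in> D0"
        and cl: "classical_solution (energy_norm R) (D0 \<times> D12) (wave_op A0) (\<lambda>t. (w t, v t))" "w 0 = w0" "v 0 = w1"
        and h: "h \<in> {0<..<hs}" and N: "N > 0" and yh: "bochner_L1 \<tau> yh"
        and fo: "forward_observer R C0 (Hh h) \<tau> yh wp vp"
        and bo: "backward_observer R C0 (Hh h) \<tau> yh (wp \<tau>) (vp \<tau>) wm vm"
        and \<Sigma>: "\<Sigma> = (\<Sum>n\<le>N. (disc_L R C0 (Hh h) \<tau> ^^ n) (wm 0, vm 0))"
      for w0 w1 w v h and N :: nat and yh wp vp wm vm \<Sigma>
    proof -
      define z where "z = (R w0, w1)"
      define V where "V = Hh h"
      define \<epsilon> where "\<epsilon> = M0 * h powr \<theta>"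
      define f where "f t = adjoint C0 (yh t)" for t
      have hpos: "h > 0" "h < h0" using h hs(2) by auto
      have \<epsilon>: "\<epsilon> \<ge> 0" using M0(1) by (simp add: \<epsilon>_def)
      have w0D: "w0 \<in> D12" "R w0 \<in> D12" "R (R w0) \<in> D12" "A0 w0 = R (R w0)"
        and w1D: "w1 \<in> D12" "R w1 \<in> D12" "A0 w1 = R (R w1)"
        using w0 w1 AR by (auto simp: dom_three_halves_def D0)
      have zD2: "z \<in> W.D2" using w0D w1D by (auto simp: W.D2_def z_def skew_def intro: D_closed)
      have zD: "z \<in> D12 \<times> D12" using w0D w1D by (simp add: z_def)
      have phys_z: "phys z = (w0, w1)" using w0D by (simp add: phys_def z_def)
      have gal: "galerkin D12 R S c B V b"
        using assms(9) hpos(1) W.norm_B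
        by (intro galerkin.intro galerkin_axioms.intro root B_bl B_pos b) (auto simp: V_def)
      have gf: "galerkin_flow D12 R S c B V b C0 \<tau>"
        by (intro galerkin_flow.intro galerkin_flow_axioms.intro gal \<tau>) (simp add: B_def)
      interpret gf: galerkin_flow D12 R S c B V b C0 \<tau> by (rule gf)
      have wg: "wave_galerkin D12 R S c B P Q b K V C0 \<tau> \<epsilon>"
      proof (intro wave_galerkin.intro wave_galerkin_axioms.intro gf \<epsilon>)
        show "damped_wave D12 R S c B P Q b K" by unfold_locales
        show "norm (gf.prj \<phi> - \<phi>) \<le> \<epsilon> * norm (R \<phi>)" if "\<phi> \<in> D12" for \<phi>
          using M0(3)[of h \<phi>] that hpos gf.energy_proj_eq[OF that] by (simp add: V_def \<epsilon>_def)
      qed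
      have fw': "weak_wave_solution R (\<lambda>x. adjoint C0 (C0 x)) V \<tau> f wp vp" "wp 0 = 0" "vp 0 = 0"
        using fo unfolding forward_observer_def f_def[abs_def] V_def by blast+
      have bw': "weak_wave_solution R (\<lambda>x. - adjoint C0 (C0 x)) V \<tau> (\<lambda>t. - f t) wm vm"
        "wm \<tau> = wp \<tau>" "vm \<tau> = vp \<tau>"
        using bo unfolding backward_observer_def f_def V_def by blast+
      have fw: "gf.weak_sol \<tau> 1 f wp vp"
        by (rule gf.weak_wave_weak_sol[OF fw'(1)]) (simp add: B_def)
      have bw: "gf.weak_sol \<tau> (-1) (\<lambda>t. - f t) wm vm"
        by (rule gf.weak_wave_weak_sol[OF bw'(1)]) (simp add: B_def)
      have vU: "v t = snd (U t z)" if "t \<in> {0..\<tau>}" for t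
      proof -
        have "emb (w t, v t) = U t (emb (w 0, v 0))"
        proof (rule classical_solution_emb[OF cl(1) _ _ that])
          show "D0 \<times> D12 \<subseteq> D12 \<times> UNIV" by (auto simp: D0)
          show "wave_op A0 x \<in> D12 \<times> UNIV \<and> emb (wave_op A0 x) = skew (emb x) \<and> emb x \<in> D12 \<times> D12"
            if "x \<in> D0 \<times> D12" for x
            using that AR by (auto simp: wave_op_def emb_def skew_def D0)
        qed
        then have "emb (w t, v t) = U t z" by (simp add: cl emb_def[of "(w0, w1)"] z_def)
        then have "snd (emb (w t, v t)) = snd (U t z)" by (rule arg_cong)
        then show ?thesis by (simp add: emb_def)
      qed
      interpret U: contraction_semigroup U "D12 \<times> D12" skew by (rule contraction_U)
      have int: "(\<lambda>t. norm (B (snd (U t z)) - f t)) integrable_on {0..\<tau>}"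
        unfolding f_def
        by (intro bochner_L1_integrable_norm_diff[OF yh adj_bl] bounded_linear.continuous_on[OF B_bl]
            continuous_on_snd U.continuous_T)
      define I where "I = integral {0..\<tau>} (\<lambda>s. norm (adjoint C0 (C0 (v s) - yh s)))"
      have I_eq: "integral {0..\<tau>} (\<lambda>t. norm (B (snd (U t z)) - f t)) = I"
        unfolding I_def
        by (rule integral_cong) (simp add: vU B_def f_def linear_diff[OF bounded_linear.linear[OF adj_bl]])
      have I0: "I \<ge> 0" unfolding I_eq[symmetric] by (rule integral_nonneg[OF int]) simp
      define Z where "Z = norm (skew (skew z))"
      have \<Sigma>b: "\<Sigma> \<in> D12 \<times> D12" "energy_norm R (phys z - \<Sigma>)
        \<le> norm ((W.L \<tau> ^^ Suc N) z) + 4 * (real N + 1) * I + \<epsilon> * (real N + 1) * C * Z"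
        using bound[of V C0 \<epsilon> z f wp vp wm vm N] wg zD2 fw fw'(2,3) bw bw'(2,3) int
        unfolding I_eq Z_def V_def[symmetric] \<Sigma> Let_def by blast+
      define \<sigma> where "\<sigma> = norm_three_halves A0 R w0 + norm (A0 w1)"
      have Z\<sigma>: "Z \<le> \<sigma>"
      proof -
        have "skew (skew z) = (- R (R (R w0)), - R (R w1))"
          using w0D w1D by (simp add: z_def skew_def R_minus)
        then show ?thesis
          using norm_Pair_le[of "- R (R (R w0))" "- R (R w1)"] w0D w1D
          by (simp add: Z_def \<sigma>_def norm_three_halves_def)
      qed
      have nz: "norm z \<le> c\<^sup>2 * Z"
      proof -
        have "skew z \<in> D12 \<times> D12" using zD2 unfolding W.D2_def by blast
        then have "c * norm (skew z) \<le> c * (c * Z)"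
          unfolding Z_def using c_pos by (intro mult_left_mono norm_le_skew) auto
        then show ?thesis using norm_le_skew[OF zD] by (simp add: power2_eq_square mult.assoc)
      qed
      define X where "X = \<eta> ^ (N + 1) / (1 - \<eta>)"
      have X: "X \<ge> 0" "\<eta> ^ (N + 1) \<le> X" using \<eta> by (simp_all add: X_def le_divide_eq mult_left_le)
      have T1: "norm ((W.L \<tau> ^^ Suc N) z) \<le> X * c\<^sup>2 * \<sigma>"
      proof -
        have "norm ((W.L \<tau> ^^ Suc N) z) \<le> \<eta> ^ (N + 1) * norm z"
          using W.L_norm_pow[OF \<tau>0, of "Suc N" z] \<eta>(1) by (simp add: \<eta>_def)
        also have "\<dots> \<le> X * (c\<^sup>2 * \<sigma>)"
          using X \<eta>(1) nz mult_left_mono[OF Z\<sigma>, of "c\<^sup>2"] by (intro mult_mono) auto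
        finally show ?thesis by (simp add: mult.assoc)
      qed
      have T2: "2 * \<epsilon> * (real N + 1) * C * Z \<le> (X + h powr \<theta> * \<tau> * (real N)\<^sup>2) * \<sigma>"
      proof (cases "\<eta> > 0")
        case True
        have "2 * \<epsilon> * (real N + 1) * C * Z \<le> 2 * \<epsilon> * (2 * real N) * C * Z"
          using N \<epsilon> C by (intro mult_right_mono mult_left_mono) (auto simp: Z_def)
        also have "\<dots> = h powr \<theta> * (A * real N) * Z" by (simp add: \<epsilon>_def A_def)
        also have "\<dots> \<le> (X + h powr \<theta> * \<tau> * (real N)\<^sup>2) * Z"
          unfolding X_def by (intro mult_right_mono hs(3)[OF h N True]) (simp add: Z_def)
        also have "\<dots> \<le> (X + h powr \<theta> * \<tau> * (real N)\<^sup>2) * \<sigma>"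
          using X \<tau> by (intro mult_left_mono Z\<sigma>) auto
        finally show ?thesis .
      next
        case False
        \<comment> \<open>\<open>L\<close> vanishes, yet it annihilates no nonzero vector of the
          domain, so \<open>z\<close> and the whole discretization error are zero.\<close>
        then have "W.L_norm \<tau> = 0" using \<eta>(1) by (simp add: \<eta>_def)
        then have "W.L \<tau> z = 0" using W.L_norm_bound[OF \<tau>0, of z] by simp
        then have "z = 0" using W.L_nonzero[OF zD \<tau>0] by blast
        then have "Z = 0" by (simp add: Z_def skew_def zero_prod_def[symmetric])
        moreover have "\<sigma> \<ge> 0" by (simp add: \<sigma>_def norm_three_halves_def)
        ultimately show ?thesis using X \<tau> by simp
      qed
      have fin: "norm (R (w0 - fst \<Sigma>)) + norm (w1 - snd \<Sigma>) \<le> 2 * energy_norm R (phys z - \<Sigma>)"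
      proof -
        have "norm (R (fst (phys z - \<Sigma>))) \<le> energy_norm R (phys z - \<Sigma>)"
          "norm (snd (phys z - \<Sigma>)) \<le> energy_norm R (phys z - \<Sigma>)"
          using norm_fst_snd_le[of "emb (phys z - \<Sigma>)"] unfolding norm_emb by (simp_all add: emb_def)
        then show ?thesis by (simp add: phys_z)
      qed
      have N1: "8 * (real N + 1) * I \<le> 16 * real N * I" using N I0 by (intro mult_right_mono) auto
      have \<sigma>0: "\<sigma> \<ge> 0" by (simp add: \<sigma>_def norm_three_halves_def)
      define Y where "Y = h powr \<theta> * \<tau> * (real N)\<^sup>2"
      have Y: "Y \<ge> 0" using \<tau> by (simp add: Y_def)
      have "norm (R (w0 - fst \<Sigma>)) + norm (w1 - snd \<Sigma>)
          \<le> 2 * (X * c\<^sup>2 * \<sigma>) + 16 * real N * I + (X + Y) * \<sigma>"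
        using fin \<Sigma>b(2) T1 T2 N1 unfolding Y_def by (simp add: algebra_simps)
      also have "\<dots> \<le> M * ((X + Y) * \<sigma> + real N * I)"
      proof -
        have "0 \<le> 2 * c\<^sup>2 * (Y * \<sigma>)" "0 \<le> 16 * ((X + Y) * \<sigma>)" "0 \<le> 2 * c\<^sup>2 * (real N * I)" "0 \<le> real N * I"
          using X Y \<sigma>0 I0 by simp_all
        then show ?thesis by (simp add: M_def algebra_simps)
      qed
      finally show ?thesis unfolding X_def Y_def \<sigma>_def I_def .
    qed
    show ?thesis
      unfolding \<eta>_eq[OF \<tau>0] \<eta>_def[symmetric] Let_def case_prod_beta
      using hs(1) main by blast
  qed
  ultimately show ?thesis by blast
qed

end
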